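(* Let $M$ be a $C^{2,1}$ manifold endowed with a locally Lipschitz spray. Let $O$ be an open neighborhood of $p\in M$. Then there is a reversible strictly convex normal neighborhood $C$ of $p$ contained in $O$, such that $\exp$ establishes a Lipeomorphism between an open star-shaped subset of $TC$ and $C\times C$. Analogously, $\widetilde{\exp}$ establishes a Lipeomorphism between an open star-shaped subset of $TC$ and $C\times C$. Moreover, for every chart $\{x^\mu\}$ defined in a neighborhood of $p$, $C$ can be chosen equal to the open ball $B(p,\delta)$ for any sufficiently small $\delta$ (the ball is defined through the Euclidean norm induced by the coordinates).
   Context: $C^{k,1}$ means $C^{k,1}_{loc}$. $M$ is an $n$-dimensional paracompact connected $C^{2,1}$ manifold, $\pi\colon TM\to M$ its tangent bundle. Each ($C^{2,1}$) chart $x^\mu$ on $U\subset M$ induces a chart $(x^\mu,v^\mu)$ on $\pi^{-1}(U)$; Lipschitz conditions are understood in such charts. A locally Lipschitz spray on $M$ assigns to each chart locally Lipschitz functions $H^\mu(x,v)$ on $\pi^{-1}(U)$ with $H^\mu(x,sv)=s^2H^\mu(x,v)$ for every $s>0$, transforming under a change of chart $\tilde x(x)$ (with $\tilde v^\mu=\frac{\partial\tilde x^\mu}{\partial x^\nu}v^\nu$) as $\tilde H^\mu(\tilde x,\tilde v)=\frac{\partial^2\tilde x^\mu}{\partial x^\alpha\partial x^\beta}v^\alpha v^\beta+\frac{\partial\tilde x^\mu}{\partial x^\nu}H^\nu(x,v)$, so that the system $\dot x^\mu=v^\mu$, $\dot v^\mu=H^\mu(x,v)$ is chart independent. Non-stationary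 solutions are called geodesics. The reverse spray is the one given by $(x,v)\mapsto H^\mu(x,-v)$. For $v\in TM$, $\gamma_v$ denotes the unique maximal solution with $\gamma_v(0)=\pi(v)$, $\gamma_v'(0)=v$ (constant if $v=0$). $\Omega\subset TM$ is the set of those $v$ for which $\gamma_v(t)$ exists at least for $t\in[0,1]$, $\Omega_p=\Omega\cap\pi^{-1}(p)$, $\exp v:=(\pi(v),\gamma_v(1))$, $\exp_p v:=\gamma_v(1)$. The exponential map of the reverse spray is $\widetilde{\exp}\,v:=(\pi(v),\gamma_v(-1))$, defined where the right-hand side makes sense, and $\widetilde{\exp}_p v:=\gamma_v(-1)$. A Lipeomorphism is a homeomorphism $f$ such that both $f$ and $f^{-1}$ are locally Lipschitz. A subset $A$ of $TM$ (or $T_pM$) is star-shaped if $v\in A$ implies $sv\in A$ for every $s\in[0,1]$. An open neighborhood $N$ of $p$ is normal if there is an open star-shaped $N_p\subset\Omega_p$ such that $\exp_p\colon N_p\to N$ is a Lipeomorphism. An open set $C\subset M$ is convex normal if it is a normal neighborhood of each of its points. It is strictly convex normal (one also says that $\bar C$ is strictly convex normal) if $C$ is convex normal and any two points of $\bar C$ are connected by a unique geodesic contained in $C$ but for the endpoints. A (strictly) convex normal set is reversible if it is (strictly) convex normal also for the reverse spray. *)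

theory Defs
  imports "HOL-Analysis.Analysis"
begin

definition locally_lipschitz_on ::
    "'a::metric_space set \<Rightarrow> ('a \<Rightarrow> 'b::metric_space) \<Rightarrow> bool" where
  "locally_lipschitz_on S f \<longleftrightarrow>
     (\<forall>x\<in>S. \<exists>r>0. \<exists>L. L-lipschitz_on (ball x r \<inter> S) f)"

text \<open>Intended for open \<open>S\<close>; the Lipschitz condition on the second derivative is local.\<close>

definition C21_on ::
    "'a::real_normed_vector set \<Rightarrow> ('a \<Rightarrow> 'b::real_normed_vector) \<Rightarrow> bool" where
  "C21_on S f \<longleftrightarrow>
     (\<exists>(f' :: 'a \<Rightarrow> 'a \<Rightarrow>\<^sub>L 'b) (f'' :: 'a \<Rightarrow> 'a \<Rightarrow>\<^sub>L ('a \<Rightarrow>\<^sub>L 'b)).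
        (\<forall>x\<in>S. (f has_derivative blinfun_apply (f' x)) (at x)) \<and>
        (\<forall>x\<in>S. (f' has_derivative blinfun_apply (f'' x)) (at x)) \<and>
        locally_lipschitz_on S f'')"

text \<open>A chart is a pair of a domain and a coordinate map; the values of the coordinate map
  outside the domain are irrelevant.\<close>

type_synonym ('m, 'a) chart = "'m set \<times> ('m \<Rightarrow> 'a)"

definition is_chart :: "('m::topological_space, 'a::topological_space) chart \<Rightarrow> bool" where
  "is_chart c \<longleftrightarrow> open (fst c) \<and> open (snd c ` fst c) \<and>
     homeomorphism (fst c) (snd c ` fst c) (snd c) (inv_into (fst c) (snd c))"

definition transition :: "('m, 'a) chart \<Rightarrow> ('m, 'b) chart \<Rightarrow> 'a \<Rightarrow> 'b" where
  "transition c d = snd d \<circ> inv_into (fst c) (snd c)"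

definition C21_compatible ::
    "('m, 'a::real_normed_vector) chart \<Rightarrow> ('m, 'a) chart \<Rightarrow> bool" where
  "C21_compatible c d \<longleftrightarrow>
     C21_on (snd c ` (fst c \<inter> fst d)) (transition c d) \<and>
     C21_on (snd d ` (fst c \<inter> fst d)) (transition d c)"

text \<open>The differentiable structure is given by its maximal atlas, so that the members of \<open>A\<close>
  are exactly the \<open>C21\<close> charts of the manifold.\<close>

definition C21_structure ::
    "('m::topological_space, 'a::real_normed_vector) chart set \<Rightarrow> bool" where
  "C21_structure A \<longleftrightarrow>
     (\<forall>c\<in>A. is_chart c) \<and> (\<Union>c\<in>A. fst c) = UNIV \<and>
     (\<forall>c\<in>A. \<forall>d\<in>A. C21_compatible c d) \<and>
     (\<forall>c. is_chart c \<longrightarrow> (\<forall>d\<in>A. C21_compatible c d) \<longrightarrow> c \<in> A)"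

definition paracompact_space :: "'m topology \<Rightarrow> bool" where
  "paracompact_space X \<longleftrightarrow>
     (\<forall>\<U>. (\<forall>U\<in>\<U>. openin X U) \<and> \<Union>\<U> = topspace X \<longrightarrow>
        (\<exists>\<V>. (\<forall>V\<in>\<V>. openin X V) \<and> \<Union>\<V> = topspace X \<and>
           (\<forall>V\<in>\<V>. \<exists>U\<in>\<U>. V \<subseteq> U) \<and> locally_finite_in X \<V>))"

text \<open>The manifold is the whole type \<open>'m\<close>; its dimension is that of \<open>'a\<close>.  The Hausdorff
  property is part of the sort of \<open>'m\<close>.\<close>

definition C21_manifold :: "('m::t2_space, 'a::euclidean_space) chart set \<Rightarrow> bool" where
  "C21_manifold A \<longleftrightarrow>
     C21_structure A \<and> paracompact_space (euclidean :: 'm topology) \<and> connected (UNIV :: 'm set)"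

text \<open>A tangent vector is its base point \<open>p\<close> together with the function assigning to each chart
  around \<open>p\<close> the components of the vector in that chart; the components are related by the
  Jacobians of the coordinate changes, and are set to \<open>0\<close> off the charts around \<open>p\<close>, so that
  equality of tangent vectors is equality in \<open>tvec\<close>.\<close>

type_synonym ('m, 'a) tvec = "'m \<times> (('m, 'a) chart \<Rightarrow> 'a)"

definition TM :: "('m, 'a::real_normed_vector) chart set \<Rightarrow> ('m, 'a) tvec set" where
  "TM A = {(p, w).
     (\<forall>c\<in>A. \<forall>d\<in>A. p \<in> fst c \<and> p \<in> fst d \<longrightarrow>
        w d = frechet_derivative (transition c d) (at (snd c p)) (w c)) \<and>
     (\<forall>c. \<not> (c \<in> A \<and> p \<in> fst c) \<longrightarrow> w c = 0)}"

definition TM_over :: "('m, 'a::real_normed_vector) chart set \<Rightarrow> 'm set \<Rightarrow> ('m, 'a) tvec set"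
  where "TM_over A C = {v \<in> TM A. fst v \<in> C}"

definition tscale :: "real \<Rightarrow> ('m, 'a::real_vector) tvec \<Rightarrow> ('m, 'a) tvec" where
  "tscale s v = (fst v, \<lambda>c. s *\<^sub>R snd v c)"

definition star_shaped :: "('m, 'a::real_vector) tvec set \<Rightarrow> bool" where
  "star_shaped S \<longleftrightarrow> (\<forall>v\<in>S. \<forall>s\<in>{0..1}. tscale s v \<in> S)"

definition TM_chart :: "('m, 'a::real_normed_vector) chart set \<Rightarrow> ('m, 'a) chart
    \<Rightarrow> (('m, 'a) tvec, 'a \<times> 'a) chart" where
  "TM_chart A c = (TM_over A (fst c), \<lambda>v. (snd c (fst v), snd v c))"

definition TM_topology :: "('m, 'a::real_normed_vector) chart set \<Rightarrow> ('m, 'a) tvec topology" where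
  "TM_topology A =
     topology_generated_by {fst d \<inter> snd d -` B |d B. d \<in> TM_chart A ` A \<and> open B}"

definition prod_charts :: "('m, 'a) chart set \<Rightarrow> ('m \<times> 'm, 'a \<times> 'a) chart set" where
  "prod_charts A = {(fst c \<times> fst d, map_prod (snd c) (snd d)) |c d. c \<in> A \<and> d \<in> A}"

text \<open>Lipschitz conditions are imposed on the coordinate expressions of a map with respect to
  families \<open>F\<close>, \<open>G\<close> of charts in the source and in the target.\<close>

definition locally_lipschitz_map ::
    "('x, 'a::metric_space) chart set \<Rightarrow> ('y, 'b::metric_space) chart set
      \<Rightarrow> 'x set \<Rightarrow> ('x \<Rightarrow> 'y) \<Rightarrow> bool" where
  "locally_lipschitz_map F G S f \<longleftrightarrow>
     (\<forall>c\<in>F. \<forall>d\<in>G. locally_lipschitz_on (snd c ` {x \<in> S \<inter> fst c. f x \<in> fst d})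
        (snd d \<circ> f \<circ> inv_into (fst c) (snd c)))"

definition lipeomorphism ::
    "'x topology \<Rightarrow> ('x, 'a::metric_space) chart set \<Rightarrow> 'y topology
      \<Rightarrow> ('y, 'b::metric_space) chart set \<Rightarrow> ('x \<Rightarrow> 'y) \<Rightarrow> bool" where
  "lipeomorphism X F Y G f \<longleftrightarrow>
     homeomorphic_map X Y f \<and>
     locally_lipschitz_map F G (topspace X) f \<and>
     locally_lipschitz_map G F (topspace Y) (inv_into (topspace X) f)"

type_synonym ('m, 'a) spray = "('m, 'a) chart \<Rightarrow> 'a \<Rightarrow> 'a \<Rightarrow> 'a"

definition locally_lipschitz_spray ::
    "('m, 'a::real_normed_vector) chart set \<Rightarrow> ('m, 'a) spray \<Rightarrow> bool" where
  "locally_lipschitz_spray A H \<longleftrightarrow>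
     (\<forall>c\<in>A. locally_lipschitz_on (snd c ` fst c \<times> UNIV) (\<lambda>(x, v). H c x v)) \<and>
     (\<forall>c\<in>A. \<forall>x\<in>snd c ` fst c. \<forall>v. \<forall>s>0. H c x (s *\<^sub>R v) = s\<^sup>2 *\<^sub>R H c x v) \<and>
     (\<forall>c\<in>A. \<forall>d\<in>A. \<forall>q\<in>fst c \<inter> fst d. \<forall>v.
        let f = transition c d; x = snd c q in
          H d (snd d q) (frechet_derivative f (at x) v) =
            frechet_derivative (\<lambda>y. frechet_derivative f (at y) v) (at x) v
            + frechet_derivative f (at x) (H c x v))"

definition reverse_spray :: "('m, 'a::real_vector) spray \<Rightarrow> ('m, 'a) spray" where
  "reverse_spray H = (\<lambda>c x v. H c x (- v))"

text \<open>The curve \<open>\<sigma>\<close> in the tangent bundle solves \<open>x' = v\<close>, \<open>v' = H(x,v)\<close> on the interval \<open>I\<close>;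
  its projection \<open>fst \<circ> \<sigma>\<close> is the solution curve in the manifold and \<open>\<sigma>\<close> its velocity.  By
  continuity of the projection, \<open>\<sigma> s\<close> lies over the domain of the chart for \<open>s\<close> near \<open>t\<close>.\<close>

definition spray_solution ::
    "('m::topological_space, 'a::real_normed_vector) chart set \<Rightarrow> ('m, 'a) spray
      \<Rightarrow> real set \<Rightarrow> (real \<Rightarrow> ('m, 'a) tvec) \<Rightarrow> bool" where
  "spray_solution A H I \<sigma> \<longleftrightarrow>
     \<sigma> ` I \<subseteq> TM A \<and> continuous_on I (fst \<circ> \<sigma>) \<and>
     (\<forall>c\<in>A. \<forall>t\<in>I. fst (\<sigma> t) \<in> fst c \<longrightarrow>
        ((\<lambda>s. snd (TM_chart A c) (\<sigma> s)) has_vector_derivative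
           (snd (\<sigma> t) c, H c (snd c (fst (\<sigma> t))) (snd (\<sigma> t) c))) (at t within I))"

definition solution_from ::
    "('m::topological_space, 'a::real_normed_vector) chart set \<Rightarrow> ('m, 'a) spray
      \<Rightarrow> ('m, 'a) tvec \<Rightarrow> real set \<Rightarrow> (real \<Rightarrow> ('m, 'a) tvec) \<Rightarrow> bool" where
  "solution_from A H v I \<sigma> \<longleftrightarrow>
     open I \<and> is_interval I \<and> 0 \<in> I \<and> spray_solution A H I \<sigma> \<and> \<sigma> 0 = v"

definition maximal_interval ::
    "('m::topological_space, 'a::real_normed_vector) chart set \<Rightarrow> ('m, 'a) spray
      \<Rightarrow> ('m, 'a) tvec \<Rightarrow> real set" where
  "maximal_interval A H v = \<Union>{I. \<exists>\<sigma>. solution_from A H v I \<sigma>}"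

text \<open>\<open>\<gamma>\<^sub>v(t)\<close>, to be used for \<open>t\<close> in the maximal interval only: the common value at \<open>t\<close> of all
  solutions that start at \<open>v\<close> and are defined at \<open>t\<close>.\<close>

definition maximal_solution ::
    "('m::topological_space, 'a::real_normed_vector) chart set \<Rightarrow> ('m, 'a) spray
      \<Rightarrow> ('m, 'a) tvec \<Rightarrow> real \<Rightarrow> 'm" where
  "maximal_solution A H v t = (THE q. \<exists>I \<sigma>. solution_from A H v I \<sigma> \<and> t \<in> I \<and> q = fst (\<sigma> t))"

definition geodesic ::
    "('m::topological_space, 'a::real_normed_vector) chart set \<Rightarrow> ('m, 'a) spray
      \<Rightarrow> real set \<Rightarrow> (real \<Rightarrow> 'm) \<Rightarrow> bool" where
  "geodesic A H I \<gamma> \<longleftrightarrow>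
     (\<exists>w. spray_solution A H I (\<lambda>t. (\<gamma> t, w t))) \<and> \<not> \<gamma> constant_on I"

definition exp_domain ::
    "('m::topological_space, 'a::real_normed_vector) chart set \<Rightarrow> ('m, 'a) spray
      \<Rightarrow> ('m, 'a) tvec set" where
  "exp_domain A H = {v \<in> TM A. {0..1} \<subseteq> maximal_interval A H v}"

text \<open>On vectors based at \<open>p\<close> the pointed map \<open>exp\<^sub>p\<close> is \<open>exp_pt\<close>.\<close>

definition exp_pt ::
    "('m::topological_space, 'a::real_normed_vector) chart set \<Rightarrow> ('m, 'a) spray
      \<Rightarrow> ('m, 'a) tvec \<Rightarrow> 'm" where
  "exp_pt A H v = maximal_solution A H v 1"

definition exp_map ::
    "('m::topological_space, 'a::real_normed_vector) chart set \<Rightarrow> ('m, 'a) spray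
      \<Rightarrow> ('m, 'a) tvec \<Rightarrow> 'm \<times> 'm" where
  "exp_map A H v = (fst v, exp_pt A H v)"

definition rev_exp_domain ::
    "('m::topological_space, 'a::real_normed_vector) chart set \<Rightarrow> ('m, 'a) spray
      \<Rightarrow> ('m, 'a) tvec set" where
  "rev_exp_domain A H = {v \<in> TM A. {-1..0} \<subseteq> maximal_interval A H v}"

text \<open>Note the sign convention: this is \<open>(\<pi>(v), \<gamma>\<^sub>v(-1))\<close>, with \<open>\<gamma>\<^sub>v\<close> a solution of the spray
  \<open>H\<close> itself; it equals \<open>exp_map A (reverse_spray H)\<close> at \<open>-v\<close>.\<close>

definition rev_exp_map ::
    "('m::topological_space, 'a::real_normed_vector) chart set \<Rightarrow> ('m, 'a) spray
      \<Rightarrow> ('m, 'a) tvec \<Rightarrow> 'm \<times> 'm" where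
  "rev_exp_map A H v = (fst v, maximal_solution A H v (-1))"

definition star_lipeomorphic_onto_square ::
    "('m::topological_space, 'a::real_normed_vector) chart set \<Rightarrow> ('m, 'a) tvec set
      \<Rightarrow> (('m, 'a) tvec \<Rightarrow> 'm \<times> 'm) \<Rightarrow> 'm set \<Rightarrow> bool" where
  "star_lipeomorphic_onto_square A D E C \<longleftrightarrow>
     (\<exists>S. openin (subtopology (TM_topology A) (TM_over A C)) S \<and> star_shaped S \<and> S \<subseteq> D \<and>
        lipeomorphism (subtopology (TM_topology A) S) (TM_chart A ` A)
          (top_of_set (C \<times> C)) (prod_charts A) E)"

text \<open>The topology and the charts of \<open>T\<^sub>pM\<close> are the restrictions of those of the tangent bundle.\<close>

definition normal_neighborhood ::
    "('m::topological_space, 'a::real_normed_vector) chart set \<Rightarrow> ('m, 'a) spray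
      \<Rightarrow> 'm \<Rightarrow> 'm set \<Rightarrow> bool" where
  "normal_neighborhood A H p N \<longleftrightarrow>
     open N \<and> p \<in> N \<and>
     (\<exists>N\<^sub>p. openin (subtopology (TM_topology A) (TM_over A {p})) N\<^sub>p \<and> star_shaped N\<^sub>p \<and>
        N\<^sub>p \<subseteq> exp_domain A H \<and>
        lipeomorphism (subtopology (TM_topology A) N\<^sub>p) (TM_chart A ` A)
          (top_of_set N) A (exp_pt A H))"

definition convex_normal ::
    "('m::topological_space, 'a::real_normed_vector) chart set \<Rightarrow> ('m, 'a) spray
      \<Rightarrow> 'm set \<Rightarrow> bool" where
  "convex_normal A H C \<longleftrightarrow> open C \<and> (\<forall>p\<in>C. normal_neighborhood A H p C)"

definition connects_inside ::
    "('m::topological_space, 'a::real_normed_vector) chart set \<Rightarrow> ('m, 'a) spray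
      \<Rightarrow> 'm set \<Rightarrow> 'm \<Rightarrow> 'm \<Rightarrow> (real \<Rightarrow> 'm) \<Rightarrow> bool" where
  "connects_inside A H C p q \<gamma> \<longleftrightarrow>
     geodesic A H {0..1} \<gamma> \<and> \<gamma> 0 = p \<and> \<gamma> 1 = q \<and> \<gamma> ` {0<..<1} \<subseteq> C"

text \<open>Geodesics between two points are parametrized by \<open>[0,1]\<close>, which fixes the affine
  parameter.  Since sprays need not be reversible, the pairs of points are ordered.\<close>

definition strictly_convex_normal ::
    "('m::topological_space, 'a::real_normed_vector) chart set \<Rightarrow> ('m, 'a) spray
      \<Rightarrow> 'm set \<Rightarrow> bool" where
  "strictly_convex_normal A H C \<longleftrightarrow>
     convex_normal A H C \<and>
     (\<forall>p\<in>closure C. \<forall>q\<in>closure C. p \<noteq> q \<longrightarrow>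
        (\<exists>\<gamma>. connects_inside A H C p q \<gamma> \<and>
           (\<forall>\<eta>. connects_inside A H C p q \<eta> \<longrightarrow> (\<forall>t\<in>{0..1}. \<eta> t = \<gamma> t))))"

definition reversible_strictly_convex_normal ::
    "('m::topological_space, 'a::real_normed_vector) chart set \<Rightarrow> ('m, 'a) spray
      \<Rightarrow> 'm set \<Rightarrow> bool" where
  "reversible_strictly_convex_normal A H C \<longleftrightarrow>
     strictly_convex_normal A H C \<and> strictly_convex_normal A (reverse_spray H) C"

definition coordinate_ball :: "('m, 'a::metric_space) chart \<Rightarrow> 'm \<Rightarrow> real \<Rightarrow> 'm set" where
  "coordinate_ball c p \<delta> = {q \<in> fst c. snd c q \<in> ball (snd c p) \<delta>}"

end

theory Submission
  imports Defs
begin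

text \<open>
  In a chart the spray is a field \<open>h(x, v)\<close> that is locally Lipschitz and homogeneous of degree two
  in \<open>v\<close>, and geodesics are the curves with \<open>x'' = h(x, x')\<close>. A Lipschitz estimate near the single
  point \<open>(x0, 0)\<close> can be rescaled by homogeneity to
  \<open>\<bar>h(x, v) - h(y, w)\<bar> \<le> K (r\<^sup>2 \<bar>x - y\<bar> + r \<bar>v - w\<bar>)\<close> for \<open>\<bar>v\<bar>, \<bar>w\<bar> \<le> r\<close>
  (\<open>quadratic_field_exists\<close>). So for slow curves over unit time the geodesic equation is a small
  perturbation of \<open>x'' = 0\<close>, and what is true of straight segments persists; smallness replaces
  Gronwall estimates and the differentiability of the flow, which fails for sprays that are only Lipschitz.

  Let \<open>u\<close> be the difference of two slow solutions on \<open>[0, 1]\<close>, and let \<open>M\<close> be the maximum of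
  \<open>\<bar>u'\<bar>\<close>. Then \<open>\<bar>u''\<bar> \<le> (M + \<bar>u(0)\<bar>) / 4\<close>, so \<open>u'\<close> is almost constant, and \<open>u\<close> is controlled, with
  explicit constants, by its two end values as well as by its initial position and velocity
  (\<open>difference_by_endpoints\<close>, \<open>difference_by_initial_values\<close>). A slow solution with prescribed
  ends in a small ball exists by the contraction principle applied to its velocity
  (\<open>joins_exists\<close>). Consequently the map that sends a pair \<open>(a, b)\<close> of points of the ball to
  \<open>(a, initial velocity of the geodesic from a to b)\<close> is bi-Lipschitz
  (\<open>launch_bilipschitz\<close>); its image is open by invariance of domain; and its inverse is \<open>exp\<close> read
  in the chart (\<open>exp_in_chart\<close>).

  Two observations turn this into strict convexity. Along a geodesic in a small ball the second
  derivative of \<open>\<bar>x - x0\<bar>\<^sup>2\<close> is positive, so geodesics with ends in the closed ball are inside the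
  open ball in between (\<open>joins_inside\<close>). And a geodesic that is confined to a ball of radius
  \<open>\<delta>\<close> for a unit of time cannot have speed above \<open>8 \<delta>\<close>, because it would leave the ball almost
  along a straight line (\<open>speed_bound\<close>). Hence every geodesic in the closed ball is slow, and
  uniqueness among slow solutions is uniqueness among all.

  On the manifold the maximal solution has to be identified on \<open>[0, 1]\<close> only, where one solution
  is known to remain in the chart; uniqueness forward in time suffices (\<open>forward_unique\<close>), and it
  follows from the comparison of slow solutions since a solution observed for a short time is slow
  after an affine change of time. The reverse exponential map at \<open>v\<close> is the exponential map of the
  reverse spray at \<open>-v\<close> (\<open>rev_exp_eq_exp_reverse\<close>), so every assertion about it, and
  reversibility, comes from applying the same result to the reverse spray in a ball small enough
  for both.
\<close>


section \<open>Locally Lipschitz maps\<close>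

lemma dist_Pair_le: "dist (a, b) (c, d) \<le> dist a c + dist b d"
  by (simp add: dist_Pair_Pair sqrt_sum_squares_le_sum)

lemma locally_lipschitz_on_subset:
  "locally_lipschitz_on T f \<Longrightarrow> S \<subseteq> T \<Longrightarrow> locally_lipschitz_on S f"
  unfolding locally_lipschitz_on_def
  by (meson Int_mono lipschitz_on_subset order_refl subsetD)

lemma locally_lipschitz_on_cong:
  "(\<And>x. x \<in> S \<Longrightarrow> f x = g x) \<Longrightarrow> locally_lipschitz_on S f \<longleftrightarrow> locally_lipschitz_on S g"
  unfolding locally_lipschitz_on_def
  by (intro ball_cong ex_cong1 conj_cong lipschitz_on_cong refl) auto

lemma lipschitz_on_imp_locally_lipschitz_on:
  "L-lipschitz_on S f \<Longrightarrow> locally_lipschitz_on S f"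
  unfolding locally_lipschitz_on_def
  by (meson inf_le2 lipschitz_on_subset zero_less_one)

lemma locally_lipschitz_on_continuous:
  assumes "locally_lipschitz_on S f"
  shows "continuous_on S f"
  unfolding continuous_on_eq_continuous_within
proof
  fix x assume x: "x \<in> S"
  then obtain r L where r: "r > 0" "L-lipschitz_on (ball x r \<inter> S) f"
    using assms unfolding locally_lipschitz_on_def by blast
  then have "continuous (at x within ball x r \<inter> S) f"
    using x by (intro lipschitz_on_continuous_within) auto
  moreover have "at x within ball x r \<inter> S = at x within S"
    using r(1) by (intro at_within_nhd[of x "ball x r"]) auto
  ultimately show "continuous (at x within S) f" by simp
qed

lemma locally_lipschitz_on_compose:
  assumes f: "locally_lipschitz_on S f" and g: "locally_lipschitz_on T g" and fST: "f ` S \<subseteq> T"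
  shows "locally_lipschitz_on S (g \<circ> f)"
  unfolding locally_lipschitz_on_def
proof
  fix x assume x: "x \<in> S"
  obtain r L where r: "r > 0" "L-lipschitz_on (ball x r \<inter> S) f"
    using f x unfolding locally_lipschitz_on_def by blast
  obtain r' L' where r': "r' > 0" "L'-lipschitz_on (ball (f x) r' \<inter> T) g"
    using g x fST unfolding locally_lipschitz_on_def by blast
  have L: "L \<ge> 0" using r(2) lipschitz_on_nonneg by blast
  define q where "q = min r (r' / (L + 1))"
  have q: "q > 0" using r r' L by (auto simp: q_def)
  have im: "f ` (ball x q \<inter> S) \<subseteq> ball (f x) r' \<inter> T"
  proof clarify
    fix y assume y: "y \<in> ball x q" "y \<in> S"
    have "dist (f x) (f y) \<le> L * dist x y"
      using y x r by (intro lipschitz_onD[OF r(2)]) (auto simp: q_def)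
    also have "\<dots> \<le> (L + 1) * dist x y" using L by (intro mult_right_mono) auto
    also have "\<dots> < (L + 1) * (r' / (L + 1))"
      using y L by (intro mult_strict_left_mono) (auto simp: q_def)
    also have "\<dots> = r'" using L by simp
    finally show "f y \<in> ball (f x) r' \<inter> T" using y fST by auto
  qed
  have "L-lipschitz_on (ball x q \<inter> S) f"
    by (rule lipschitz_on_subset[OF r(2)]) (auto simp: q_def)
  moreover have "L'-lipschitz_on (f ` (ball x q \<inter> S)) g"
    by (rule lipschitz_on_subset[OF r'(2) im])
  ultimately have "(L' * L)-lipschitz_on (ball x q \<inter> S) (g \<circ> f)"
    by (rule lipschitz_on_compose)
  with q show "\<exists>r>0. \<exists>L. L-lipschitz_on (ball x r \<inter> S) (g \<circ> f)" by blast
qed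

lemma locally_lipschitz_on_Pair:
  assumes f: "locally_lipschitz_on S f" and g: "locally_lipschitz_on S g"
  shows "locally_lipschitz_on S (\<lambda>x. (f x, g x))"
  unfolding locally_lipschitz_on_def
proof
  fix x assume x: "x \<in> S"
  obtain r L where r: "r > 0" "L-lipschitz_on (ball x r \<inter> S) f"
    using f x unfolding locally_lipschitz_on_def by blast
  obtain r' L' where r': "r' > 0" "L'-lipschitz_on (ball x r' \<inter> S) g"
    using g x unfolding locally_lipschitz_on_def by blast
  have "L-lipschitz_on (ball x (min r r') \<inter> S) f" "L'-lipschitz_on (ball x (min r r') \<inter> S) g"
    by (rule lipschitz_on_subset[OF r(2)], force, rule lipschitz_on_subset[OF r'(2)], force)
  from lipschitz_on_Pair[OF this] r(1) r'(1)
  show "\<exists>r>0. \<exists>L. L-lipschitz_on (ball x r \<inter> S) (\<lambda>x. (f x, g x))"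
    by (meson min_less_iff_conj)
qed

lemma locally_lipschitz_on_fst: "locally_lipschitz_on S fst"
  and locally_lipschitz_on_snd: "locally_lipschitz_on S snd"
  by (rule lipschitz_on_imp_locally_lipschitz_on[of 1], rule lipschitz_onI,
      auto simp: dist_fst_le dist_snd_le)+

text \<open>On a ball on which the continuous derivative is within distance \<open>1\<close> of its value at the
  centre, the mean value inequality gives a Lipschitz constant.\<close>

lemma locally_lipschitz_on_C1:
  fixes f :: "'a::real_normed_vector \<Rightarrow> 'b::real_normed_vector"
  assumes S: "open S" and f: "\<And>x. x \<in> S \<Longrightarrow> (f has_derivative blinfun_apply (f' x)) (at x)"
    and f': "continuous_on S f'"
  shows "locally_lipschitz_on S f"
  unfolding locally_lipschitz_on_def
proof
  fix x assume x: "x \<in> S"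
  obtain r1 where r1: "r1 > 0" "ball x r1 \<subseteq> S" using S x open_contains_ball by blast
  have "isCont f' x" using f' S x continuous_on_eq_continuous_at by blast
  then obtain r2 where r2: "r2 > 0" "\<And>y. dist y x < r2 \<Longrightarrow> dist (f' y) (f' x) < 1"
    unfolding continuous_at_eps_delta using zero_less_one by blast
  define r where "r = min r1 r2"
  have "(norm (f' x) + 1)-lipschitz_on (ball x r) f"
  proof (rule bounded_derivative_imp_lipschitz)
    fix y assume y: "y \<in> ball x r"
    then have "y \<in> S" using r1 by (auto simp: r_def)
    from f[OF this] show "(f has_derivative blinfun_apply (f' y)) (at y within ball x r)"
      by (rule has_derivative_at_withinI)
    have "norm (f' y - f' x) < 1" using r2(2)[of y] y by (simp add: r_def dist_norm norm_minus_commute)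
    then show "onorm (blinfun_apply (f' y)) \<le> norm (f' x) + 1"
      using norm_triangle_ineq2[of "f' y" "f' x"] by (simp add: norm_blinfun.rep_eq)
  qed auto
  then show "\<exists>r>0. \<exists>L. L-lipschitz_on (ball x r \<inter> S) f"
    using r1(1) r2(1) by (intro exI[of _ r] exI[of _ "norm (f' x) + 1"])
      (auto simp: r_def intro: lipschitz_on_subset)
qed

text \<open>Jacobians act on tangent vectors in this way. The expression is not globally Lipschitz in the
  pair, since the variation of \<open>F\<close> is multiplied by the size of the vector; near a point that
  size is bounded.\<close>

lemma locally_lipschitz_on_blinfun_apply:
  fixes F :: "'a::real_normed_vector \<Rightarrow> 'b::real_normed_vector \<Rightarrow>\<^sub>L 'c::real_normed_vector"
  assumes F: "locally_lipschitz_on S F"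
  shows "locally_lipschitz_on (S \<times> UNIV) (\<lambda>(x, v). blinfun_apply (F x) v)"
  unfolding locally_lipschitz_on_def
proof
  fix z assume "z \<in> S \<times> (UNIV :: 'b set)"
  then obtain x v where z: "z = (x, v)" "x \<in> S" by auto
  obtain r L where r: "r > 0" and lip: "L-lipschitz_on (ball x r \<inter> S) F"
    using F z unfolding locally_lipschitz_on_def by blast
  have L: "L \<ge> 0" using lip lipschitz_on_nonneg by blast
  define B where "B = norm (F x) + L * r"
  have B: "norm (F y) \<le> B" if "y \<in> ball x r \<inter> S" for y
  proof -
    have "norm (F y - F x) \<le> L * dist y x"
      using lipschitz_onD[OF lip, of y x] that z r by (simp add: dist_norm)
    also have "\<dots> \<le> L * r" using that L by (intro mult_left_mono) (auto simp: dist_commute)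
    finally show ?thesis using norm_triangle_ineq2[of "F y" "F x"] by (simp add: B_def)
  qed
  have B0: "B \<ge> 0" using L r by (simp add: B_def)
  have "(L * (norm v + r) + B)-lipschitz_on (ball z r \<inter> S \<times> UNIV) (\<lambda>(x, v). blinfun_apply (F x) v)"
  proof (rule lipschitz_onI)
    fix p q assume pq: "p \<in> ball z r \<inter> S \<times> UNIV" "q \<in> ball z r \<inter> S \<times> UNIV"
    obtain y w y' w' where e: "p = (y, w)" "q = (y', w')" by fastforce
    have y: "y \<in> ball x r \<inter> S" "y' \<in> ball x r \<inter> S" and w: "w \<in> ball v r"
      using pq dist_fst_le[of z p] dist_fst_le[of z q] dist_snd_le[of z p] by (auto simp: e z)
    have wn: "norm w \<le> norm v + r"
      using w norm_triangle_ineq2[of w v] by (simp add: dist_norm norm_minus_commute)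
    have "blinfun_apply (F y) w - blinfun_apply (F y') w'
        = blinfun_apply (F y - F y') w + blinfun_apply (F y') (w - w')"
      by (simp add: blinfun.diff_left blinfun.diff_right)
    also have "norm \<dots> \<le> norm (F y - F y') * norm w + norm (F y') * norm (w - w')"
      by (intro norm_triangle_mono norm_blinfun)
    also have "\<dots> \<le> (L * dist y y') * (norm v + r) + B * dist w w'"
      using lipschitz_onD[OF lip y] wn B[OF y(2)] L B0
      by (intro add_mono mult_mono) (auto simp: dist_norm)
    also have "\<dots> \<le> (L * dist p q) * (norm v + r) + B * dist p q"
      using dist_fst_le[of p q] dist_snd_le[of p q] L B0 r
      by (intro add_mono mult_mono mult_nonneg_nonneg add_nonneg_nonneg) (auto simp: e)
    finally show "dist (case p of (x, v) \<Rightarrow> blinfun_apply (F x) v) (case q of (x, v) \<Rightarrow> blinfun_apply (F x) v)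
        \<le> (L * (norm v + r) + B) * dist p q"
      by (simp add: e dist_norm algebra_simps)
  qed (use L r B0 in auto)
  then show "\<exists>r>0. \<exists>L. L-lipschitz_on (ball z r \<inter> S \<times> UNIV) (\<lambda>(x, v). blinfun_apply (F x) v)"
    using r by blast
qed

section \<open>Comparison of slow solutions\<close>

lemma vector_derivative_bound:
  fixes f :: "real \<Rightarrow> 'a::real_normed_vector"
  assumes f: "\<And>t. t \<in> I \<Longrightarrow> (f has_vector_derivative f' t) (at t within I)"
    and I: "is_interval I" and B: "\<And>t. t \<in> I \<Longrightarrow> norm (f' t) \<le> B" and st: "s \<in> I" "t \<in> I"
  shows "norm (f t - f s) \<le> B * \<bar>t - s\<bar>"
proof -
  have "norm (f t - f s) \<le> B * norm (t - s)"
  proof (rule differentiable_bound[where S = I and f' = "\<lambda>t h. h *\<^sub>R f' t"])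
    show "convex I" using I by (simp add: is_interval_convex_1)
    show "onorm (\<lambda>h. h *\<^sub>R f' t) \<le> B" if "t \<in> I" for t
      using B[OF that] by (intro onorm_le) (simp add: mult.commute[of B] mult_left_mono)
  qed (use f st in \<open>auto simp: has_vector_derivative_def\<close>)
  then show ?thesis by simp
qed

definition solves :: "('a::real_normed_vector \<Rightarrow> 'a \<Rightarrow> 'a) \<Rightarrow> real set \<Rightarrow> (real \<Rightarrow> 'a) \<Rightarrow> (real \<Rightarrow> 'a) \<Rightarrow> bool"
  where "solves h I x v \<longleftrightarrow> (\<forall>t\<in>I. (x has_vector_derivative v t) (at t within I) \<and>
     (v has_vector_derivative h (x t) (v t)) (at t within I))"

lemma solves_subset: "solves h I x v \<Longrightarrow> J \<subseteq> I \<Longrightarrow> solves h J x v"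
  unfolding solves_def by (meson has_vector_derivative_within_subset subsetD)

text \<open>For a field that is homogeneous of degree two, an affine change of time turns solutions into
  solutions. The homogeneity is required along the curve only, because it is known near the
  centre of a chart only; \<open>s = 0\<close> gives constant curves.\<close>

lemma solves_rescale:
  assumes sol: "solves h I x v" and im: "\<And>t. t \<in> J \<Longrightarrow> c + s * t \<in> I"
    and hom: "\<And>t. t \<in> J \<Longrightarrow> h (x (c + s * t)) (s *\<^sub>R v (c + s * t)) = s\<^sup>2 *\<^sub>R h (x (c + s * t)) (v (c + s * t))"
  shows "solves h J (\<lambda>t. x (c + s * t)) (\<lambda>t. s *\<^sub>R v (c + s * t))"
  unfolding solves_def
proof (intro ballI conjI)
  fix t assume t: "t \<in> J"
  let ?a = "\<lambda>t. c + s * t"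
  have a: "(?a has_vector_derivative s) (at t within J)"
    by (auto intro!: derivative_eq_intros simp: has_real_derivative_iff_has_vector_derivative[symmetric])
  have sub: "?a ` J \<subseteq> I" using im by auto
  have "(x has_vector_derivative v (?a t)) (at (?a t) within ?a ` J)"
    "(v has_vector_derivative h (x (?a t)) (v (?a t))) (at (?a t) within ?a ` J)"
    using sol im[OF t] sub unfolding solves_def by (blast intro: has_vector_derivative_within_subset)+
  then have d: "(x \<circ> ?a has_vector_derivative s *\<^sub>R v (?a t)) (at t within J)"
    "(v \<circ> ?a has_vector_derivative s *\<^sub>R h (x (?a t)) (v (?a t))) (at t within J)"
    by (auto intro: vector_diff_chain_within[OF a])
  show "((\<lambda>t. x (c + s * t)) has_vector_derivative s *\<^sub>R v (c + s * t)) (at t within J)"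
    using d(1) by (simp add: o_def)
  have "((\<lambda>t. s *\<^sub>R (v \<circ> ?a) t) has_vector_derivative s *\<^sub>R (s *\<^sub>R h (x (?a t)) (v (?a t)))) (at t within J)"
    by (intro bounded_linear.has_vector_derivative[OF bounded_linear_scaleR_right] d)
  then show "((\<lambda>t. s *\<^sub>R v (c + s * t)) has_vector_derivative h (x (c + s * t)) (s *\<^sub>R v (c + s * t)))
      (at t within J)"
    using hom[OF t] by (simp add: o_def power2_eq_square)
qed

text \<open>A spray near the centre \<open>x0\<close> of a chart. The two powers of \<open>r\<close> are those forced by
  homogeneity: a field that is Lipschitz on vectors of norm at most \<open>1\<close> scales to this estimate.
  Both terms are small for slow vectors.\<close>

locale quadratic_field =
  fixes h :: "'a::euclidean_space \<Rightarrow> 'a \<Rightarrow> 'a" and x0 :: 'a and R K :: real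
  assumes R: "R > 0" and K: "K \<ge> 0"
    and lip: "\<And>x y v w r. \<lbrakk>x \<in> cball x0 R; y \<in> cball x0 R; norm v \<le> r; norm w \<le> r\<rbrakk> \<Longrightarrow>
       norm (h x v - h y w) \<le> K * (r\<^sup>2 * norm (x - y) + r * norm (v - w))"
    and hom: "\<And>x v s. \<lbrakk>x \<in> cball x0 R; s > 0\<rbrakk> \<Longrightarrow> h x (s *\<^sub>R v) = s\<^sup>2 *\<^sub>R h x v"
begin

lemma h_zero: assumes "x \<in> cball x0 R" shows "h x 0 = 0"
proof -
  have "h x 0 = 4 *\<^sub>R h x 0" using hom[OF assms, of 2 0] by simp
  then have "3 *\<^sub>R h x 0 = 0" by (simp add: scaleR_left_diff_distrib[of 4 1, simplified])
  then show ?thesis by simp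
qed

lemma hom_nonneg: "x \<in> cball x0 R \<Longrightarrow> s \<ge> 0 \<Longrightarrow> h x (s *\<^sub>R v) = s\<^sup>2 *\<^sub>R h x v"
  using hom[of x s v] h_zero by (cases "s = 0") auto

lemma h_bound: assumes "x \<in> cball x0 R" shows "norm (h x v) \<le> K * (norm v)\<^sup>2"
  using lip[OF assms assms, of v "norm v" 0] by (simp add: h_zero[OF assms] power2_eq_square)

lemma h_continuous: "continuous_on (cball x0 R \<times> cball 0 r) (\<lambda>(x, v). h x v)"
proof (cases "r \<ge> 0")
  case True
  have "(K * (r\<^sup>2 + r))-lipschitz_on (cball x0 R \<times> cball 0 r) (\<lambda>(x, v). h x v)"
  proof (rule lipschitz_onI)
    fix p q assume pq: "p \<in> cball x0 R \<times> cball (0 :: 'a) r" "q \<in> cball x0 R \<times> cball (0 :: 'a) r"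
    obtain y w y' w' where e: "p = (y, w)" "q = (y', w')" by fastforce
    have "norm (h y w - h y' w') \<le> K * (r\<^sup>2 * norm (y - y') + r * norm (w - w'))"
      using pq by (intro lip) (auto simp: e)
    also have "\<dots> \<le> K * (r\<^sup>2 * dist p q + r * dist p q)"
      using dist_fst_le[of p q] dist_snd_le[of p q] K True
      by (intro mult_left_mono add_mono) (auto simp: e dist_norm)
    finally show "dist (case p of (x, v) \<Rightarrow> h x v) (case q of (x, v) \<Rightarrow> h x v) \<le> K * (r\<^sup>2 + r) * dist p q"
      by (simp add: e dist_norm algebra_simps)
  qed (use K True in auto)
  then show ?thesis by (rule lipschitz_on_continuous_on)
qed auto

text \<open>The bound on the derivative of \<open>v - w\<close> contains the unknown maximum \<open>M\<close> of \<open>norm (v - w)\<close>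
  itself, but with the factor \<open>K (r\<^sup>2 + r) \<le> 1/4\<close>. This lets the corollaries absorb \<open>M\<close> on
  the left-hand side; that \<open>M\<close> is attained is what they evaluate.\<close>

lemma solution_difference:
  assumes x: "solves h {0..1} x v" and y: "solves h {0..1} y w"
    and mem: "\<And>t. t \<in> {0..1} \<Longrightarrow> x t \<in> cball x0 R" "\<And>t. t \<in> {0..1} \<Longrightarrow> y t \<in> cball x0 R"
    and r: "\<And>t. t \<in> {0..1} \<Longrightarrow> norm (v t) \<le> r" "\<And>t. t \<in> {0..1} \<Longrightarrow> norm (w t) \<le> r"
    and small: "K * (r\<^sup>2 + r) \<le> 1/4"
  shows "\<exists>M\<ge>0. (\<exists>t\<in>{0..1}. M = norm (v t - w t)) \<and>
    (\<forall>t\<in>{0..1}. norm (v t - w t) \<le> M \<and> norm (x t - y t) \<le> norm (x 0 - y 0) + M \<and>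
       norm ((v t - w t) - (v 0 - w 0)) \<le> (M + norm (x 0 - y 0)) / 4 \<and>
       norm ((x 1 - y 1) - (x 0 - y 0) - (v t - w t)) \<le> (M + norm (x 0 - y 0)) / 4)"
proof -
  let ?I = "{0..1 :: real}"
  have dx: "((\<lambda>t. x t - y t) has_vector_derivative v t - w t) (at t within ?I)"
    and dv: "((\<lambda>t. v t - w t) has_vector_derivative h (x t) (v t) - h (y t) (w t)) (at t within ?I)"
    if "t \<in> ?I" for t
    using x y that unfolding solves_def by (auto intro!: derivative_intros)
  have "continuous_on ?I (\<lambda>t. norm (v t - w t))"
    by (intro continuous_on_norm continuous_on_vector_derivative[OF dv])
  then obtain t0 where t0: "t0 \<in> ?I" "\<And>t. t \<in> ?I \<Longrightarrow> norm (v t - w t) \<le> norm (v t0 - w t0)"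
    using continuous_attains_sup[of ?I "\<lambda>t. norm (v t - w t)"] by auto
  define M where "M = norm (v t0 - w t0)"
  define u0 where "u0 = norm (x 0 - y 0)"
  have M: "norm (v t - w t) \<le> M" if "t \<in> ?I" for t using t0 that by (simp add: M_def)
  have M0: "M \<ge> 0" and u0: "u0 \<ge> 0" by (auto simp: M_def u0_def)
  have r0: "r \<ge> 0" using order_trans[OF norm_ge_zero r(1)[of 0]] by simp
  have pos: "norm (x t - y t) \<le> u0 + M" if t: "t \<in> ?I" for t
  proof -
    have "norm ((x t - y t) - (x 0 - y 0)) \<le> M * \<bar>t - 0\<bar>"
      using M t by (intro vector_derivative_bound[OF dx]) auto
    also have "\<dots> \<le> M" using t M0 by (simp add: mult_left_le)
    finally show ?thesis
      using norm_triangle_ineq2[of "x t - y t" "x 0 - y 0"] by (simp add: u0_def)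
  qed
  have acc: "norm (h (x t) (v t) - h (y t) (w t)) \<le> (M + u0) / 4" if t: "t \<in> ?I" for t
  proof -
    have "norm (h (x t) (v t) - h (y t) (w t)) \<le> K * (r\<^sup>2 * norm (x t - y t) + r * norm (v t - w t))"
      by (intro lip mem r t)
    also have "\<dots> \<le> K * (r\<^sup>2 * (u0 + M) + r * (u0 + M))"
      using pos[OF t] M[OF t] K r0 u0 by (intro mult_left_mono add_mono) auto
    also have "\<dots> = K * (r\<^sup>2 + r) * (u0 + M)" by (simp add: algebra_simps)
    also have "\<dots> \<le> 1/4 * (u0 + M)" using small u0 M0 by (intro mult_right_mono) auto
    finally show ?thesis by (simp add: algebra_simps)
  qed
  have vel: "norm ((v t - w t) - (v s - w s)) \<le> (M + u0) / 4" if st: "s \<in> ?I" "t \<in> ?I" for s t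
  proof -
    have "norm ((v t - w t) - (v s - w s)) \<le> (M + u0) / 4 * \<bar>t - s\<bar>"
      using acc st by (intro vector_derivative_bound[OF dv]) auto
    also have "\<dots> \<le> (M + u0) / 4 * 1" using st M0 u0 by (intro mult_left_mono) auto
    finally show ?thesis by simp
  qed
  have chord: "norm ((x 1 - y 1) - (x 0 - y 0) - (v t - w t)) \<le> (M + u0) / 4" if t: "t \<in> ?I" for t
  proof -
    \<comment> \<open>subtracting a uniform motion leaves a curve with derivative of size \<open>(M + u0) / 4\<close>\<close>
    let ?g = "\<lambda>s. (x s - y s) - s *\<^sub>R (v t - w t)"
    have "norm (?g 1 - ?g 0) \<le> (M + u0) / 4 * \<bar>1 - 0\<bar>"
    proof (rule vector_derivative_bound[where I = ?I and f' = "\<lambda>s. (v s - w s) - (v t - w t)"])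
      show "(?g has_vector_derivative (v s - w s) - (v t - w t)) (at s within ?I)" if "s \<in> ?I" for s
        using that by (intro has_vector_derivative_diff dx)
          (auto intro!: derivative_eq_intros simp: has_vector_derivative_def)
      show "norm ((v s - w s) - (v t - w t)) \<le> (M + u0) / 4" if "s \<in> ?I" for s
        using vel[OF t that] .
    qed (auto intro: is_interval_cc)
    then show ?thesis by (simp add: algebra_simps)
  qed
  show ?thesis
    using M0 M pos vel[of 0] chord t0(1) unfolding u0_def by (intro exI[of _ M]) (auto simp: M_def)
qed

text \<open>Since \<open>v - w\<close> is nearly constant, it is close to the mean velocity, which is the increment
  of \<open>x - y\<close>. Taken at the time where \<open>M\<close> is attained, this bounds \<open>M\<close>.\<close>

lemma difference_by_endpoints:
  assumes x: "solves h {0..1} x v" and y: "solves h {0..1} y w"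
    and mem: "\<And>t. t \<in> {0..1} \<Longrightarrow> x t \<in> cball x0 R" "\<And>t. t \<in> {0..1} \<Longrightarrow> y t \<in> cball x0 R"
    and r: "\<And>t. t \<in> {0..1} \<Longrightarrow> norm (v t) \<le> r" "\<And>t. t \<in> {0..1} \<Longrightarrow> norm (w t) \<le> r"
    and small: "K * (r\<^sup>2 + r) \<le> 1/4" and t: "t \<in> {0..1}"
  defines "d0 \<equiv> norm (x 0 - y 0)" and "e \<equiv> norm ((x 1 - y 1) - (x 0 - y 0))"
  shows "norm (v t - w t) \<le> 2 * (d0 + e)"
    and "norm (x t - y t) \<le> 3 * (d0 + e)"
    and "norm ((x 1 - y 1) - (x 0 - y 0) - (v t - w t)) \<le> (d0 + e) / 2"
proof -
  obtain M t0 where M: "M \<ge> 0" "t0 \<in> {0..1}" "M = norm (v t0 - w t0)"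
    "\<forall>t\<in>{0..1}. norm (v t - w t) \<le> M \<and> norm (x t - y t) \<le> norm (x 0 - y 0) + M \<and>
       norm ((v t - w t) - (v 0 - w 0)) \<le> (M + norm (x 0 - y 0)) / 4 \<and>
       norm ((x 1 - y 1) - (x 0 - y 0) - (v t - w t)) \<le> (M + norm (x 0 - y 0)) / 4"
    using solution_difference[OF x y mem r small] by blast
  have "M \<le> e + norm ((x 1 - y 1) - (x 0 - y 0) - (v t0 - w t0))"
    using norm_triangle_ineq4[of "(x 1 - y 1) - (x 0 - y 0)" "(x 1 - y 1) - (x 0 - y 0) - (v t0 - w t0)"]
    by (simp add: M(3) e_def)
  with bspec[OF M(4,2)] have Me: "M \<le> 4/3 * e + 1/3 * d0" by (simp add: field_simps d0_def)
  have nn: "d0 \<ge> 0" "e \<ge> 0" by (auto simp: d0_def e_def)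
  show "norm (v t - w t) \<le> 2 * (d0 + e)" "norm (x t - y t) \<le> 3 * (d0 + e)"
    "norm ((x 1 - y 1) - (x 0 - y 0) - (v t - w t)) \<le> (d0 + e) / 2"
    using bspec[OF M(4) t] Me nn unfolding d0_def by argo+
qed

text \<open>The same absorption with the initial value of \<open>v - w\<close> in place of its mean. It serves both
  as continuous dependence on initial data and as uniqueness of the initial value problem.\<close>

lemma difference_by_initial_values:
  assumes x: "solves h {0..1} x v" and y: "solves h {0..1} y w"
    and mem: "\<And>t. t \<in> {0..1} \<Longrightarrow> x t \<in> cball x0 R" "\<And>t. t \<in> {0..1} \<Longrightarrow> y t \<in> cball x0 R"
    and r: "\<And>t. t \<in> {0..1} \<Longrightarrow> norm (v t) \<le> r" "\<And>t. t \<in> {0..1} \<Longrightarrow> norm (w t) \<le> r"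
    and small: "K * (r\<^sup>2 + r) \<le> 1/4" and t: "t \<in> {0..1}"
  shows "norm (v t - w t) \<le> 2 * (norm (x 0 - y 0) + norm (v 0 - w 0))"
    and "norm (x t - y t) \<le> 2 * (norm (x 0 - y 0) + norm (v 0 - w 0))"
proof -
  obtain M t0 where M: "M \<ge> 0" "t0 \<in> {0..1}" "M = norm (v t0 - w t0)"
    "\<forall>t\<in>{0..1}. norm (v t - w t) \<le> M \<and> norm (x t - y t) \<le> norm (x 0 - y 0) + M \<and>
       norm ((v t - w t) - (v 0 - w 0)) \<le> (M + norm (x 0 - y 0)) / 4 \<and>
       norm ((x 1 - y 1) - (x 0 - y 0) - (v t - w t)) \<le> (M + norm (x 0 - y 0)) / 4"
    using solution_difference[OF x y mem r small] by blast
  have "M \<le> norm (v 0 - w 0) + norm ((v t0 - w t0) - (v 0 - w 0))"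
    using norm_triangle_ineq[of "v 0 - w 0" "(v t0 - w t0) - (v 0 - w 0)"] by (simp add: M(3))
  with bspec[OF M(4,2)] have "M \<le> 4/3 * norm (v 0 - w 0) + 1/3 * norm (x 0 - y 0)"
    by (simp add: field_simps)
  then show "norm (v t - w t) \<le> 2 * (norm (x 0 - y 0) + norm (v 0 - w 0))"
    "norm (x t - y t) \<le> 2 * (norm (x 0 - y 0) + norm (v 0 - w 0))"
    using bspec[OF M(4) t] norm_ge_zero[of "v 0 - w 0"] norm_ge_zero[of "x 0 - y 0"] by argo+
qed

end

section \<open>Geodesics with prescribed ends\<close>

text \<open>The primitive that vanishes at \<open>0\<close>. Curves are considered on \<open>[-1, 2]\<close> rather than on
  \<open>[0, 1]\<close>, because a solution from a tangent vector has to live on an open interval that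
  contains \<open>[0, 1]\<close>.\<close>

definition prim :: "(real \<Rightarrow> 'a::banach) \<Rightarrow> real \<Rightarrow> 'a" where
  "prim f t = integral {-1..t} f - integral {-1..0} f"

lemma prim_0 [simp]: "prim f 0 = 0"
  by (simp add: prim_def)

lemma prim_has_derivative:
  assumes "continuous_on {-1..2} f" "t \<in> {-1..2}"
  shows "(prim f has_vector_derivative f t) (at t within {-1..2})"
proof -
  have "((\<lambda>t. integral {-1..t} f - integral {-1..0} f) has_vector_derivative f t - 0) (at t within {-1..2})"
    by (intro has_vector_derivative_diff integral_has_vector_derivative assms has_vector_derivative_const)
  then show ?thesis by (simp add: prim_def[abs_def])
qed

lemma prim_continuous: "continuous_on {-1..2} f \<Longrightarrow> continuous_on {-1..2} (prim f)"
  by (rule continuous_on_vector_derivative[OF prim_has_derivative])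

lemma prim_diff_bound:
  assumes f: "continuous_on {-1..2} f" and g: "continuous_on {-1..2} g"
    and e: "\<And>t. t \<in> {-1..2} \<Longrightarrow> norm (f t - g t) \<le> e" and t: "t \<in> {-1..2}"
  shows "norm (prim f t - prim g t) \<le> 2 * e"
proof -
  have e0: "e \<ge> 0" using e[OF t] norm_ge_zero order_trans by blast
  have "norm ((prim f t - prim g t) - (prim f 0 - prim g 0)) \<le> e * \<bar>t - 0\<bar>"
  proof (rule vector_derivative_bound[where I = "{-1..2}" and f' = "\<lambda>t. f t - g t"])
    show "((\<lambda>t. prim f t - prim g t) has_vector_derivative f t - g t) (at t within {-1..2})"
      if "t \<in> {-1..2}" for t
      by (intro has_vector_derivative_diff prim_has_derivative f g that)
  qed (use t e in \<open>auto intro: is_interval_cc\<close>)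
  also have "\<dots> \<le> e * 2" using t e0 by (intro mult_left_mono) auto
  finally show ?thesis by simp
qed

lemma prim_bound:
  assumes f: "continuous_on {-1..2} f"
    and e: "\<And>t. t \<in> {-1..2} \<Longrightarrow> norm (f t) \<le> e" and t: "t \<in> {-1..2}"
  shows "norm (prim f t) \<le> 2 * e"
  using prim_diff_bound[OF f, of "\<lambda>_. 0" e t] e t by (simp add: prim_def)

text \<open>Points of the ball of radius \<open>\<delta>\<close> are at most \<open>2 \<delta>\<close> apart, and geodesics between them
  are sought with speed at most \<open>8 \<delta>\<close>. During the times in \<open>[-1, 2]\<close> these stay within
  \<open>\<delta> + 2 * 8 \<delta> = 17 \<delta>\<close> of the centre. The last condition makes all perturbation terms small
  at once.\<close>

locale small_quadratic_field = quadratic_field h x0 R K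
  for h :: "'a::euclidean_space \<Rightarrow> 'a \<Rightarrow> 'a" and x0 R K +
  fixes \<delta> :: real
  assumes \<delta>: "\<delta> > 0" "\<delta> \<le> 1" "17 * \<delta> < R" "2000 * K * \<delta> \<le> 1"
begin

definition traj :: "'a \<Rightarrow> (real \<Rightarrow> 'a) \<Rightarrow> real \<Rightarrow> 'a" where
  "traj a w t = a + prim w t"

definition accel :: "'a \<Rightarrow> (real \<Rightarrow> 'a) \<Rightarrow> real \<Rightarrow> 'a" where
  "accel a w t = h (traj a w t) (w t)"

text \<open>A velocity \<open>w\<close> determines the curve \<open>traj a w\<close>. A fixed point of this map has derivative
  \<open>accel a w\<close>, so it solves the equation, and its integral over \<open>[0, 1]\<close> is \<open>b - a\<close>: the last
  term removes the mean over \<open>[0, 1]\<close> of \<open>prim (accel a w)\<close>.\<close>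

definition bvp_map :: "'a \<Rightarrow> 'a \<Rightarrow> (real \<Rightarrow> 'a) \<Rightarrow> real \<Rightarrow> 'a" where
  "bvp_map a b w t = (b - a) + prim (accel a w) t - prim (prim (accel a w)) 1"

context
  fixes a :: 'a and w :: "real \<Rightarrow> 'a"
  assumes a: "a \<in> cball x0 \<delta>" and w: "continuous_on {-1..2} w"
    and w_le: "\<And>t. t \<in> {-1..2} \<Longrightarrow> norm (w t) \<le> 8 * \<delta>"
begin

lemma traj_in: assumes t: "t \<in> {-1..2}" shows "traj a w t \<in> cball x0 (17 * \<delta>)"
proof -
  have "norm (prim w t) \<le> 2 * (8 * \<delta>)" by (intro prim_bound w w_le t)
  moreover have "norm (x0 - a) \<le> \<delta>" using a by (simp add: dist_norm)
  ultimately have "norm ((x0 - a) - prim w t) \<le> 17 * \<delta>"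
    using norm_triangle_ineq4[of "x0 - a" "prim w t"] by linarith
  then show ?thesis by (simp add: traj_def dist_norm algebra_simps)
qed

lemma traj_in_R: "t \<in> {-1..2} \<Longrightarrow> traj a w t \<in> cball x0 R"
  using traj_in[of t] \<delta>(3) by auto

lemma traj_continuous: "continuous_on {-1..2} (traj a w)"
  unfolding traj_def by (intro continuous_intros prim_continuous w)

lemma accel_continuous: "continuous_on {-1..2} (accel a w)"
  unfolding accel_def
  by (rule continuous_on_compose2[OF h_continuous[of "8 * \<delta>"], of _ "\<lambda>t. (traj a w t, w t)", simplified])
     (use traj_in_R w_le traj_continuous w in \<open>auto intro!: continuous_on_Pair\<close>)

lemma accel_bound: assumes t: "t \<in> {-1..2}" shows "norm (accel a w t) \<le> 64 * K * \<delta>\<^sup>2"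
proof -
  have "norm (accel a w t) \<le> K * (norm (w t))\<^sup>2" unfolding accel_def by (intro h_bound traj_in_R t)
  also have "\<dots> \<le> K * (8 * \<delta>)\<^sup>2" using K w_le[OF t] by (intro mult_left_mono power_mono) auto
  finally show ?thesis by (simp add: power_mult_distrib)
qed

text \<open>The straight motion contributes at most \<open>2 \<delta>\<close>, and the two corrections are of order
  \<open>K \<delta>\<^sup>2\<close>, hence below the remaining \<open>6 \<delta>\<close>.\<close>

lemma bvp_map_bound:
  assumes b: "b \<in> cball x0 \<delta>" and t: "t \<in> {-1..2}"
  shows "norm (bvp_map a b w t) \<le> 8 * \<delta>"
proof -
  have 1: "norm (prim (accel a w) t) \<le> 2 * (64 * K * \<delta>\<^sup>2)" if "t \<in> {-1..2}" for t
    by (intro prim_bound accel_continuous accel_bound that)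
  have 2: "norm (prim (prim (accel a w)) 1) \<le> 2 * (2 * (64 * K * \<delta>\<^sup>2))"
    by (intro prim_bound prim_continuous accel_continuous 1) auto
  have "2000 * K * \<delta> * \<delta> \<le> 1 * \<delta>" using \<delta> by (intro mult_right_mono) auto
  then have "64 * K * \<delta>\<^sup>2 * 6 \<le> 6 * \<delta>" using \<delta> K by (simp add: power2_eq_square)
  moreover have "norm (b - a) \<le> 2 * \<delta>"
    using dist_triangle3[of b a x0] a b by (simp add: dist_norm)
  ultimately show ?thesis
    using 1[OF t] 2 norm_triangle_ineq4[of "(b - a) + prim (accel a w) t" "prim (prim (accel a w)) 1"]
      norm_triangle_ineq[of "b - a" "prim (accel a w) t"] unfolding bvp_map_def by linarith
qed

lemma bvp_map_continuous: "continuous_on {-1..2} (bvp_map a b w)"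
  unfolding bvp_map_def by (intro continuous_intros prim_continuous accel_continuous)

end

text \<open>Passing from velocities to accelerations costs the factor \<open>136 K \<delta>\<close>, and the primitives
  on \<open>[-1, 2]\<close> cost a factor \<open>2\<close> each, hence \<open>6\<close> in total for the two corrections.\<close>

lemma bvp_map_contraction:
  assumes a: "a \<in> cball x0 \<delta>"
    and w: "continuous_on {-1..2} w" "\<And>t. t \<in> {-1..2} \<Longrightarrow> norm (w t) \<le> 8 * \<delta>"
    and u: "continuous_on {-1..2} u" "\<And>t. t \<in> {-1..2} \<Longrightarrow> norm (u t) \<le> 8 * \<delta>"
    and d: "\<And>t. t \<in> {-1..2} \<Longrightarrow> norm (w t - u t) \<le> d" and t: "t \<in> {-1..2}"
  shows "norm (bvp_map a b w t - bvp_map a b u t) \<le> 1/2 * d"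
proof -
  let ?k = "136 * K * \<delta> * d"
  have d0: "d \<ge> 0" using d[OF t] norm_ge_zero order_trans by blast
  have accel: "norm (accel a w t - accel a u t) \<le> ?k" if t: "t \<in> {-1..2}" for t
  proof -
    have "norm (traj a w t - traj a u t) \<le> 2 * d"
      using prim_diff_bound[OF w(1) u(1) d t] by (simp add: traj_def)
    moreover have "norm (accel a w t - accel a u t)
        \<le> K * ((8 * \<delta>)\<^sup>2 * norm (traj a w t - traj a u t) + 8 * \<delta> * norm (w t - u t))"
      unfolding accel_def by (intro lip traj_in_R a w u t)
    ultimately have "norm (accel a w t - accel a u t) \<le> K * ((8 * \<delta>)\<^sup>2 * (2 * d) + 8 * \<delta> * d)"
      using K \<delta> d[OF t] by (elim order_trans) (intro mult_left_mono add_mono, auto)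
    also have "\<dots> = 128 * (K * \<delta> * d) * \<delta> + 8 * (K * \<delta> * d)" by (simp add: power2_eq_square algebra_simps)
    also have "\<dots> \<le> 128 * (K * \<delta> * d) * 1 + 8 * (K * \<delta> * d)"
      using K \<delta> d0 by (intro add_mono mult_left_mono) auto
    finally show ?thesis by simp
  qed
  note c = accel_continuous[OF a w] accel_continuous[OF a u]
  have 1: "norm (prim (accel a w) t - prim (accel a u) t) \<le> 2 * ?k" if "t \<in> {-1..2}" for t
    by (intro prim_diff_bound c accel that)
  have 2: "norm (prim (prim (accel a w)) 1 - prim (prim (accel a u)) 1) \<le> 2 * (2 * ?k)"
    by (intro prim_diff_bound prim_continuous c 1) auto
  have "bvp_map a b w t - bvp_map a b u t = (prim (accel a w) t - prim (accel a u) t)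
      - (prim (prim (accel a w)) 1 - prim (prim (accel a u)) 1)" (is "_ = ?A - ?B")
    by (simp add: bvp_map_def)
  then have "norm (bvp_map a b w t - bvp_map a b u t) \<le> norm ?A + norm ?B"
    by (simp only: norm_triangle_ineq4)
  with 1[OF t] 2 have "norm (bvp_map a b w t - bvp_map a b u t) \<le> 6 * ?k" by linarith
  moreover have "2000 * K * \<delta> * d \<le> 1 * d" using \<delta> d0 by (intro mult_right_mono) auto
  moreover have "K * \<delta> * d \<ge> 0" using K \<delta> d0 by simp
  ultimately show ?thesis by (simp add: algebra_simps)
qed

definition joins :: "'a \<Rightarrow> 'a \<Rightarrow> (real \<Rightarrow> 'a) \<Rightarrow> (real \<Rightarrow> 'a) \<Rightarrow> bool" where
  "joins a b x v \<longleftrightarrow> solves h {-1..2} x v \<and> x 0 = a \<and> x 1 = b \<and>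
     (\<forall>t\<in>{-1..2}. x t \<in> cball x0 (17 * \<delta>) \<and> norm (v t) \<le> 8 * \<delta>)"

text \<open>Banach's theorem, in the complete space of bounded continuous functions on the whole line.
  Only the values on \<open>[-1, 2]\<close> matter, so the operator is composed with the retraction of
  the line onto this interval.\<close>

lemma joins_exists:
  assumes a: "a \<in> cball x0 \<delta>" and b: "b \<in> cball x0 \<delta>"
  shows "\<exists>x v. joins a b x v"
proof -
  let ?I = "{-1..2 :: real}"
  define S where "S = PiC (UNIV :: real set) (\<lambda>_. cball (0 :: 'a) (8 * \<delta>))"
  define clp where "clp t = max (-1) (min 2 t)" for t :: real
  define T where "T w = Bcontfun (\<lambda>t. bvp_map a b (apply_bcontfun w) (clp t))" for w :: "real \<Rightarrow>\<^sub>C 'a"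
  have clp: "clp t \<in> ?I" for t by (auto simp: clp_def)
  have clp_id: "clp t = t" if "t \<in> ?I" for t using that by (auto simp: clp_def)
  have Sw: "norm (apply_bcontfun w t) \<le> 8 * \<delta>" if "w \<in> S" for w t
    using that by (auto simp: S_def mem_PiC_iff Pi_iff)
  have B: "norm (bvp_map a b (apply_bcontfun w) (clp t)) \<le> 8 * \<delta>" if "w \<in> S" for w t
    using Sw[OF that] by (intro bvp_map_bound a b clp) auto
  have T: "apply_bcontfun (T w) t = bvp_map a b (apply_bcontfun w) (clp t)" if "w \<in> S" for w t
  proof -
    have "continuous_on UNIV (\<lambda>t. bvp_map a b (apply_bcontfun w) (clp t))"
      by (rule continuous_on_compose2[OF bvp_map_continuous[OF a _ Sw[OF that], where b = b]])
         (use clp in \<open>auto simp: clp_def intro!: continuous_intros\<close>)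
    moreover have "bounded (range (\<lambda>t. bvp_map a b (apply_bcontfun w) (clp t)))"
      unfolding bounded_iff using B[OF that] by blast
    ultimately show ?thesis
      unfolding T_def by (subst Bcontfun_inverse) (auto simp: bcontfun_def)
  qed
  have "\<exists>!w\<in>S. T w = w"
  proof (rule Banach_fix[where c = "1/2"])
    show "complete S"
      unfolding complete_eq_closed S_def by (rule closed_PiC) auto
    have "const_bcontfun 0 \<in> S"
      using \<delta> by (auto simp: S_def mem_PiC_iff const_bcontfun.rep_eq)
    then show "S \<noteq> {}" by blast
    have "T w \<in> S" if "w \<in> S" for w
      using B[OF that] T[OF that] unfolding S_def mem_PiC_iff by auto
    then show "T ` S \<subseteq> S" by blast
    show "dist (T w) (T u) \<le> 1/2 * dist w u" if wu: "w \<in> S" "u \<in> S" for w u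
    proof (rule dist_bound)
      fix t
      have "norm (bvp_map a b w (clp t) - bvp_map a b u (clp t)) \<le> 1/2 * dist w u"
        by (rule bvp_map_contraction)
           (use clp a Sw wu dist_bounded[of w _ u] in \<open>auto simp: dist_norm\<close>)
      then show "dist (T w t) (T u t) \<le> 1/2 * dist w u" using T wu by (simp add: dist_norm)
    qed
  qed auto
  then obtain w' where w': "w' \<in> S" "T w' = w'" by blast
  define w where "w = apply_bcontfun w'"
  have cont: "continuous_on ?I w" and le: "\<And>t. norm (w t) \<le> 8 * \<delta>"
    using Sw[OF w'(1)] by (auto simp: w_def)
  have fix_eq: "w t = bvp_map a b w t" if "t \<in> ?I" for t
    using T[OF w'(1), of t] clp_id[OF that] w'(2) by (simp add: w_def)
  let ?F = "prim (accel a w)"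
  have fc: "continuous_on ?I (accel a w)" by (rule accel_continuous[OF a cont le])
  have dw: "(w has_vector_derivative accel a w t) (at t within ?I)" if t: "t \<in> ?I" for t
  proof (rule has_vector_derivative_transform[OF t fix_eq])
    show "(bvp_map a b w has_vector_derivative accel a w t) (at t within ?I)"
      unfolding bvp_map_def using prim_has_derivative[OF fc t]
      by (auto intro!: derivative_eq_intros simp: algebra_simps)
  qed
  have dx: "(traj a w has_vector_derivative w t) (at t within ?I)" if t: "t \<in> ?I" for t
    unfolding traj_def using prim_has_derivative[OF cont t] by (auto intro!: derivative_eq_intros)
  \<comment> \<open>integrating the fixed point equation over \<open>[0, 1]\<close>: both sides have the same derivative\<close>
  have "norm ((prim w 1 - (prim ?F 1 + 1 *\<^sub>R ((b - a) - prim ?F 1)))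
      - (prim w 0 - (prim ?F 0 + 0 *\<^sub>R ((b - a) - prim ?F 1)))) \<le> 0 * \<bar>1 - 0\<bar>"
  proof (rule vector_derivative_bound[where I = ?I and f' = "\<lambda>t. w t - (?F t + ((b - a) - prim ?F 1))"])
    fix t assume t: "t \<in> ?I"
    have "((\<lambda>t. t *\<^sub>R ((b - a) - prim ?F 1)) has_vector_derivative ((b - a) - prim ?F 1)) (at t within ?I)"
      by (auto simp: has_vector_derivative_def intro!: derivative_eq_intros)
    then show "((\<lambda>t. prim w t - (prim ?F t + t *\<^sub>R ((b - a) - prim ?F 1))) has_vector_derivative
        w t - (?F t + ((b - a) - prim ?F 1))) (at t within ?I)"
      by (intro has_vector_derivative_diff has_vector_derivative_add prim_has_derivative cont
            prim_continuous fc t)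
    show "norm (w t - (?F t + ((b - a) - prim ?F 1))) \<le> 0"
      using fix_eq[OF t] by (simp add: bvp_map_def algebra_simps)
  qed (auto intro: is_interval_cc)
  then have endpoint: "traj a w 1 = b" by (simp add: traj_def algebra_simps)
  have "joins a b (traj a w) w"
    unfolding joins_def solves_def using dx dw endpoint traj_in[OF a cont le] le
    by (auto simp: traj_def[of a w 0] accel_def)
  then show ?thesis by blast
qed

section \<open>Speed, convexity and the launching map\<close>

lemma small_speed: "K * ((8 * \<delta>)\<^sup>2 + 8 * \<delta>) \<le> 1/4"
proof -
  have "K * \<delta> * \<delta> \<le> K * \<delta> * 1" using K \<delta> by (intro mult_left_mono) auto
  then show ?thesis using \<delta>(4) by (simp add: power2_eq_square algebra_simps)
qed

lemma flow_ball_in_domain: "x \<in> cball x0 (17 * \<delta>) \<Longrightarrow> x \<in> cball x0 R"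
  using \<delta>(3) by auto

lemma small_ball_in_flow_ball: "x \<in> cball x0 \<delta> \<Longrightarrow> x \<in> cball x0 (17 * \<delta>)"
  using \<delta>(1) by auto

lemma joinsD:
  assumes "joins a b x v"
  shows "solves h {0..1} x v" "x 0 = a" "x 1 = b"
    "\<And>t. t \<in> {0..1} \<Longrightarrow> x t \<in> cball x0 R" "\<And>t. t \<in> {0..1} \<Longrightarrow> x t \<in> cball x0 (17 * \<delta>)"
    "\<And>t. t \<in> {0..1} \<Longrightarrow> norm (v t) \<le> 8 * \<delta>"
  using assms flow_ball_in_domain unfolding joins_def by (auto intro: solves_subset)

text \<open>Around the time \<open>t0\<close> of maximal speed \<open>V\<close> the velocity is nearly constant for a time of
  order \<open>1 / (K V)\<close>. If \<open>V > 8 \<delta>\<close>, there is room inside \<open>[0, 1]\<close>, on one side of \<open>t0\<close>, for an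
  interval of length \<open>4 \<delta> / V\<close>, and on it the curve covers a distance of at least \<open>3 \<delta>\<close>, more
  than the diameter of the ball.\<close>

lemma speed_bound:
  assumes sol: "solves h {0..1} x v" and mem: "\<And>t. t \<in> {0..1} \<Longrightarrow> x t \<in> cball x0 \<delta>"
    and t: "t \<in> {0..1}"
  shows "norm (v t) \<le> 8 * \<delta>"
proof (rule ccontr)
  let ?I = "{0..1 :: real}"
  assume big: "\<not> norm (v t) \<le> 8 * \<delta>"
  have dx: "(x has_vector_derivative v s) (at s within ?I)"
    and dv: "(v has_vector_derivative h (x s) (v s)) (at s within ?I)" if "s \<in> ?I" for s
    using sol that unfolding solves_def by auto
  have "continuous_on ?I (\<lambda>t. norm (v t))"
    by (intro continuous_on_norm continuous_on_vector_derivative[OF dv])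
  then obtain t0 where t0: "t0 \<in> ?I" "\<And>s. s \<in> ?I \<Longrightarrow> norm (v s) \<le> norm (v t0)"
    using continuous_attains_sup[of ?I "\<lambda>t. norm (v t)"] by auto
  define V where "V = norm (v t0)"
  have V: "V > 8 * \<delta>" using big t0(2)[OF t] by (simp add: V_def)
  with \<delta> have V0: "V > 0" by simp
  define \<tau> where "\<tau> = 4 * \<delta> / V"
  have \<tau>: "0 < \<tau>" "\<tau> < 1/2" "\<tau> * V = 4 * \<delta>" using V V0 \<delta> by (auto simp: \<tau>_def field_simps)
  \<comment> \<open>run away from \<open>t0\<close> towards the farther end of \<open>[0, 1]\<close>\<close>
  define \<sigma> :: real where "\<sigma> = (if t0 \<le> 1/2 then 1 else - 1)"
  define t1 where "t1 = t0 + \<sigma> * \<tau>"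
  have t1: "t1 \<in> ?I" "\<bar>t1 - t0\<bar> = \<tau>" using \<tau> t0(1) by (auto simp: t1_def \<sigma>_def)
  define J where "J = {min t0 t1..max t0 t1}"
  have J: "J \<subseteq> ?I" "t0 \<in> J" "t1 \<in> J" using t0(1) t1(1) by (auto simp: J_def)
  have near: "norm (v s - v t0) \<le> V / 4" if s: "s \<in> J" for s
  proof -
    have "norm (v s - v t0) \<le> K * V\<^sup>2 * \<bar>s - t0\<bar>"
    proof (rule vector_derivative_bound[OF dv])
      show "norm (h (x s) (v s)) \<le> K * V\<^sup>2" if "s \<in> ?I" for s
      proof -
        have "norm (h (x s) (v s)) \<le> K * (norm (v s))\<^sup>2"
          using h_bound flow_ball_in_domain small_ball_in_flow_ball mem that by blast
        also have "\<dots> \<le> K * V\<^sup>2"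
          using K t0(2)[OF that] by (intro mult_left_mono power_mono) (auto simp: V_def)
        finally show ?thesis .
      qed
    qed (use s J t0 in \<open>auto intro: is_interval_cc\<close>)
    also have "\<dots> \<le> K * V\<^sup>2 * \<tau>"
      using K s t1(2) by (intro mult_left_mono) (auto simp: J_def)
    also have "\<dots> = K * V * (\<tau> * V)" by (simp add: power2_eq_square)
    also have "\<dots> = 4 * K * \<delta> * V" using \<tau>(3) by simp
    also have "\<dots> \<le> 1/4 * V" using V0 \<delta>(4) by (intro mult_right_mono) auto
    finally show ?thesis by simp
  qed
  have "norm ((x t1 - t1 *\<^sub>R v t0) - (x t0 - t0 *\<^sub>R v t0)) \<le> V / 4 * \<bar>t1 - t0\<bar>"
  proof (rule vector_derivative_bound[where I = J and f' = "\<lambda>s. v s - v t0"])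
    fix s assume s: "s \<in> J"
    have "((\<lambda>s. s *\<^sub>R v t0) has_vector_derivative v t0) (at s within J)"
      by (auto simp: has_vector_derivative_def intro!: derivative_eq_intros)
    moreover have "(x has_vector_derivative v s) (at s within J)"
      using dx J s by (blast intro: has_vector_derivative_within_subset)
    ultimately show "((\<lambda>s. x s - s *\<^sub>R v t0) has_vector_derivative v s - v t0) (at s within J)"
      by (intro has_vector_derivative_diff)
  qed (use near J in \<open>auto simp: J_def intro: is_interval_cc\<close>)
  also have "\<dots> = \<delta>" using \<tau>(3) t1(2) by (simp add: field_simps)
  also have "(x t1 - t1 *\<^sub>R v t0) - (x t0 - t0 *\<^sub>R v t0) = (x t1 - x t0) - (t1 - t0) *\<^sub>R v t0"
    by (simp add: algebra_simps)
  finally have "norm ((x t1 - x t0) - (t1 - t0) *\<^sub>R v t0) \<le> \<delta>" .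
  moreover have "norm ((t1 - t0) *\<^sub>R v t0) = 4 * \<delta>" using \<tau>(3) t1(2) by (simp add: V_def)
  moreover have "norm (x t1 - x t0) \<le> 2 * \<delta>"
    using mem[OF t1(1)] mem[OF t0(1)] dist_triangle3[of "x t1" "x t0" x0] by (simp add: dist_norm)
  ultimately show False
    using norm_triangle_ineq2[of "(t1 - t0) *\<^sub>R v t0" "x t1 - x t0"] \<delta>(1)
    by (simp add: norm_minus_commute)
qed

lemma joins_unique:
  assumes j: "joins a b x v" and sol: "solves h {0..1} y w" and "y 0 = a" "y 1 = b"
    and y: "\<And>t. t \<in> {0..1} \<Longrightarrow> y t \<in> cball x0 (17 * \<delta>)"
    and w: "\<And>t. t \<in> {0..1} \<Longrightarrow> norm (w t) \<le> 8 * \<delta>" and t: "t \<in> {0..1}"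
  shows "y t = x t" "w t = v t"
proof -
  note jd = joinsD[OF j]
  note d = difference_by_endpoints[OF jd(1) sol jd(4) flow_ball_in_domain[OF y] jd(6) w small_speed t]
  show "y t = x t" "w t = v t" using d(1,2) assms(3,4) jd(2,3) by auto
qed

lemma constant_solves: "a \<in> cball x0 R \<Longrightarrow> solves h I (\<lambda>_. a) (\<lambda>_. 0)"
  by (auto simp: solves_def h_zero)

text \<open>The velocity is nearly the increment \<open>b - a\<close>. Comparison with the constant solution at \<open>a\<close>
  makes this precise.\<close>

lemma joins_moving:
  assumes j: "joins a b x v" and "a \<noteq> b" and a: "a \<in> cball x0 \<delta>" and t: "t \<in> {0..1}"
  shows "v t \<noteq> 0"
proof
  assume v: "v t = 0"
  note jd = joinsD[OF j]
  have aR: "a \<in> cball x0 R" using flow_ball_in_domain small_ball_in_flow_ball a by blast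
  have "norm ((x 1 - a) - (x 0 - a) - (v t - 0))
      \<le> (norm (x 0 - a) + norm ((x 1 - a) - (x 0 - a))) / 2"
    by (rule difference_by_endpoints[OF jd(1) constant_solves[OF aR] jd(4) _ jd(6) _ small_speed t])
       (use aR \<delta> in auto)
  then have "norm (b - a) \<le> norm (b - a) / 2" using jd(2,3) v by simp
  with \<open>a \<noteq> b\<close> show False by simp
qed

text \<open>The function \<open>f = norm (x - x0)\<^sup>2\<close> has second derivative
  \<open>2 (norm v)\<^sup>2 + 2 (x - x0) \<bullet> h x v\<close>, where the last term is at most \<open>34 K \<delta> (norm v)\<^sup>2\<close> and
  \<open>v\<close> does not vanish. So \<open>f'\<close> is strictly increasing, which excludes an interior value that is
  at least as large as both end values.\<close>

lemma joins_inside: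
  assumes j: "joins a b x v" and ab: "a \<noteq> b" "a \<in> cball x0 \<delta>" "b \<in> cball x0 \<delta>" and t: "0 < t" "t < 1"
  shows "x t \<in> ball x0 \<delta>"
proof (rule ccontr)
  assume out: "x t \<notin> ball x0 \<delta>"
  define f where "f s = (x s - x0) \<bullet> (x s - x0)" for s
  define f' where "f' s = 2 * ((x s - x0) \<bullet> v s)" for s
  note jd = joinsD[OF j]
  have at: "at s within {-1..2} = at s" if "0 \<le> s" "s \<le> 1" for s :: real
    using that by (intro at_within_Icc_at) auto
  have dx: "(x has_vector_derivative v s) (at s)"
    and dv: "(v has_vector_derivative h (x s) (v s)) (at s)" if "0 \<le> s" "s \<le> 1" for s
  proof -
    have "s \<in> {-1..2}" using that by auto
    then show "(x has_vector_derivative v s) (at s)" "(v has_vector_derivative h (x s) (v s)) (at s)"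
      using j at[OF that] unfolding joins_def solves_def by metis+
  qed
  have df: "(f has_real_derivative f' s) (at s)" if "0 \<le> s" "s \<le> 1" for s
  proof -
    have "(f has_derivative (\<lambda>h. (x s - x0) \<bullet> (h *\<^sub>R v s) + (h *\<^sub>R v s) \<bullet> (x s - x0))) (at s)"
      using dx[OF that] unfolding f_def[abs_def] has_vector_derivative_def
      by (auto intro!: derivative_eq_intros)
    then show ?thesis
      unfolding has_field_derivative_def f'_def
      by (rule has_derivative_eq_rhs) (auto simp: inner_commute algebra_simps)
  qed
  have df': "(f' has_real_derivative 2 * (v s \<bullet> v s + (x s - x0) \<bullet> h (x s) (v s))) (at s)"
    if "0 \<le> s" "s \<le> 1" for s
  proof -
    have "(f' has_derivative (\<lambda>k. 2 * ((x s - x0) \<bullet> (k *\<^sub>R h (x s) (v s)) + (k *\<^sub>R v s) \<bullet> v s))) (at s)"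
      using dx[OF that] dv[OF that] unfolding f'_def[abs_def] has_vector_derivative_def
      by (auto intro!: derivative_eq_intros)
    then show ?thesis
      unfolding has_field_derivative_def
      by (rule has_derivative_eq_rhs) (auto simp: algebra_simps)
  qed
  have pos: "2 * (v s \<bullet> v s + (x s - x0) \<bullet> h (x s) (v s)) > 0" if s: "0 \<le> s" "s \<le> 1" for s
  proof -
    have "\<bar>(x s - x0) \<bullet> h (x s) (v s)\<bar> \<le> norm (x s - x0) * norm (h (x s) (v s))"
      by (rule Cauchy_Schwarz_ineq2)
    also have "\<dots> \<le> (17 * \<delta>) * (K * (norm (v s))\<^sup>2)"
      using jd(4,5)[of s] h_bound[of "x s" "v s"] s \<delta>
      by (intro mult_mono) (auto simp: dist_norm norm_minus_commute)
    also have "\<dots> = (17 * K * \<delta>) * (norm (v s))\<^sup>2" by simp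
    also have "\<dots> \<le> 1/2 * (norm (v s))\<^sup>2" using \<delta>(4) by (intro mult_right_mono) auto
    finally have "\<bar>(x s - x0) \<bullet> h (x s) (v s)\<bar> \<le> 1/2 * (norm (v s))\<^sup>2" .
    moreover have "norm (v s) > 0" using joins_moving[OF j ab(1,2), of s] s by simp
    then have "(norm (v s))\<^sup>2 > 0" by simp
    moreover have "0 < 2 * (y + z)" if "\<bar>z\<bar> \<le> 1/2 * y" "y > 0" for y z :: real
    proof -
      have "- z \<le> 1/2 * y" using that(1) by (simp add: abs_le_iff)
      then show ?thesis using that(2) by simp
    qed
    ultimately show ?thesis unfolding power2_norm_eq_inner by blast
  qed
  have fn: "f s = (dist x0 (x s))\<^sup>2" for s
    by (simp only: f_def dist_norm norm_minus_commute[of x0 "x s"] power2_norm_eq_inner)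
  have ft: "f t \<ge> \<delta>\<^sup>2"
    using out \<delta>(1) by (auto simp: fn intro: power_mono)
  have f01: "f 0 \<le> \<delta>\<^sup>2" "f 1 \<le> \<delta>\<^sup>2"
    using jd(2,3) ab by (auto simp: fn intro: power_mono)
  obtain z1 where z1: "0 < z1" "z1 < t" "f t - f 0 = (t - 0) * f' z1"
    using MVT2[of 0 t f f'] df t by auto
  obtain z2 where z2: "t < z2" "z2 < 1" "f 1 - f t = (1 - t) * f' z2"
    using MVT2[of t 1 f f'] df t by auto
  have "t * f' z1 \<ge> 0" "(1 - t) * f' z2 \<le> 0" using z1 z2 ft f01 by auto
  then have "f' z1 \<ge> 0" "f' z2 \<le> 0" using t by (auto simp: zero_le_mult_iff mult_le_0_iff)
  moreover have "f' z1 < f' z2"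
  proof (rule DERIV_pos_imp_increasing[where f = f' and a = z1 and b = z2])
    show "z1 < z2" using z1 z2 by simp
    show "\<exists>y. (f' has_real_derivative y) (at s) \<and> 0 < y" if "z1 \<le> s" "s \<le> z2" for s
      using df'[of s] pos[of s] that z1 z2 by force
  qed
  ultimately show False by simp
qed

lemma joins_inside_ball:
  assumes j: "joins a b x v" and a: "a \<in> ball x0 \<delta>" and b: "b \<in> ball x0 \<delta>" and t: "t \<in> {0..1}"
  shows "x t \<in> ball x0 \<delta>"
proof (cases "a = b")
  case True
  have aR: "a \<in> cball x0 R" using flow_ball_in_domain small_ball_in_flow_ball a by auto
  have "a = x t"
    by (rule joins_unique[OF j constant_solves[OF aR]]) (use True a t \<delta> in auto)
  then show ?thesis using a by simp
next
  case False
  then show ?thesis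
    using joins_inside[OF j False, of t] joinsD(2,3)[OF j] a b t
    by (cases "t = 0 \<or> t = 1") auto
qed

text \<open>The geodesic is unique by \<open>joins_unique\<close>, so the choice is of no consequence.\<close>

definition vel :: "'a \<Rightarrow> 'a \<Rightarrow> 'a" where
  "vel a b = (SOME u. \<exists>x v. joins a b x v \<and> v 0 = u)"

lemma joins_vel:
  assumes "a \<in> cball x0 \<delta>" "b \<in> cball x0 \<delta>"
  obtains x v where "joins a b x v" "v 0 = vel a b"
proof -
  have "\<exists>u x v. joins a b x v \<and> v 0 = u" using joins_exists[OF assms] by blast
  then have "\<exists>x v. joins a b x v \<and> v 0 = vel a b" unfolding vel_def by (rule someI_ex)
  then show ?thesis using that by blast
qed

text \<open>The coordinate expression of the inverse of the exponential map: the ends of a short geodesic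
  are sent to its initial position and velocity.\<close>

definition launch :: "'a \<times> 'a \<Rightarrow> 'a \<times> 'a" where
  "launch = (\<lambda>(a, b). (a, vel a b))"

definition launch_set :: "('a \<times> 'a) set" where
  "launch_set = launch ` (ball x0 \<delta> \<times> ball x0 \<delta>)"

text \<open>One inequality is dependence of a geodesic on its ends, the other is dependence on its
  initial values.\<close>

lemma launch_bilipschitz:
  assumes "p \<in> cball x0 \<delta> \<times> cball x0 \<delta>" "q \<in> cball x0 \<delta> \<times> cball x0 \<delta>"
  shows "dist (launch p) (launch q) \<le> 7 * dist p q" "dist p q \<le> 5 * dist (launch p) (launch q)"
proof -
  obtain a b a' b' where e: "p = (a, b)" "q = (a', b')" by fastforce
  obtain x v where j: "joins a b x v" "v 0 = vel a b" using joins_vel[of a b] assms e by auto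
  obtain y w where k: "joins a' b' y w" "w 0 = vel a' b'" using joins_vel[of a' b'] assms e by auto
  note jd = joinsD[OF j(1)] and kd = joinsD[OF k(1)]
  have "norm (v 0 - w 0) \<le> 2 * (norm (x 0 - y 0) + norm ((x 1 - y 1) - (x 0 - y 0)))"
    by (rule difference_by_endpoints[OF jd(1) kd(1) jd(4) kd(4) jd(6) kd(6) small_speed]) auto
  also have "\<dots> \<le> 4 * norm (a - a') + 2 * norm (b - b')"
    using norm_triangle_ineq4[of "b - b'" "a - a'"] jd kd by simp
  finally have "dist (vel a b) (vel a' b') \<le> 4 * dist a a' + 2 * dist b b'"
    using j k by (simp add: dist_norm)
  moreover have "dist (launch p) (launch q) \<le> dist a a' + dist (vel a b) (vel a' b')"
    by (simp add: launch_def e dist_Pair_le)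
  moreover have "dist a a' \<le> dist p q" "dist b b' \<le> dist p q"
    using dist_fst_le[of p q] dist_snd_le[of p q] by (auto simp: e)
  ultimately show "dist (launch p) (launch q) \<le> 7 * dist p q" by linarith
  have "norm (x 1 - y 1) \<le> 2 * (norm (x 0 - y 0) + norm (v 0 - w 0))"
    by (rule difference_by_initial_values[OF jd(1) kd(1) jd(4) kd(4) jd(6) kd(6) small_speed]) auto
  then have "dist b b' \<le> 2 * dist a a' + 2 * dist (vel a b) (vel a' b')"
    using j k jd kd by (simp add: dist_norm)
  moreover have "dist p q \<le> dist a a' + dist b b'" by (simp add: e dist_Pair_le)
  moreover have "dist a a' \<le> dist (launch p) (launch q)"
    "dist (vel a b) (vel a' b') \<le> dist (launch p) (launch q)"
    using dist_fst_le[of "launch p" "launch q"] dist_snd_le[of "launch p" "launch q"]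
    by (auto simp: e launch_def)
  ultimately show "dist p q \<le> 5 * dist (launch p) (launch q)" by linarith
qed

lemma launch_inj: "inj_on launch (ball x0 \<delta> \<times> ball x0 \<delta>)"
proof (rule inj_onI)
  fix p q assume "p \<in> ball x0 \<delta> \<times> ball x0 \<delta>" "q \<in> ball x0 \<delta> \<times> ball x0 \<delta>" "launch p = launch q"
  then have "dist p q \<le> 0" using launch_bilipschitz(2)[of p q] by auto
  then show "p = q" by simp
qed

lemma launch_lipschitz: "7-lipschitz_on (ball x0 \<delta> \<times> ball x0 \<delta>) launch"
  using launch_bilipschitz(1) by (intro lipschitz_onI) auto

text \<open>Invariance of domain replaces an inverse function theorem for the exponential map, which is
  only Lipschitz.\<close>

lemma launch_set_open: "open launch_set"
  unfolding launch_set_def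
  by (rule invariance_of_domain[OF _ _ launch_inj])
     (auto intro: open_Times lipschitz_on_continuous_on[OF launch_lipschitz])

text \<open>The coordinate expression of the exponential map.\<close>

definition land :: "'a \<times> 'a \<Rightarrow> 'a \<times> 'a" where
  "land = inv_into (ball x0 \<delta> \<times> ball x0 \<delta>) launch"

lemma land_lipschitz: "5-lipschitz_on launch_set land"
proof (rule lipschitz_onI)
  fix p q assume "p \<in> launch_set" "q \<in> launch_set"
  then obtain p' q' where e: "p = launch p'" "q = launch q'"
    "p' \<in> ball x0 \<delta> \<times> ball x0 \<delta>" "q' \<in> ball x0 \<delta> \<times> ball x0 \<delta>" by (auto simp: launch_set_def)
  then show "dist (land p) (land q) \<le> 5 * dist p q"
    using launch_bilipschitz(2)[of p' q'] inv_into_f_f[OF launch_inj] by (auto simp: land_def)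
qed simp

lemma land_launch: "p \<in> ball x0 \<delta> \<times> ball x0 \<delta> \<Longrightarrow> land (launch p) = p"
  unfolding land_def by (rule inv_into_f_f[OF launch_inj])

lemma launch_land: "p \<in> launch_set \<Longrightarrow> launch (land p) = p"
  unfolding land_def launch_set_def by (rule f_inv_into_f)

text \<open>Slowing down a geodesic by the factor \<open>s\<close> yields the geodesic to its intermediate point at
  time \<open>s\<close>. By convexity this point is again in the ball.\<close>

lemma launch_set_star:
  assumes "(a, u) \<in> launch_set" "s \<in> {0..1}"
  shows "(a, s *\<^sub>R u) \<in> launch_set"
proof -
  obtain b where b: "b \<in> ball x0 \<delta>" "a \<in> ball x0 \<delta>" "u = vel a b"
    using assms by (auto simp: launch_set_def launch_def)
  obtain x v where j: "joins a b x v" "v 0 = vel a b" using joins_vel[of a b] b by auto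
  note jd = joinsD[OF j(1)]
  have st: "s * t \<in> {0..1}" if "t \<in> {0..1}" for t
    using assms(2) that by (auto intro: mult_le_one)
  have xs: "x (s * t) \<in> ball x0 \<delta>" if "t \<in> {0..1}" for t
    using joins_inside_ball[OF j(1) b(2,1) st[OF that]] .
  then have c: "x s \<in> ball x0 \<delta>" using xs[of 1] by simp
  obtain y w where k: "joins a (x s) y w" "w 0 = vel a (x s)" using joins_vel[of a "x s"] b c by auto
  have sol: "solves h {0..1} (\<lambda>t. x (0 + s * t)) (\<lambda>t. s *\<^sub>R v (0 + s * t))"
    by (rule solves_rescale[OF jd(1)]) (use st jd(4) assms(2) in \<open>auto intro: hom_nonneg\<close>)
  have "s *\<^sub>R v (0 + s * 0) = w 0"
  proof (rule joins_unique(2)[OF k(1) sol])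
    fix t :: real assume t: "t \<in> {0..1}"
    show "x (0 + s * t) \<in> cball x0 (17 * \<delta>)" using jd(5)[OF st[OF t]] by simp
    have "s * norm (v (s * t)) \<le> 1 * norm (v (s * t))" using assms(2) by (intro mult_right_mono) auto
    then show "norm (s *\<^sub>R v (0 + s * t)) \<le> 8 * \<delta>"
      using jd(6)[OF st[OF t]] assms(2) by simp
  qed (use jd in auto)
  then have "(a, s *\<^sub>R u) = launch (a, x s)" using j k b by (simp add: launch_def)
  then show ?thesis using b c by (auto simp: launch_set_def)
qed

end

section \<open>Lipeomorphisms seen through one chart\<close>

lemma transition_at:
  "inj_on (snd c) (fst c) \<Longrightarrow> x \<in> fst c \<Longrightarrow> transition c d (snd c x) = snd d x"
  by (simp add: transition_def)

text \<open>The Lipschitz conditions refer to all charts of the families. A single chart \<open>c\<close> that covers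
  the space suffices to verify them if it is compatible, in the Lipschitz sense, with every member
  of the family \<open>F\<close>.\<close>

definition adapted_chart ::
    "'x topology \<Rightarrow> ('x, 'a::metric_space) chart set \<Rightarrow> ('x, 'a) chart \<Rightarrow> bool" where
  "adapted_chart X F c \<longleftrightarrow> topspace X \<subseteq> fst c \<and>
     homeomorphic_map X (top_of_set (snd c ` topspace X)) (snd c) \<and>
     (\<forall>e\<in>insert c F. inj_on (snd e) (fst e)) \<and>
     (\<forall>e\<in>F. locally_lipschitz_on (snd c ` (topspace X \<inter> fst e)) (transition c e) \<and>
        locally_lipschitz_on (snd e ` (topspace X \<inter> fst e)) (transition e c))"

lemma locally_lipschitz_map_through_charts:
  assumes c: "adapted_chart X F c" and d: "adapted_chart Y G d"
    and f: "\<And>x. x \<in> topspace X \<Longrightarrow> f x \<in> topspace Y \<and> snd d (f x) = g (snd c x)"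
    and g: "locally_lipschitz_on (snd c ` topspace X) g"
  shows "locally_lipschitz_map F G (topspace X) f"
  unfolding locally_lipschitz_map_def
proof (intro ballI)
  fix e e' assume e: "e \<in> F" "e' \<in> G"
  let ?X = "{x \<in> topspace X \<inter> fst e. f x \<in> fst e'}"
  have inj: "inj_on (snd c) (fst c)" "inj_on (snd e) (fst e)" "inj_on (snd d) (fst d)"
    using c d e by (auto simp: adapted_chart_def)
  have sub: "topspace X \<subseteq> fst c" "topspace Y \<subseteq> fst d" using c d by (auto simp: adapted_chart_def)
  have "locally_lipschitz_on (snd e ` ?X) (transition e c)"
    using c e by (auto simp: adapted_chart_def intro: locally_lipschitz_on_subset)
  moreover have "transition e c ` snd e ` ?X \<subseteq> snd c ` ?X"
    by (auto simp: transition_at[OF inj(2)])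
  moreover have "locally_lipschitz_on (snd c ` ?X) g"
    by (rule locally_lipschitz_on_subset[OF g]) auto
  ultimately have 1: "locally_lipschitz_on (snd e ` ?X) (g \<circ> transition e c)"
    by (blast intro: locally_lipschitz_on_compose)
  have 2: "(g \<circ> transition e c) ` snd e ` ?X \<subseteq> snd d ` (topspace Y \<inter> fst e')"
  proof (clarify, rule image_eqI)
    fix x assume x: "x \<in> topspace X" "x \<in> fst e" "f x \<in> fst e'"
    show "(g \<circ> transition e c) (snd e x) = snd d (f x)"
      using x f[of x] by (simp add: transition_at[OF inj(2)])
    show "f x \<in> topspace Y \<inter> fst e'" using x f[of x] by simp
  qed
  have "locally_lipschitz_on (snd d ` (topspace Y \<inter> fst e')) (transition d e')"
    using d e by (auto simp: adapted_chart_def)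
  from locally_lipschitz_on_compose[OF 1 this 2]
  have "locally_lipschitz_on (snd e ` ?X) (transition d e' \<circ> (g \<circ> transition e c))" .
  moreover have "(transition d e' \<circ> (g \<circ> transition e c)) z = (snd e' \<circ> f \<circ> inv_into (fst e) (snd e)) z"
    if z: "z \<in> snd e ` ?X" for z
  proof -
    obtain x where x: "z = snd e x" "x \<in> ?X" using z by auto
    then have "(transition d e' \<circ> (g \<circ> transition e c)) z = transition d e' (snd d (f x))"
      using f[of x] by (simp add: transition_at[OF inj(2)])
    also have "\<dots> = snd e' (f x)" using f[of x] x sub(2) by (intro transition_at[OF inj(3)]) auto
    finally show ?thesis using x inj(2) by simp
  qed
  ultimately show "locally_lipschitz_on (snd e ` ?X) (snd e' \<circ> f \<circ> inv_into (fst e) (snd e))"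
    using locally_lipschitz_on_cong by blast
qed

text \<open>Reduces the assertion to a pair of mutually inverse locally Lipschitz maps \<open>g\<close>, \<open>g'\<close> between
  sets of coordinates. The sources are open parts of the tangent bundle and of
  its fibres, the targets open sets and their squares.\<close>

lemma lipeomorphism_through_charts:
  assumes c: "adapted_chart X F c" and d: "adapted_chart Y G d"
    and f: "\<And>x. x \<in> topspace X \<Longrightarrow> f x \<in> topspace Y \<and> snd d (f x) = g (snd c x)"
    and g: "locally_lipschitz_on (snd c ` topspace X) g"
    and g': "locally_lipschitz_on (snd d ` topspace Y) g'"
    and gg': "\<And>z. z \<in> snd c ` topspace X \<Longrightarrow> g' (g z) = z"
    and g'g: "\<And>z. z \<in> snd d ` topspace Y \<Longrightarrow> g' z \<in> snd c ` topspace X \<and> g (g' z) = z"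
  shows "lipeomorphism X F Y G f"
proof -
  have inj: "inj_on (snd c) (topspace X)" "inj_on (snd d) (topspace Y)"
    using c d by (auto simp: adapted_chart_def intro: inj_on_subset)
  have "homeomorphic_maps (top_of_set (snd c ` topspace X)) (top_of_set (snd d ` topspace Y)) g g'"
    unfolding homeomorphic_maps_def
  proof (intro conjI)
    show "continuous_map (top_of_set (snd c ` topspace X)) (top_of_set (snd d ` topspace Y)) g"
      using locally_lipschitz_on_continuous[OF g] f by force
    show "continuous_map (top_of_set (snd d ` topspace Y)) (top_of_set (snd c ` topspace X)) g'"
      using locally_lipschitz_on_continuous[OF g'] g'g by auto
  qed (use gg' g'g in auto)
  then have hg: "homeomorphic_map (top_of_set (snd c ` topspace X)) (top_of_set (snd d ` topspace Y)) g"
    using homeomorphic_map_maps by blast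
  have hc: "homeomorphic_map X (top_of_set (snd c ` topspace X)) (snd c)"
    and hd: "homeomorphic_map Y (top_of_set (snd d ` topspace Y)) (snd d)"
    using c d by (auto simp: adapted_chart_def)
  obtain k where k: "homeomorphic_maps Y (top_of_set (snd d ` topspace Y)) (snd d) k"
    using hd homeomorphic_map_maps by blast
  then have hk: "homeomorphic_map (top_of_set (snd d ` topspace Y)) Y k"
    using homeomorphic_maps_sym homeomorphic_map_maps by blast
  have kd: "k (snd d y) = y" if "y \<in> topspace Y" for y using k that by (auto simp: homeomorphic_maps_def)
  have "homeomorphic_map X Y (k \<circ> (g \<circ> snd c))"
    by (intro homeomorphic_map_compose[OF _ hk] homeomorphic_map_compose[OF hc hg])
  then have hf: "homeomorphic_map X Y f"
    by (rule homeomorphic_map_eq) (use f kd in \<open>metis comp_apply\<close>)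
  then have fim: "f ` topspace X = topspace Y" and finj: "inj_on f (topspace X)"
    by (auto simp: homeomorphic_eq_everything_map)
  have inv: "inv_into (topspace X) f y \<in> topspace X \<and> snd c (inv_into (topspace X) f y) = g' (snd d y)"
    if "y \<in> topspace Y" for y
  proof -
    obtain x where x: "y = f x" "x \<in> topspace X" using \<open>y \<in> topspace Y\<close> fim by blast
    then show ?thesis using f[of x] finj gg' by simp
  qed
  show ?thesis
    unfolding lipeomorphism_def
    using hf locally_lipschitz_map_through_charts[OF c d f g]
      locally_lipschitz_map_through_charts[OF d c inv g'] by blast
qed

section \<open>Charts of the manifold and of its tangent bundle\<close>

lemma chart_inj: "is_chart c \<Longrightarrow> inj_on (snd c) (fst c)"
  unfolding is_chart_def homeomorphism_def by (metis inj_on_inverseI)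

lemma chart_continuous: "is_chart c \<Longrightarrow> continuous_on (fst c) (snd c)"
  and chart_inv_continuous: "is_chart c \<Longrightarrow> continuous_on (snd c ` fst c) (inv_into (fst c) (snd c))"
  unfolding is_chart_def homeomorphism_def by auto

lemma chart_image_open:
  assumes "is_chart c" "open U" shows "open (snd c ` (fst c \<inter> U))"
proof -
  have "openin (top_of_set (snd c ` fst c)) (snd c ` (fst c \<inter> U))"
    using assms unfolding is_chart_def
    by (intro homeomorphism_imp_open_map) (auto simp: openin_open_Int)
  then show ?thesis using assms unfolding is_chart_def by (auto dest: openin_open_trans)
qed

lemma chart_preimage_open:
  assumes "is_chart c" "open B" shows "open {q \<in> fst c. snd c q \<in> B}"
proof -
  have "open (snd c -` B \<inter> fst c)"
    using assms chart_continuous[OF assms(1)] continuous_on_open_vimage[of "fst c" "snd c"]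
    unfolding is_chart_def by blast
  moreover have "snd c -` B \<inter> fst c = {q \<in> fst c. snd c q \<in> B}" by auto
  ultimately show ?thesis by simp
qed

definition jac :: "('m, 'a::real_normed_vector) chart \<Rightarrow> ('m, 'a) chart \<Rightarrow> 'a \<Rightarrow> 'a \<Rightarrow> 'a" where
  "jac c d x = frechet_derivative (transition c d) (at x)"

definition tangent_transition ::
    "('m, 'a::real_normed_vector) chart \<Rightarrow> ('m, 'a) chart \<Rightarrow> 'a \<times> 'a \<Rightarrow> 'a \<times> 'a" where
  "tangent_transition c d = (\<lambda>(x, v). (transition c d x, jac c d x v))"

text \<open>The tangent vector at \<open>q\<close> with components \<open>v\<close> in the chart \<open>c\<close>.\<close>

definition lift :: "('m, 'a::real_normed_vector) chart set \<Rightarrow> ('m, 'a) chart \<Rightarrow> 'm \<Rightarrow> 'a \<Rightarrow> ('m, 'a) tvec"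
  where "lift A c q v = (q, \<lambda>d. if d \<in> A \<and> q \<in> fst d then jac c d (snd c q) v else 0)"

definition square_chart :: "('m, 'a) chart \<Rightarrow> ('m \<times> 'm, 'a \<times> 'a) chart" where
  "square_chart c = (fst c \<times> fst c, map_prod (snd c) (snd c))"

locale C21_atlas =
  fixes A :: "('m::t2_space, 'a::euclidean_space) chart set"
  assumes structure_A: "C21_structure A"
begin

lemma chart: "c \<in> A \<Longrightarrow> is_chart c"
  using structure_A by (simp add: C21_structure_def)

lemmas inj = chart_inj[OF chart]

lemma inv_chart [simp]: "c \<in> A \<Longrightarrow> q \<in> fst c \<Longrightarrow> inv_into (fst c) (snd c) (snd c q) = q"
  by (simp add: inj)

lemma open_chart: "c \<in> A \<Longrightarrow> open (fst c)" using chart by (auto simp: is_chart_def)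

lemma overlap_open: "c \<in> A \<Longrightarrow> d \<in> A \<Longrightarrow> open (snd c ` (fst c \<inter> fst d))"
  by (intro chart_image_open chart open_chart)

lemma transition_chart [simp]: "c \<in> A \<Longrightarrow> q \<in> fst c \<Longrightarrow> transition c d (snd c q) = snd d q"
  by (simp add: transition_at inj)

text \<open>The derivatives as bounded linear maps, which are needed to differentiate Jacobians along
  curves.\<close>

lemma transition_derivatives:
  assumes "c \<in> A" "d \<in> A"
  obtains F F' where
    "\<And>x. x \<in> snd c ` (fst c \<inter> fst d) \<Longrightarrow> jac c d x = blinfun_apply (F x)"
    "\<And>x. x \<in> snd c ` (fst c \<inter> fst d) \<Longrightarrow> (transition c d has_derivative blinfun_apply (F x)) (at x)"
    "\<And>x. x \<in> snd c ` (fst c \<inter> fst d) \<Longrightarrow> (F has_derivative blinfun_apply (F' x)) (at x)"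
    "continuous_on (snd c ` (fst c \<inter> fst d)) F'"
proof -
  have "C21_on (snd c ` (fst c \<inter> fst d)) (transition c d)"
    using structure_A assms by (auto simp: C21_structure_def C21_compatible_def)
  then obtain F F' where F:
    "\<forall>x\<in>snd c ` (fst c \<inter> fst d). (transition c d has_derivative blinfun_apply (F x)) (at x)"
    "\<forall>x\<in>snd c ` (fst c \<inter> fst d). (F has_derivative blinfun_apply (F' x)) (at x)"
    "locally_lipschitz_on (snd c ` (fst c \<inter> fst d)) F'"
    unfolding C21_on_def by blast
  show ?thesis
  proof (rule that)
    show "jac c d x = blinfun_apply (F x)" if "x \<in> snd c ` (fst c \<inter> fst d)" for x
      using frechet_derivative_at F(1) that unfolding jac_def by metis
    show "continuous_on (snd c ` (fst c \<inter> fst d)) F'" using F(3) by (rule locally_lipschitz_on_continuous)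
  qed (use F in auto)
qed

lemma jac_derivative:
  assumes "c \<in> A" "d \<in> A" "q \<in> fst c" "q \<in> fst d"
  shows "(transition c d has_derivative jac c d (snd c q)) (at (snd c q))"
proof -
  have "snd c q \<in> snd c ` (fst c \<inter> fst d)" using assms by auto
  with transition_derivatives[OF assms(1,2)] show ?thesis by metis
qed

lemma jac_same:
  assumes "c \<in> A" "q \<in> fst c"
  shows "jac c c (snd c q) v = v"
proof -
  have "(transition c c has_derivative (\<lambda>v. v)) (at (snd c q))"
  proof (rule has_derivative_transform_within_open[OF has_derivative_ident])
    show "open (snd c ` (fst c \<inter> fst c))" using overlap_open assms by blast
  qed (use assms in auto)
  from has_derivative_unique[OF jac_derivative[OF assms(1,1,2,2)] this] show ?thesis by metis
qed

lemma jac_chain: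
  assumes A: "c \<in> A" "d \<in> A" "e \<in> A" and q: "q \<in> fst c" "q \<in> fst d" "q \<in> fst e"
  shows "jac d e (snd d q) (jac c d (snd c q) v) = jac c e (snd c q) v"
proof -
  have "(transition d e has_derivative jac d e (snd d q)) (at (transition c d (snd c q)))"
    using jac_derivative[OF A(2,3) q(2,3)] A q by simp
  from has_derivative_compose[OF jac_derivative[OF A(1,2) q(1,2)] this]
  have "((\<lambda>x. transition d e (transition c d x)) has_derivative
      (\<lambda>v. jac d e (snd d q) (jac c d (snd c q) v))) (at (snd c q))" .
  then have "(transition c e has_derivative (\<lambda>v. jac d e (snd d q) (jac c d (snd c q) v))) (at (snd c q))"
  proof (rule has_derivative_transform_within_open)
    show "open (snd c ` (fst c \<inter> (fst d \<inter> fst e)))"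
      using A by (intro chart_image_open chart open_Int open_chart)
  qed (use A q in auto)
  from has_derivative_unique[OF this jac_derivative[OF A(1,3) q(1,3)]] show ?thesis by metis
qed

lemma lift_component:
  "d \<in> A \<Longrightarrow> q \<in> fst d \<Longrightarrow> snd (lift A c q v) d = jac c d (snd c q) v"
  by (simp add: lift_def)

lemma lift_TM:
  assumes "c \<in> A" "q \<in> fst c"
  shows "lift A c q v \<in> TM A" "snd (lift A c q v) c = v" "fst (lift A c q v) = q"
proof -
  show "snd (lift A c q v) c = v" using assms by (simp add: lift_component jac_same)
  show "fst (lift A c q v) = q" by (simp add: lift_def)
  show "lift A c q v \<in> TM A"
    unfolding TM_def lift_def mem_Collect_eq case_prod_conv
  proof (intro conjI ballI allI impI)
    fix d e assume "d \<in> A" "e \<in> A" "q \<in> fst d \<and> q \<in> fst e"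
    then show "(if e \<in> A \<and> q \<in> fst e then jac c e (snd c q) v else 0)
        = frechet_derivative (transition d e) (at (snd d q))
            (if d \<in> A \<and> q \<in> fst d then jac c d (snd c q) v else 0)"
      using jac_chain[of c d e q v] assms by (simp add: jac_def)
  qed auto
qed

lemma TM_change:
  assumes v: "v \<in> TM A" and A: "c \<in> A" "d \<in> A" and q: "fst v \<in> fst c" "fst v \<in> fst d"
  shows "snd v d = jac c d (snd c (fst v)) (snd v c)"
proof -
  have "\<forall>c\<in>A. \<forall>d\<in>A. fst v \<in> fst c \<and> fst v \<in> fst d \<longrightarrow>
      snd v d = frechet_derivative (transition c d) (at (snd c (fst v))) (snd v c)"
    using v unfolding TM_def mem_Collect_eq case_prod_unfold by (rule conjunct1)
  with A q show ?thesis unfolding jac_def by blast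
qed

lemma TM_off_chart: "v \<in> TM A \<Longrightarrow> \<not> (c \<in> A \<and> fst v \<in> fst c) \<Longrightarrow> snd v c = 0"
  unfolding TM_def mem_Collect_eq case_prod_unfold by blast

lemma TM_eqI:
  assumes v: "v \<in> TM A" and w: "w \<in> TM A" and "c \<in> A" "fst v \<in> fst c" "fst w = fst v" "snd v c = snd w c"
  shows "v = w"
proof (rule prod_eqI)
  show "snd v = snd w"
  proof
    fix d
    show "snd v d = snd w d"
    proof (cases "d \<in> A \<and> fst v \<in> fst d")
      case True
      then show ?thesis using TM_change[OF v, of c d] TM_change[OF w, of c d] assms(3-6) by simp
    next
      case False
      then show ?thesis
        using TM_off_chart[OF v, of d] TM_off_chart[OF w, of d] \<open>fst w = fst v\<close> by simp
    qed
  qed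
qed (use assms in simp)

lemma TM_chart_inj:
  assumes "c \<in> A" shows "inj_on (snd (TM_chart A c)) (fst (TM_chart A c))"
proof (rule inj_onI)
  fix v w assume vw: "v \<in> fst (TM_chart A c)" "w \<in> fst (TM_chart A c)"
    "snd (TM_chart A c) v = snd (TM_chart A c) w"
  then have "fst v = fst w"
    using inj[OF assms] by (auto simp: TM_chart_def TM_over_def dest: inj_onD)
  then show "v = w"
    using vw assms by (intro TM_eqI) (auto simp: TM_chart_def TM_over_def)
qed

lemma lift_in_chart:
  assumes "c \<in> A" "q \<in> fst c"
  shows "lift A c q v \<in> fst (TM_chart A c)" "snd (TM_chart A c) (lift A c q v) = (snd c q, v)"
  using lift_TM[OF assms] assms by (auto simp: TM_chart_def TM_over_def)

lemma TM_chart_transition: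
  assumes "c \<in> A" "d \<in> A" "v \<in> fst (TM_chart A c)" "v \<in> fst (TM_chart A d)"
  shows "snd (TM_chart A d) v = tangent_transition c d (snd (TM_chart A c) v)"
  using assms TM_change[of v c d] by (auto simp: TM_chart_def TM_over_def tangent_transition_def)

lemma transition_locally_lipschitz:
  assumes "c \<in> A" "d \<in> A"
  shows "locally_lipschitz_on (snd c ` (fst c \<inter> fst d)) (transition c d)"
proof -
  from transition_derivatives[OF assms] obtain F F' where F:
    "\<And>x. x \<in> snd c ` (fst c \<inter> fst d) \<Longrightarrow> (transition c d has_derivative blinfun_apply (F x)) (at x)"
    "\<And>x. x \<in> snd c ` (fst c \<inter> fst d) \<Longrightarrow> (F has_derivative blinfun_apply (F' x)) (at x)" by metis
  have "continuous_on (snd c ` (fst c \<inter> fst d)) F"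
    using F(2) by (meson continuous_at_imp_continuous_on has_derivative_continuous)
  then show ?thesis using F(1) overlap_open[OF assms] locally_lipschitz_on_C1 by blast
qed

lemma tangent_transition_locally_lipschitz:
  assumes "c \<in> A" "d \<in> A"
  shows "locally_lipschitz_on (snd c ` (fst c \<inter> fst d) \<times> UNIV) (tangent_transition c d)"
proof -
  let ?S = "snd c ` (fst c \<inter> fst d)"
  from transition_derivatives[OF assms] obtain F F' where F:
    "\<And>x. x \<in> ?S \<Longrightarrow> jac c d x = blinfun_apply (F x)"
    "\<And>x. x \<in> ?S \<Longrightarrow> (F has_derivative blinfun_apply (F' x)) (at x)"
    "continuous_on ?S F'" by metis
  have "locally_lipschitz_on ?S F" using F(2,3) overlap_open[OF assms] locally_lipschitz_on_C1 by blast
  then have "locally_lipschitz_on (?S \<times> UNIV) (\<lambda>(x, v). blinfun_apply (F x) v)"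
    by (rule locally_lipschitz_on_blinfun_apply)
  moreover have "locally_lipschitz_on (?S \<times> (UNIV :: 'a set)) (transition c d \<circ> fst)"
    by (rule locally_lipschitz_on_compose[OF locally_lipschitz_on_fst transition_locally_lipschitz[OF assms]]) auto
  ultimately have "locally_lipschitz_on (?S \<times> UNIV)
      (\<lambda>z. ((transition c d \<circ> fst) z, (\<lambda>(x, v). blinfun_apply (F x) v) z))"
    by (intro locally_lipschitz_on_Pair)
  then show ?thesis
    by (subst locally_lipschitz_on_cong) (auto simp: tangent_transition_def F(1))
qed

lemma topspace_TM: "topspace (TM_topology A) = TM A"
  unfolding TM_topology_def topology_generated_by_topspace
proof
  show "\<Union> {fst d \<inter> snd d -` B |d B. d \<in> TM_chart A ` A \<and> open B} \<subseteq> TM A"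
    by (auto simp: TM_chart_def TM_over_def)
  show "TM A \<subseteq> \<Union> {fst d \<inter> snd d -` B |d B. d \<in> TM_chart A ` A \<and> open B}"
  proof
    fix v assume v: "v \<in> TM A"
    have "fst v \<in> (\<Union>c\<in>A. fst c)" using structure_A by (simp add: C21_structure_def)
    then obtain c where c: "c \<in> A" "fst v \<in> fst c" by blast
    then have "v \<in> fst (TM_chart A c) \<inter> snd (TM_chart A c) -` UNIV"
      using v by (simp add: TM_chart_def TM_over_def)
    with c(1) show "v \<in> \<Union> {fst d \<inter> snd d -` B |d B. d \<in> TM_chart A ` A \<and> open B}"
      using open_UNIV by blast
  qed
qed

lemma TM_chart_open:
  assumes "c \<in> A" "open B"
  shows "openin (TM_topology A) (fst (TM_chart A c) \<inter> snd (TM_chart A c) -` B)"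
  unfolding TM_topology_def using assms by (intro topology_generated_by_Basis) blast

text \<open>The topology is generated from all charts, so the point is continuity of the inverse of one
  chart: the preimages of the generators that belong to another chart \<open>d\<close> are open because the
  coordinate change from \<open>c\<close> to \<open>d\<close> is continuous.\<close>

lemma TM_chart_homeomorphic:
  assumes c: "c \<in> A" and S: "S \<subseteq> fst (TM_chart A c)"
  shows "homeomorphic_map (subtopology (TM_topology A) S) (top_of_set (snd (TM_chart A c) ` S))
      (snd (TM_chart A c))"
proof -
  let ?\<psi> = "snd (TM_chart A c)" and ?T = "subtopology (TM_topology A) S"
  define \<theta> where "\<theta> z = lift A c (inv_into (fst c) (snd c) (fst z)) (snd z)" for z :: "'a \<times> 'a"
  have topS: "topspace ?T = S"
    using S topspace_TM by (auto simp: TM_chart_def TM_over_def)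
  have \<theta>\<psi>: "\<theta> (?\<psi> v) = v" if v: "v \<in> S" for v
  proof -
    have m: "v \<in> TM A" "fst v \<in> fst c" using v S by (auto simp: TM_chart_def TM_over_def)
    have "\<theta> (?\<psi> v) = lift A c (fst v) (snd v c)" using m c by (simp add: \<theta>_def TM_chart_def)
    also have "\<dots> = v" using lift_TM[OF c m(2)] m c by (intro TM_eqI[where c = c]) auto
    finally show ?thesis .
  qed
  have cont1: "continuous_map ?T (top_of_set (?\<psi> ` S)) ?\<psi>"
    unfolding continuous_map topS
  proof (intro conjI allI impI)
    show "?\<psi> ` S \<subseteq> topspace (top_of_set (?\<psi> ` S))" by simp
    fix U assume "openin (top_of_set (?\<psi> ` S)) U"
    then obtain B where B: "open B" "U = ?\<psi> ` S \<inter> B" by (auto simp: openin_open)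
    have "{x \<in> S. ?\<psi> x \<in> U} = (fst (TM_chart A c) \<inter> ?\<psi> -` B) \<inter> S" using S B by auto
    then show "openin ?T {x \<in> S. ?\<psi> x \<in> U}"
      using TM_chart_open[OF c B(1)] by (auto simp: openin_subtopology)
  qed
  have cont2: "continuous_map (top_of_set (?\<psi> ` S)) (TM_topology A) \<theta>"
    unfolding TM_topology_def
  proof (rule continuous_on_generated_topo)
    fix U assume "U \<in> {fst d \<inter> snd d -` B |d B. d \<in> TM_chart A ` A \<and> open B}"
    then obtain d B where d: "d \<in> A" "open B" "U = fst (TM_chart A d) \<inter> snd (TM_chart A d) -` B" by blast
    let ?O = "snd c ` (fst c \<inter> fst d) \<times> (UNIV :: 'a set)"
    have "open (?O \<inter> tangent_transition c d -` B)"
      using continuous_open_preimage[OF locally_lipschitz_on_continuous[OF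
          tangent_transition_locally_lipschitz[OF c d(1)]] _ d(2)] overlap_open[OF c d(1)]
      by (auto intro: open_Times)
    moreover have "\<theta> -` U \<inter> topspace (top_of_set (?\<psi> ` S)) = ?\<psi> ` S \<inter> (?O \<inter> tangent_transition c d -` B)"
    proof -
      have iff: "v \<in> U \<longleftrightarrow> ?\<psi> v \<in> ?O \<inter> tangent_transition c d -` B" if v: "v \<in> S" for v
      proof -
        have m: "v \<in> TM A" "fst v \<in> fst c" "v \<in> fst (TM_chart A c)"
          using v S by (auto simp: TM_chart_def TM_over_def)
        have "snd c (fst v) \<in> snd c ` (fst c \<inter> fst d) \<longleftrightarrow> fst v \<in> fst d"
          using inj[OF c] m by (auto dest: inj_onD)
        then have "?\<psi> v \<in> ?O \<longleftrightarrow> v \<in> fst (TM_chart A d)"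
          using m by (auto simp: TM_chart_def TM_over_def)
        then show ?thesis using TM_chart_transition[OF c d(1) m(3)] d(3) by auto
      qed
      show ?thesis
      proof (rule set_eqI)
        fix z
        show "z \<in> \<theta> -` U \<inter> topspace (top_of_set (?\<psi> ` S))
            \<longleftrightarrow> z \<in> ?\<psi> ` S \<inter> (?O \<inter> tangent_transition c d -` B)"
        proof (cases "z \<in> ?\<psi> ` S")
          case True
          then obtain v where v: "v \<in> S" "z = ?\<psi> v" by blast
          then show ?thesis using iff[OF v(1)] \<theta>\<psi>[OF v(1)] by simp
        qed simp
      qed
    qed
    ultimately show "openin (top_of_set (?\<psi> ` S)) (\<theta> -` U \<inter> topspace (top_of_set (?\<psi> ` S)))"
      by (metis openin_open_Int)
  next
    have "\<theta> ` (?\<psi> ` S) \<subseteq> topspace (TM_topology A)"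
      using \<theta>\<psi> S topspace_TM by (auto simp: TM_chart_def TM_over_def)
    then show "\<theta> ` topspace (top_of_set (?\<psi> ` S))
        \<subseteq> \<Union> {fst d \<inter> snd d -` B |d B. d \<in> TM_chart A ` A \<and> open B}"
      unfolding TM_topology_def topology_generated_by_topspace by simp
  qed
  have "homeomorphic_maps ?T (top_of_set (?\<psi> ` S)) ?\<psi> \<theta>"
    unfolding homeomorphic_maps_def topS
  proof (intro conjI cont1)
    show "continuous_map (top_of_set (?\<psi> ` S)) ?T \<theta>"
      using cont2 \<theta>\<psi> by (auto simp: continuous_map_in_subtopology)
  qed (use \<theta>\<psi> in auto)
  then show ?thesis using homeomorphic_map_maps by blast
qed

lemma adapted_TM_chart:
  assumes c: "c \<in> A" and S: "S \<subseteq> fst (TM_chart A c)"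
  shows "adapted_chart (subtopology (TM_topology A) S) (TM_chart A ` A) (TM_chart A c)"
proof -
  have topS: "topspace (subtopology (TM_topology A) S) = S"
    using S topspace_TM by (auto simp: TM_chart_def TM_over_def)
  have ll: "locally_lipschitz_on (snd (TM_chart A d) ` (S \<inter> fst (TM_chart A e)))
      (transition (TM_chart A d) (TM_chart A e))"
    if d: "d \<in> A" and e: "e \<in> A" and S: "S \<subseteq> fst (TM_chart A d)" for d e S
  proof -
    have "snd (TM_chart A d) ` (S \<inter> fst (TM_chart A e)) \<subseteq> snd d ` (fst d \<inter> fst e) \<times> UNIV"
      using S by (auto simp: TM_chart_def TM_over_def)
    then have "locally_lipschitz_on (snd (TM_chart A d) ` (S \<inter> fst (TM_chart A e))) (tangent_transition d e)"
      by (rule locally_lipschitz_on_subset[OF tangent_transition_locally_lipschitz[OF d e]])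
    moreover have "tangent_transition d e z = transition (TM_chart A d) (TM_chart A e) z"
      if z: "z \<in> snd (TM_chart A d) ` (S \<inter> fst (TM_chart A e))" for z
    proof -
      obtain v where v: "v \<in> S" "v \<in> fst (TM_chart A e)" "z = snd (TM_chart A d) v" using z by blast
      with S have "v \<in> fst (TM_chart A d)" by blast
      then show ?thesis
        using TM_chart_transition[OF d e _ v(2)] transition_at[OF TM_chart_inj[OF d]] v(3) by metis
    qed
    ultimately show ?thesis using locally_lipschitz_on_cong by blast
  qed
  show ?thesis
    unfolding adapted_chart_def topS
  proof (intro conjI ballI)
    fix e assume "e \<in> TM_chart A ` A"
    then obtain d where d: "d \<in> A" "e = TM_chart A d" by blast
    show "locally_lipschitz_on (snd (TM_chart A c) ` (S \<inter> fst e)) (transition (TM_chart A c) e)"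
      using ll[OF c d(1) S] d(2) by simp
    have "locally_lipschitz_on (snd (TM_chart A d) ` ((S \<inter> fst (TM_chart A d)) \<inter> fst (TM_chart A c)))
      (transition (TM_chart A d) (TM_chart A c))" by (rule ll[OF d(1) c]) auto
    moreover have "(S \<inter> fst (TM_chart A d)) \<inter> fst (TM_chart A c) = S \<inter> fst e" using S d(2) by auto
    ultimately show "locally_lipschitz_on (snd e ` (S \<inter> fst e)) (transition e (TM_chart A c))"
      using d(2) by simp
  next
    show "inj_on (snd e) (fst e)" if "e \<in> insert (TM_chart A c) (TM_chart A ` A)" for e
      using that c TM_chart_inj by blast
  qed (use S TM_chart_homeomorphic[OF c S] in auto)
qed

lemma chart_homeomorphic:
  assumes c: "c \<in> A" and S: "S \<subseteq> fst c"
  shows "homeomorphic_map (top_of_set S) (top_of_set (snd c ` S)) (snd c)"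
proof -
  have "homeomorphic_maps (top_of_set S) (top_of_set (snd c ` S)) (snd c) (inv_into (fst c) (snd c))"
    unfolding homeomorphic_maps_def
  proof (intro conjI)
    show "continuous_map (top_of_set S) (top_of_set (snd c ` S)) (snd c)"
      using continuous_on_subset[OF chart_continuous[OF chart[OF c]] S] by auto
    show "continuous_map (top_of_set (snd c ` S)) (top_of_set S) (inv_into (fst c) (snd c))"
      using continuous_on_subset[OF chart_inv_continuous[OF chart[OF c]], of "snd c ` S"] S c by auto
  qed (use S c in auto)
  then show ?thesis using homeomorphic_map_maps by blast
qed

lemma adapted_chart_base:
  assumes c: "c \<in> A" and S: "S \<subseteq> fst c"
  shows "adapted_chart (top_of_set S) A c"
  unfolding adapted_chart_def
proof (intro conjI ballI)
  fix e assume e: "e \<in> A"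
  show "locally_lipschitz_on (snd c ` (topspace (top_of_set S) \<inter> fst e)) (transition c e)"
    by (rule locally_lipschitz_on_subset[OF transition_locally_lipschitz[OF c e]]) (use S in auto)
  show "locally_lipschitz_on (snd e ` (topspace (top_of_set S) \<inter> fst e)) (transition e c)"
    by (rule locally_lipschitz_on_subset[OF transition_locally_lipschitz[OF e c]]) (use S in auto)
qed (use assms chart_homeomorphic inj in auto)

lemma prod_transition_locally_lipschitz:
  assumes A: "c1 \<in> A" "c2 \<in> A" "d1 \<in> A" "d2 \<in> A"
  defines "c \<equiv> (fst c1 \<times> fst c2, map_prod (snd c1) (snd c2))"
    and "d \<equiv> (fst d1 \<times> fst d2, map_prod (snd d1) (snd d2))"
  shows "locally_lipschitz_on (snd c ` (fst c \<inter> fst d)) (transition c d)"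
proof -
  let ?S = "snd c ` (fst c \<inter> fst d)"
  have "locally_lipschitz_on ?S (transition c1 d1 \<circ> fst)"
    by (rule locally_lipschitz_on_compose[OF locally_lipschitz_on_fst transition_locally_lipschitz])
       (use A in \<open>auto simp: c_def d_def\<close>)
  moreover have "locally_lipschitz_on ?S (transition c2 d2 \<circ> snd)"
    by (rule locally_lipschitz_on_compose[OF locally_lipschitz_on_snd transition_locally_lipschitz])
       (use A in \<open>auto simp: c_def d_def\<close>)
  ultimately have "locally_lipschitz_on ?S (\<lambda>z. ((transition c1 d1 \<circ> fst) z, (transition c2 d2 \<circ> snd) z))"
    by (rule locally_lipschitz_on_Pair)
  moreover have "inj_on (snd c) (fst c)"
    using map_prod_inj_on[OF inj[OF A(1)] inj[OF A(2)]] by (simp add: c_def)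
  then have "transition c d z = ((transition c1 d1 \<circ> fst) z, (transition c2 d2 \<circ> snd) z)" if "z \<in> ?S" for z
    using that A transition_at[of c _ d] by (auto simp: c_def d_def)
  ultimately show ?thesis using locally_lipschitz_on_cong by (metis (no_types, lifting))
qed

lemma adapted_square_chart:
  assumes c: "c \<in> A" and S: "S \<subseteq> fst c"
  shows "adapted_chart (top_of_set (S \<times> S)) (prod_charts A) (square_chart c)"
  unfolding adapted_chart_def
proof (intro conjI ballI)
  have sq: "square_chart c \<in> prod_charts A" using c unfolding square_chart_def prod_charts_def by blast
  have "inj_on (snd e) (fst e)" if e: "e \<in> prod_charts A" for e
  proof -
    obtain c d where "c \<in> A" "d \<in> A" "e = (fst c \<times> fst d, map_prod (snd c) (snd d))"
      using e unfolding prod_charts_def by blast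
    then show ?thesis using map_prod_inj_on[OF inj inj, of c d] by simp
  qed
  then show "inj_on (snd e) (fst e)" if "e \<in> insert (square_chart c) (prod_charts A)" for e
    using that sq by blast
  show "topspace (top_of_set (S \<times> S)) \<subseteq> fst (square_chart c)" using S by (auto simp: square_chart_def)
  have cS: "continuous_on S (snd c)" using continuous_on_subset[OF chart_continuous[OF chart[OF c]] S] .
  have ciS: "continuous_on (snd c ` S) (inv_into (fst c) (snd c))"
    using continuous_on_subset[OF chart_inv_continuous[OF chart[OF c]], of "snd c ` S"] S by auto
  have "homeomorphic_maps (top_of_set (S \<times> S)) (top_of_set (snd c ` S \<times> snd c ` S))
      (map_prod (snd c) (snd c)) (map_prod (inv_into (fst c) (snd c)) (inv_into (fst c) (snd c)))"
    unfolding homeomorphic_maps_def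
  proof (intro conjI)
    have "continuous_on (S \<times> S) (\<lambda>z. (snd c (fst z), snd c (snd z)))"
      by (intro continuous_on_Pair continuous_on_compose2[OF cS] continuous_intros) auto
    then show "continuous_map (top_of_set (S \<times> S)) (top_of_set (snd c ` S \<times> snd c ` S))
        (map_prod (snd c) (snd c))" by (auto simp: map_prod_def case_prod_unfold)
    have "continuous_on (snd c ` S \<times> snd c ` S)
        (\<lambda>z. (inv_into (fst c) (snd c) (fst z), inv_into (fst c) (snd c) (snd z)))"
      by (intro continuous_on_Pair continuous_on_compose2[OF ciS] continuous_intros) auto
    then show "continuous_map (top_of_set (snd c ` S \<times> snd c ` S)) (top_of_set (S \<times> S))
        (map_prod (inv_into (fst c) (snd c)) (inv_into (fst c) (snd c)))"
      using S c by (auto simp: map_prod_def case_prod_unfold)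
  qed (use S c in auto)
  then show "homeomorphic_map (top_of_set (S \<times> S))
      (top_of_set (snd (square_chart c) ` topspace (top_of_set (S \<times> S)))) (snd (square_chart c))"
    using homeomorphic_map_maps by (auto simp: square_chart_def map_prod_surj_on)
  fix e assume "e \<in> prod_charts A"
  then obtain d1 d2 where d: "d1 \<in> A" "d2 \<in> A" "e = (fst d1 \<times> fst d2, map_prod (snd d1) (snd d2))"
    unfolding prod_charts_def by blast
  show "locally_lipschitz_on (snd (square_chart c) ` (topspace (top_of_set (S \<times> S)) \<inter> fst e))
      (transition (square_chart c) e)"
    by (rule locally_lipschitz_on_subset[OF prod_transition_locally_lipschitz[OF c c d(1,2), folded d(3) square_chart_def]])
       (use S in \<open>auto simp: square_chart_def\<close>)
  show "locally_lipschitz_on (snd e ` (topspace (top_of_set (S \<times> S)) \<inter> fst e))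
      (transition e (square_chart c))"
    by (rule locally_lipschitz_on_subset[OF prod_transition_locally_lipschitz[OF d(1,2) c c, folded d(3) square_chart_def]])
       (use S in \<open>auto simp: square_chart_def\<close>)
qed

end

section \<open>The geodesic equation in charts\<close>

lemma (in C21_atlas) second_derivative:
  assumes A: "c \<in> A" "d \<in> A" and x: "x \<in> snd c ` (fst c \<inter> fst d)"
    and F: "\<And>x. x \<in> snd c ` (fst c \<inter> fst d) \<Longrightarrow> jac c d x = blinfun_apply (F x)"
    and F': "\<And>x. x \<in> snd c ` (fst c \<inter> fst d) \<Longrightarrow> (F has_derivative blinfun_apply (F' x)) (at x)"
  shows "frechet_derivative (\<lambda>y. jac c d y v) (at x) = (\<lambda>w. blinfun_apply (blinfun_apply (F' x) w) v)"
proof -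
  have "((\<lambda>y. blinfun_apply (F y) v) has_derivative (\<lambda>w. blinfun_apply (blinfun_apply (F' x) w) v)) (at x)"
    by (rule bounded_linear.has_derivative[OF blinfun.bounded_linear_left F'[OF x]])
  then have "((\<lambda>y. jac c d y v) has_derivative (\<lambda>w. blinfun_apply (blinfun_apply (F' x) w) v)) (at x)"
    by (rule has_derivative_transform_within_open[OF _ overlap_open[OF A] x]) (simp add: F)
  then show ?thesis by (rule frechet_derivative_at[symmetric])
qed

locale sprayed_manifold = C21_atlas A
  for A :: "('m::t2_space, 'a::euclidean_space) chart set" +
  fixes H :: "('m, 'a) spray"
  assumes spray: "locally_lipschitz_spray A H"
begin

lemma spray_lipschitz: "c \<in> A \<Longrightarrow> locally_lipschitz_on (snd c ` fst c \<times> UNIV) (\<lambda>(x, v). H c x v)"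
  and spray_homogeneous: "c \<in> A \<Longrightarrow> x \<in> snd c ` fst c \<Longrightarrow> s > 0 \<Longrightarrow> H c x (s *\<^sub>R v) = s\<^sup>2 *\<^sub>R H c x v"
  and spray_transform: "\<lbrakk>c \<in> A; d \<in> A; q \<in> fst c; q \<in> fst d\<rbrakk> \<Longrightarrow>
     H d (snd d q) (jac c d (snd c q) v) =
       frechet_derivative (\<lambda>y. jac c d y v) (at (snd c q)) v + jac c d (snd c q) (H c (snd c q) v)"
  using spray unfolding locally_lipschitz_spray_def Let_def jac_def by blast+

text \<open>The inhomogeneous term of the transformation law is quadratic in \<open>v\<close>, hence invariant under
  \<open>v \<mapsto> -v\<close>, while the Jacobian is odd.\<close>

lemma reverse_sprayed: "sprayed_manifold A (reverse_spray H)"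
proof
  show "locally_lipschitz_spray A (reverse_spray H)"
    unfolding locally_lipschitz_spray_def Let_def reverse_spray_def
  proof (intro conjI ballI allI impI)
    fix c assume c: "c \<in> A"
    let ?S = "snd c ` fst c \<times> (UNIV :: 'a set)"
    have "1-lipschitz_on ?S (\<lambda>(x, v). (x, - v))"
      by (rule lipschitz_onI) (auto simp: dist_Pair_Pair dist_minus)
    then have "locally_lipschitz_on ?S (\<lambda>(x, v). (x, - v))"
      by (rule lipschitz_on_imp_locally_lipschitz_on)
    moreover have "(\<lambda>(x, v). (x, - v)) ` ?S \<subseteq> ?S" by auto
    ultimately have "locally_lipschitz_on ?S ((\<lambda>(x, v). H c x v) \<circ> (\<lambda>(x, v). (x, - v)))"
      using spray_lipschitz[OF c] by (blast intro: locally_lipschitz_on_compose)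
    then show "locally_lipschitz_on ?S (\<lambda>(x, v). H c x (- v))" by (simp add: o_def case_prod_unfold)
  next
    fix c x v and s :: real assume c: "c \<in> A" "x \<in> snd c ` fst c" "s > 0"
    show "H c x (- (s *\<^sub>R v)) = s\<^sup>2 *\<^sub>R H c x (- v)"
      using spray_homogeneous[OF c, of "- v"] by simp
  next
    fix c d q v assume A: "c \<in> A" "d \<in> A" and "q \<in> fst c \<inter> fst d"
    then have q: "q \<in> fst c" "q \<in> fst d" and x: "snd c q \<in> snd c ` (fst c \<inter> fst d)" by auto
    from transition_derivatives[OF A] obtain F F' where F:
      "\<And>x. x \<in> snd c ` (fst c \<inter> fst d) \<Longrightarrow> jac c d x = blinfun_apply (F x)"
      "\<And>x. x \<in> snd c ` (fst c \<inter> fst d) \<Longrightarrow> (F has_derivative blinfun_apply (F' x)) (at x)" by metis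
    note sd = second_derivative[OF A x F]
    have "H d (snd d q) (- jac c d (snd c q) v) = H d (snd d q) (jac c d (snd c q) (- v))"
      by (simp add: F(1)[OF x] blinfun.minus_right)
    also have "\<dots> = frechet_derivative (\<lambda>y. jac c d y v) (at (snd c q)) v
        + jac c d (snd c q) (H c (snd c q) (- v))"
      using spray_transform[OF A q, of "- v"] by (simp add: sd blinfun.minus_right blinfun.minus_left)
    finally show "H d (snd d q) (- frechet_derivative (transition c d) (at (snd c q)) v) =
        frechet_derivative (\<lambda>y. frechet_derivative (transition c d) (at y) v) (at (snd c q)) v +
        frechet_derivative (transition c d) (at (snd c q)) (H c (snd c q) (- v))"
      unfolding jac_def .
  qed
qed

lemma spray_solution_in_chart:
  assumes sol: "spray_solution A H I \<sigma>" and c: "c \<in> A" and J: "J \<subseteq> I"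
    and in_c: "\<And>t. t \<in> J \<Longrightarrow> fst (\<sigma> t) \<in> fst c"
  shows "solves (H c) J (\<lambda>t. snd c (fst (\<sigma> t))) (\<lambda>t. snd (\<sigma> t) c)"
  unfolding solves_def
proof
  fix t assume t: "t \<in> J"
  have "((\<lambda>s. snd (TM_chart A c) (\<sigma> s)) has_vector_derivative
           (snd (\<sigma> t) c, H c (snd c (fst (\<sigma> t))) (snd (\<sigma> t) c))) (at t within I)"
    using sol c J t in_c unfolding spray_solution_def by blast
  then have "((\<lambda>s. snd (TM_chart A c) (\<sigma> s)) has_vector_derivative
           (snd (\<sigma> t) c, H c (snd c (fst (\<sigma> t))) (snd (\<sigma> t) c))) (at t within J)"
    using J by (rule has_vector_derivative_within_subset)
  from bounded_linear.has_vector_derivative[OF bounded_linear_fst this]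
    bounded_linear.has_vector_derivative[OF bounded_linear_snd this]
  show "((\<lambda>t. snd c (fst (\<sigma> t))) has_vector_derivative snd (\<sigma> t) c) (at t within J) \<and>
      ((\<lambda>t. snd (\<sigma> t) c) has_vector_derivative H c (snd c (fst (\<sigma> t))) (snd (\<sigma> t) c)) (at t within J)"
    by (simp add: TM_chart_def)
qed

text \<open>A solution of the equation in one chart solves it in every chart \<open>d\<close>: differentiating
  \<open>F (x t) (v t)\<close>, where \<open>F\<close> is the Jacobian of the coordinate change, by the product rule
  produces the two terms of the transformation law of the spray.\<close>

lemma spray_solution_lift:
  assumes c: "c \<in> A" and sol: "solves (H c) I x v" and im: "x ` I \<subseteq> snd c ` fst c"
  shows "spray_solution A H I (\<lambda>t. lift A c (inv_into (fst c) (snd c) (x t)) (v t))"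
proof -
  let ?q = "\<lambda>t. inv_into (fst c) (snd c) (x t)"
  have q: "?q t \<in> fst c" "snd c (?q t) = x t" if "t \<in> I" for t
  proof -
    have "x t \<in> snd c ` fst c" using im that by blast
    then show "?q t \<in> fst c" "snd c (?q t) = x t" by (auto simp: inv_into_into f_inv_into_f)
  qed
  have dx: "(x has_vector_derivative v t) (at t within I)"
    and dv: "(v has_vector_derivative H c (x t) (v t)) (at t within I)" if "t \<in> I" for t
    using sol that by (auto simp: solves_def)
  have xc: "continuous_on I x" by (rule continuous_on_vector_derivative[OF dx])
  show ?thesis
    unfolding spray_solution_def
  proof (intro conjI ballI impI)
    show "(\<lambda>t. lift A c (?q t) (v t)) ` I \<subseteq> TM A" using lift_TM(1)[OF c q(1)] by blast
    show "continuous_on I (fst \<circ> (\<lambda>t. lift A c (?q t) (v t)))"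
      using continuous_on_compose2[OF chart_inv_continuous[OF chart[OF c]] xc im]
      by (simp add: o_def lift_def)
  next
    fix d t assume d: "d \<in> A" and t: "t \<in> I" and qd': "fst (lift A c (?q t) (v t)) \<in> fst d"
    let ?S = "snd c ` (fst c \<inter> fst d)"
    have qd: "?q t \<in> fst d" using qd' by (simp add: lift_def)
    have xS: "x t \<in> ?S" using q[OF t] qd by (metis IntI image_eqI)
    from transition_derivatives[OF c d] obtain F F' where F:
      "\<And>x. x \<in> ?S \<Longrightarrow> jac c d x = blinfun_apply (F x)"
      "\<And>x. x \<in> ?S \<Longrightarrow> (transition c d has_derivative blinfun_apply (F x)) (at x)"
      "\<And>x. x \<in> ?S \<Longrightarrow> (F has_derivative blinfun_apply (F' x)) (at x)" by metis
    have "((transition c d \<circ> x) has_vector_derivative blinfun_apply (F (x t)) (v t)) (at t within I)"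
      by (rule vector_derivative_diff_chain_within[OF dx[OF t] has_derivative_at_withinI[OF F(2)[OF xS]]])
    moreover have "((F \<circ> x) has_vector_derivative blinfun_apply (F' (x t)) (v t)) (at t within I)"
      by (rule vector_derivative_diff_chain_within[OF dx[OF t] has_derivative_at_withinI[OF F(3)[OF xS]]])
    then have "((\<lambda>s. blinfun_apply ((F \<circ> x) s) (v s)) has_vector_derivative
        blinfun_apply ((F \<circ> x) t) (H c (x t) (v t)) + blinfun_apply (blinfun_apply (F' (x t)) (v t)) (v t))
        (at t within I)"
      by (rule bounded_bilinear.has_vector_derivative[OF bounded_bilinear_blinfun_apply _ dv[OF t]])
    ultimately have "((\<lambda>s. ((transition c d \<circ> x) s, blinfun_apply ((F \<circ> x) s) (v s))) has_vector_derivative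
        (blinfun_apply (F (x t)) (v t),
         blinfun_apply ((F \<circ> x) t) (H c (x t) (v t)) + blinfun_apply (blinfun_apply (F' (x t)) (v t)) (v t)))
        (at t within I)"
      by (rule has_vector_derivative_Pair)
    moreover have "H d (snd d (?q t)) (jac c d (x t) (v t))
        = blinfun_apply (blinfun_apply (F' (x t)) (v t)) (v t) + blinfun_apply (F (x t)) (H c (x t) (v t))"
      using spray_transform[OF c d q(1)[OF t] qd, of "v t"] second_derivative[OF c d xS F(1,3)] q(2)[OF t] F(1)[OF xS]
      by simp
    ultimately have D: "((\<lambda>s. ((transition c d \<circ> x) s, blinfun_apply ((F \<circ> x) s) (v s))) has_vector_derivative
        (jac c d (x t) (v t), H d (snd d (?q t)) (jac c d (x t) (v t)))) (at t within I)"
      using F(1)[OF xS] by (simp add: add.commute)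
    obtain e where e: "e > 0" "\<And>s. s \<in> I \<Longrightarrow> dist s t < e \<Longrightarrow> x s \<in> ?S"
    proof -
      obtain r where r: "r > 0" "ball (x t) r \<subseteq> ?S"
        using overlap_open[OF c d] xS open_contains_ball by blast
      obtain e where "e > 0" "\<And>s. s \<in> I \<Longrightarrow> dist s t < e \<Longrightarrow> dist (x s) (x t) < r"
        using xc t r(1) unfolding continuous_on_iff by blast
      then show ?thesis using that r(2) by (metis dist_commute mem_ball subsetD)
    qed
    have "((\<lambda>s. snd (TM_chart A d) (lift A c (?q s) (v s))) has_vector_derivative
        (jac c d (x t) (v t), H d (snd d (?q t)) (jac c d (x t) (v t)))) (at t within I)"
    proof (rule has_vector_derivative_transform_within[OF D e(1) t])
      fix s assume s: "s \<in> I" "dist s t < e"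
      from e(2)[OF s] obtain p where p: "p \<in> fst c" "p \<in> fst d" "x s = snd c p" by blast
      then have "?q s = p" using c by simp
      then show "((transition c d \<circ> x) s, blinfun_apply ((F \<circ> x) s) (v s))
          = snd (TM_chart A d) (lift A c (?q s) (v s))"
        using p c d F(1)[OF e(2)[OF s]] lift_component[OF d p(2), of c "v s"]
        by (simp add: TM_chart_def lift_def)
    qed
    then show "((\<lambda>s. snd (TM_chart A d) (lift A c (?q s) (v s))) has_vector_derivative
        (snd (lift A c (?q t) (v t)) d,
         H d (snd d (fst (lift A c (?q t) (v t)))) (snd (lift A c (?q t) (v t)) d))) (at t within I)"
      using d qd q(2)[OF t] by (simp add: lift_def)
  qed
qed

text \<open>The Lipschitz constant \<open>L\<close> near \<open>(snd c p, 0)\<close> is valid for vectors of norm at most \<open>\<rho>\<close>.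
  Vectors of norm at most \<open>s\<close> are reduced to these by the factor \<open>\<rho> / s\<close>, and homogeneity
  multiplies the estimate by \<open>(s / \<rho>)\<^sup>2\<close>.\<close>

lemma quadratic_field_exists:
  assumes c: "c \<in> A" and p: "p \<in> fst c"
  obtains R K where "quadratic_field (H c) (snd c p) R K" "cball (snd c p) R \<subseteq> snd c ` fst c"
proof -
  let ?x0 = "snd c p" and ?U = "snd c ` fst c"
  have "(?x0, 0) \<in> ?U \<times> (UNIV :: 'a set)" using p by auto
  then obtain r L where r: "r > 0" and L: "L-lipschitz_on (ball (?x0, 0) r \<inter> ?U \<times> UNIV) (\<lambda>(x, v). H c x v)"
    using spray_lipschitz[OF c] unfolding locally_lipschitz_on_def by blast
  have L0: "L \<ge> 0" using L by (rule lipschitz_on_nonneg)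
  have "open ?U" using chart[OF c] by (simp add: is_chart_def)
  then obtain e where e: "e > 0" "cball ?x0 e \<subseteq> ?U" using p open_contains_cball[of ?U] by blast
  define \<rho> where "\<rho> = min e (r / 3)"
  have \<rho>: "\<rho> > 0" "\<rho> \<le> e" "\<rho> \<le> r / 3" using r e by (auto simp: \<rho>_def)
  define K where "K = L / \<rho>\<^sup>2 + L / \<rho>"
  have K0: "K \<ge> 0" using L0 \<rho> by (auto simp: K_def)
  have U: "x \<in> ?U" if "x \<in> cball ?x0 \<rho>" for x
    using that \<rho> e by auto
  have unit: "norm (H c x v - H c y w) \<le> L * (norm (x - y) + norm (v - w))"
    if "x \<in> cball ?x0 \<rho>" "y \<in> cball ?x0 \<rho>" "norm v \<le> \<rho>" "norm w \<le> \<rho>" for x y v w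
  proof -
    have mem: "(z, u) \<in> ball (?x0, 0) r \<inter> ?U \<times> UNIV" if "z \<in> cball ?x0 \<rho>" "norm u \<le> \<rho>" for z u
      using dist_Pair_le[of ?x0 0 z u] that U[OF that(1)] \<rho> r by auto
    have "dist (H c x v) (H c y w) \<le> L * dist (x, v) (y, w)"
      using lipschitz_onD[OF L mem mem, OF that(1,3,2,4)] by simp
    also have "\<dots> \<le> L * (dist x y + dist v w)" using L0 dist_Pair_le by (intro mult_left_mono) auto
    finally show ?thesis by (simp add: dist_norm)
  qed
  have "quadratic_field (H c) ?x0 \<rho> K"
  proof
    show "\<rho> > 0" "K \<ge> 0" by fact+
    show "H c x (s *\<^sub>R v) = s\<^sup>2 *\<^sub>R H c x v" if "x \<in> cball ?x0 \<rho>" "s > 0" for x v s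
      using spray_homogeneous[OF c U] that by blast
    fix x y v w :: 'a and s :: real
    assume a: "x \<in> cball ?x0 \<rho>" "y \<in> cball ?x0 \<rho>" "norm v \<le> s" "norm w \<le> s"
    show "norm (H c x v - H c y w) \<le> K * (s\<^sup>2 * norm (x - y) + s * norm (v - w))"
    proof (cases "s > 0")
      case True
      \<comment> \<open>the vectors are divided by \<open>k\<close> to reach norm at most \<open>\<rho>\<close>\<close>
      define k where "k = s / \<rho>"
      have k: "k > 0" using True \<rho> by (simp add: k_def)
      have scale: "norm ((1 / k) *\<^sub>R u) \<le> \<rho>" if "norm u \<le> s" for u :: 'a
        using that True \<rho> by (simp add: k_def field_simps)
      have hs: "H c z u = k\<^sup>2 *\<^sub>R H c z ((1 / k) *\<^sub>R u)" if "z \<in> cball ?x0 \<rho>" for z u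
        using spray_homogeneous[OF c U[OF that] k, of "(1 / k) *\<^sub>R u"] k by simp
      have "norm (H c x v - H c y w) = k\<^sup>2 * norm (H c x ((1 / k) *\<^sub>R v) - H c y ((1 / k) *\<^sub>R w))"
        unfolding hs[OF a(1), of v] hs[OF a(2), of w] by (simp flip: scaleR_diff_right)
      also have "\<dots> \<le> k\<^sup>2 * (L * (norm (x - y) + norm ((1 / k) *\<^sub>R v - (1 / k) *\<^sub>R w)))"
        using unit[OF a(1,2) scale scale, OF a(3,4)] by (intro mult_left_mono) auto
      also have "norm ((1 / k) *\<^sub>R v - (1 / k) *\<^sub>R w) = norm (v - w) / k"
        using k by (simp flip: scaleR_diff_right)
      also have "k\<^sup>2 * (L * (norm (x - y) + norm (v - w) / k))
          = L / \<rho>\<^sup>2 * (s\<^sup>2 * norm (x - y)) + L / \<rho> * (s * norm (v - w))"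
        using True \<rho> by (simp add: k_def field_simps power2_eq_square)
      also have "\<dots> \<le> K * (s\<^sup>2 * norm (x - y)) + K * (s * norm (v - w))"
        using L0 \<rho> True by (intro add_mono mult_right_mono) (auto simp: K_def)
      finally show ?thesis by (simp add: algebra_simps)
    next
      case False
      then have "norm v = 0" "norm w = 0" "s = 0"
        using a(3,4) norm_ge_zero[of v] norm_ge_zero[of w] by linarith+
      then have z: "v = 0" "w = 0" "s = 0" by auto
      have "H c z 0 = 0" if "z \<in> cball ?x0 \<rho>" for z
      proof -
        have "H c z 0 = 4 *\<^sub>R H c z 0" using spray_homogeneous[OF c U[OF that], of 2 0] by simp
        then have "3 *\<^sub>R H c z 0 = 0" by (simp add: scaleR_left_diff_distrib[of 4 1, simplified])
        then show ?thesis by simp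
      qed
      then show ?thesis using z a by simp
    qed
  qed
  then show ?thesis using that \<rho> e by (meson subset_cball subset_trans)
qed

end

section \<open>Forward uniqueness and reversal of time\<close>

lemma agree_at_left_end:
  fixes f g :: "real \<Rightarrow> 'b::t2_space"
  assumes f: "continuous (at b within {0..1}) f" and g: "continuous (at b within {0..1}) g"
    and b: "0 < b" "b \<le> 1" and eq: "\<And>s. s \<in> {0..<b} \<Longrightarrow> f s = g s"
  shows "f b = g b"
proof -
  have "(f \<longlongrightarrow> f b) (at b within {0..b})" "(g \<longlongrightarrow> g b) (at b within {0..b})"
    using b by (intro tendsto_within_subset[OF f[unfolded continuous_within]]
        tendsto_within_subset[OF g[unfolded continuous_within]]; simp)+
  then have lim: "(f \<longlongrightarrow> f b) (at_left b)" "(g \<longlongrightarrow> g b) (at_left b)"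
    using b by (simp_all add: at_within_Icc_at_left)
  have "\<forall>\<^sub>F s in at_left b. f s = g s"
    using b eq by (auto simp: eventually_at_left_field intro!: exI[of _ 0])
  with lim(1) have "(g \<longlongrightarrow> f b) (at_left b)" by (rule tendsto_cong[THEN iffD1, rotated])
  then show ?thesis using lim(2) tendsto_unique trivial_limit_at_left_real by blast
qed

lemma reverse_reverse [simp]: "reverse_spray (reverse_spray H) = H"
  by (simp add: reverse_spray_def)

lemma tscale_neg_neg [simp]: "tscale (- 1) (tscale (- 1) v) = v"
  by (simp add: tscale_def)

context sprayed_manifold
begin

lemma spray_solution_subset: "spray_solution A H I \<sigma> \<Longrightarrow> J \<subseteq> I \<Longrightarrow> spray_solution A H J \<sigma>"
  unfolding spray_solution_def
  by (meson continuous_on_subset has_vector_derivative_within_subset image_mono order_trans subsetD)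

lemma spray_solution_TM: "spray_solution A H I \<sigma> \<Longrightarrow> t \<in> I \<Longrightarrow> \<sigma> t \<in> TM A"
  unfolding spray_solution_def by blast

lemma tangent_eq_in_chart:
  assumes "c \<in> A" "v \<in> TM A" "w \<in> TM A" "fst v \<in> fst c" "fst w \<in> fst c"
    "snd c (fst v) = snd c (fst w)" "snd v c = snd w c"
  shows "v = w"
proof -
  have "fst w = fst v" using inj[OF assms(1)] assms(4-6) by (auto dest: inj_onD)
  with assms show ?thesis by (intro TM_eqI) auto
qed

text \<open>Observed for the short time \<open>e\<close> and reparametrized to \<open>[0, 1]\<close>, both solutions have speed at
  most \<open>r\<close>, and then they agree by \<open>difference_by_initial_values\<close>. The position of \<open>\<tau>\<close> is in
  the chart only near \<open>b\<close>, by continuity.\<close>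

lemma local_forward_unique:
  assumes c: "c \<in> A" and Q: "quadratic_field (H c) x0 R K"
    and \<sigma>: "spray_solution A H {0..1} \<sigma>" and \<tau>: "spray_solution A H {0..1} \<tau>"
    and b: "0 \<le> b" "b < 1" and eq: "\<tau> b = \<sigma> b"
    and \<sigma>_in: "\<And>t. t \<in> {0..1} \<Longrightarrow> fst (\<sigma> t) \<in> fst c \<and> snd c (fst (\<sigma> t)) \<in> ball x0 R"
  obtains e where "e > 0" "\<And>s. s \<in> {b..b + e} \<Longrightarrow> \<tau> s = \<sigma> s"
proof -
  interpret quadratic_field "H c" x0 R K by fact
  let ?I = "{0..1 :: real}"
  have bI: "b \<in> ?I" using b by simp
  define W where "W = {q \<in> fst c. snd c q \<in> ball x0 R}"
  have "open W" unfolding W_def by (rule chart_preimage_open[OF chart[OF c]]) simp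
  moreover have "fst (\<tau> b) \<in> W" using \<sigma>_in[OF bI] eq by (simp add: W_def)
  moreover have "((\<lambda>s. fst (\<tau> s)) \<longlongrightarrow> fst (\<tau> b)) (at b within ?I)"
    using \<tau> bI unfolding spray_solution_def continuous_on_def o_def by blast
  ultimately have "\<forall>\<^sub>F s in at b within ?I. fst (\<tau> s) \<in> W" by (metis topological_tendstoD)
  then obtain k where k: "k > 0" "\<And>s. s \<in> ?I \<Longrightarrow> s \<noteq> b \<Longrightarrow> dist s b < k \<Longrightarrow> fst (\<tau> s) \<in> W"
    unfolding eventually_at by blast
  define l where "l = min (k / 2) (1 - b)"
  have l: "l > 0" "l < k" "l \<le> 1 - b" using k b by (auto simp: l_def)
  let ?J = "{b..b + l}"
  have J: "?J \<subseteq> ?I" using l b by auto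
  have \<tau>W: "fst (\<tau> s) \<in> W" if "s \<in> ?J" for s
    using k(2)[of s] that l J \<open>fst (\<tau> b) \<in> W\<close> by (cases "s = b") (auto simp: dist_real_def)
  have \<sigma>W: "fst (\<sigma> s) \<in> W" if "s \<in> ?J" for s
    using \<sigma>_in[of s] that J by (auto simp: W_def)
  have sol\<sigma>: "solves (H c) ?J (\<lambda>t. snd c (fst (\<sigma> t))) (\<lambda>t. snd (\<sigma> t) c)"
    using \<sigma>W by (intro spray_solution_in_chart[OF \<sigma> c J]) (auto simp: W_def)
  have sol\<tau>: "solves (H c) ?J (\<lambda>t. snd c (fst (\<tau> t))) (\<lambda>t. snd (\<tau> t) c)"
    using \<tau>W by (intro spray_solution_in_chart[OF \<tau> c J]) (auto simp: W_def)
  have bdd: "\<exists>V. \<forall>t\<in>?J. norm (w t) \<le> V" if "solves (H c) ?J x w" for x w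
  proof -
    have "continuous_on ?J w"
      using that by (intro continuous_on_vector_derivative[where f' = "\<lambda>t. H c (x t) (w t)"])
        (auto simp: solves_def)
    then have "bounded (w ` ?J)" by (intro compact_imp_bounded compact_continuous_image) auto
    then show ?thesis by (auto simp: bounded_iff)
  qed
  obtain V1 V2 where V12: "\<And>t. t \<in> ?J \<Longrightarrow> norm (snd (\<sigma> t) c) \<le> V1"
      "\<And>t. t \<in> ?J \<Longrightarrow> norm (snd (\<tau> t) c) \<le> V2"
    using bdd[OF sol\<sigma>] bdd[OF sol\<tau>] by blast
  define V where "V = max 1 (max V1 V2)"
  have V: "V > 0" "\<And>t. t \<in> ?J \<Longrightarrow> norm (snd (\<sigma> t) c) \<le> V" "\<And>t. t \<in> ?J \<Longrightarrow> norm (snd (\<tau> t) c) \<le> V"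
    using V12 by (force simp: V_def)+
  define r where "r = min 1 (1 / (8 * (K + 1)))"
  have r: "r > 0" "r \<le> 1" "r \<le> 1 / (8 * (K + 1))" using K by (auto simp: r_def)
  have small: "K * (r\<^sup>2 + r) \<le> 1/4"
  proof -
    have "r\<^sup>2 \<le> r" using r by (simp add: power2_eq_square mult_left_le)
    then have "K * (r\<^sup>2 + r) \<le> (K + 1) * (r + r)" using K r by (intro mult_mono) auto
    also have "\<dots> \<le> 1/4" using r(3) K by (simp add: field_simps)
    finally show ?thesis .
  qed
  define e where "e = min l (r / V)"
  have e: "e > 0" "e \<le> l" "e * V \<le> r"
    using l r V(1) by (auto simp: e_def field_simps min_def)
  have eJ: "b + e * t \<in> ?J" if "t \<in> {0..1}" for t
  proof -
    have "e * t \<le> e * 1" "0 \<le> e * t" using that e(1) by (auto intro: mult_left_mono)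
    then show ?thesis using e(2) by simp
  qed
  have slow: "norm (e *\<^sub>R u) \<le> r" if "norm u \<le> V" for u :: 'a
  proof -
    have "e * norm u \<le> e * V" using that e(1) by (intro mult_left_mono) auto
    also have "\<dots> \<le> r" by (rule e(3))
    finally show ?thesis using e(1) by simp
  qed
  have inR: "snd c (fst (\<sigma> s)) \<in> cball x0 R" "snd c (fst (\<tau> s)) \<in> cball x0 R" if "s \<in> ?J" for s
    using \<sigma>W[OF that] \<tau>W[OF that] by (auto simp: W_def)
  have rs\<sigma>: "solves (H c) {0..1} (\<lambda>t. snd c (fst (\<sigma> (b + e * t)))) (\<lambda>t. e *\<^sub>R snd (\<sigma> (b + e * t)) c)"
    using hom[OF inR(1)[OF eJ] e(1)] by (intro solves_rescale[OF sol\<sigma> eJ]) auto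
  have rs\<tau>: "solves (H c) {0..1} (\<lambda>t. snd c (fst (\<tau> (b + e * t)))) (\<lambda>t. e *\<^sub>R snd (\<tau> (b + e * t)) c)"
    using hom[OF inR(2)[OF eJ] e(1)] by (intro solves_rescale[OF sol\<tau> eJ]) auto
  show ?thesis
  proof (rule that[OF e(1)])
    fix s assume s: "s \<in> {b..b + e}"
    define t where "t = (s - b) / e"
    have t: "t \<in> {0..1}" "b + e * t = s" using s e by (auto simp: t_def field_simps)
    note d = difference_by_initial_values[OF rs\<sigma> rs\<tau> inR(1)[OF eJ] inR(2)[OF eJ]
        slow[OF V(2)[OF eJ]] slow[OF V(3)[OF eJ]] small t(1)]
    have "snd c (fst (\<sigma> s)) = snd c (fst (\<tau> s))" "snd (\<sigma> s) c = snd (\<tau> s) c"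
      using d eq t(2) e(1) by auto
    moreover have "s \<in> ?J" using s e by auto
    moreover from this have "\<sigma> s \<in> TM A" "\<tau> s \<in> TM A"
      using spray_solution_TM[OF \<sigma>] spray_solution_TM[OF \<tau>] J by blast+
    ultimately show "\<tau> s = \<sigma> s"
      using \<sigma>W \<tau>W c by (intro tangent_eq_in_chart[where c = c]) (auto simp: W_def)
  qed
qed

text \<open>Consider the infimum \<open>b\<close> of the times where the solutions differ. They agree at \<open>b\<close>: first the
  positions, because the manifold is Hausdorff, so that both are in the chart at \<open>b\<close>, and then
  the velocities. But then they agree slightly beyond \<open>b\<close>. Only one of the solutions is assumed to
  stay in the chart; the other is an arbitrary competitor in the definition of the maximal solution.\<close>

lemma forward_unique:
  assumes c: "c \<in> A" and Q: "quadratic_field (H c) x0 R K"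
    and \<sigma>: "spray_solution A H {0..1} \<sigma>" and \<tau>: "spray_solution A H {0..1} \<tau>" and eq0: "\<tau> 0 = \<sigma> 0"
    and \<sigma>_in: "\<And>t. t \<in> {0..1} \<Longrightarrow> fst (\<sigma> t) \<in> fst c \<and> snd c (fst (\<sigma> t)) \<in> ball x0 R"
    and t: "t \<in> {0..1}"
  shows "\<tau> t = \<sigma> t"
proof (rule ccontr)
  assume neq: "\<tau> t \<noteq> \<sigma> t"
  let ?I = "{0..1 :: real}"
  define B where "B = {s \<in> ?I. \<tau> s \<noteq> \<sigma> s}"
  have tB: "t \<in> B" using t neq by (simp add: B_def)
  have bdd: "bdd_below B" by (rule bdd_belowI[of _ 0]) (simp add: B_def)
  define b where "b = Inf B"
  have b0: "0 \<le> b" unfolding b_def using tB by (intro cInf_greatest) (auto simp: B_def)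
  have le: "b \<le> s" if "s \<in> B" for s unfolding b_def using that bdd by (rule cInf_lower)
  have b1: "b \<le> 1" using le[OF tB] t by simp
  have before: "\<tau> s = \<sigma> s" if "s \<in> {0..<b}" for s
  proof (rule ccontr)
    assume "\<tau> s \<noteq> \<sigma> s"
    then have "s \<in> B" using that b1 by (simp add: B_def)
    with le[of s] that show False by simp
  qed
  have bI: "b \<in> ?I" using b0 b1 by simp
  have eqb: "\<tau> b = \<sigma> b"
  proof (cases "b = 0")
    case False
    have bpos: "0 < b" using False b0 by simp
    have cont: "continuous (at b within ?I) (\<lambda>s. fst (\<rho> s))" if "spray_solution A H ?I \<rho>" for \<rho>
      using that bI unfolding spray_solution_def continuous_on_eq_continuous_within o_def by blast
    have cont': "continuous (at b within ?I) (\<lambda>s. snd (TM_chart A c) (\<rho> s))"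
      if \<rho>: "spray_solution A H ?I \<rho>" "fst (\<rho> b) \<in> fst c" for \<rho>
    proof -
      have "((\<lambda>s. snd (TM_chart A c) (\<rho> s)) has_vector_derivative
          (snd (\<rho> b) c, H c (snd c (fst (\<rho> b))) (snd (\<rho> b) c))) (at b within ?I)"
        using \<rho> bI c unfolding spray_solution_def by blast
      then show ?thesis by (rule has_vector_derivative_continuous)
    qed
    have "fst (\<tau> b) = fst (\<sigma> b)"
      by (rule agree_at_left_end[OF cont[OF \<tau>] cont[OF \<sigma>] bpos b1]) (simp only: before)
    then have *: "fst (\<tau> b) \<in> fst c" "fst (\<sigma> b) \<in> fst c" using \<sigma>_in[OF bI] by auto
    have "snd (TM_chart A c) (\<tau> b) = snd (TM_chart A c) (\<sigma> b)"
      by (rule agree_at_left_end[OF cont'[OF \<tau> *(1)] cont'[OF \<sigma> *(2)] bpos b1]) (simp only: before)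
    then show ?thesis
      using * c bI spray_solution_TM[OF \<sigma>] spray_solution_TM[OF \<tau>]
      by (intro tangent_eq_in_chart[where c = c]) (auto simp: TM_chart_def)
  qed (use eq0 in simp)
  then have "b \<noteq> t" using neq by auto
  then have "b < 1" using le[OF tB] t by auto
  from local_forward_unique[OF c Q \<sigma> \<tau> b0 this eqb \<sigma>_in] obtain e where
    e: "e > 0" "\<And>s. s \<in> {b..b + e} \<Longrightarrow> \<tau> s = \<sigma> s" by blast
  have "b + e \<le> b"
    unfolding b_def
  proof (rule cInf_greatest)
    show "B \<noteq> {}" using tB by blast
    fix s assume s: "s \<in> B"
    then have "\<not> s \<in> {b..b + e}" using e(2) by (auto simp: B_def)
    then show "Inf B + e \<le> s" using le[OF s] by (simp add: b_def)
  qed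
  with e(1) show False by simp
qed

lemma tscale_TM:
  assumes v: "v \<in> TM A" shows "tscale s v \<in> TM A"
  unfolding TM_def tscale_def mem_Collect_eq case_prod_conv
proof (intro conjI ballI allI impI)
  fix c d assume cd: "c \<in> A" "d \<in> A" and q: "fst v \<in> fst c \<and> fst v \<in> fst d"
  have "linear (jac c d (snd c (fst v)))"
    using jac_derivative[OF cd] q has_derivative_linear by blast
  then show "s *\<^sub>R snd v d = frechet_derivative (transition c d) (at (snd c (fst v))) (s *\<^sub>R snd v c)"
    using TM_change[OF v cd] q by (simp add: linear_cmul jac_def)
next
  fix c assume "\<not> (c \<in> A \<and> fst v \<in> fst c)"
  then show "s *\<^sub>R snd v c = 0" using TM_off_chart[OF v] by simp
qed

text \<open>Reversal of time changes the sign of the velocity and keeps the acceleration, so the field at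
  the new velocity \<open>w\<close> is \<open>H\<close> at \<open>-w\<close>.\<close>

lemma spray_solution_reverse:
  assumes sol: "spray_solution A H I \<sigma>"
  shows "spray_solution A (reverse_spray H) (uminus ` I) (\<lambda>t. tscale (- 1) (\<sigma> (- t)))"
  unfolding spray_solution_def
proof (intro conjI ballI impI)
  show "(\<lambda>t. tscale (- 1) (\<sigma> (- t))) ` uminus ` I \<subseteq> TM A"
  proof (rule image_subsetI)
    fix t assume "t \<in> uminus ` I"
    then have "- t \<in> I" by auto
    then show "tscale (- 1) (\<sigma> (- t)) \<in> TM A" by (intro tscale_TM spray_solution_TM[OF sol])
  qed
  have "continuous_on I (fst \<circ> \<sigma>)" using sol unfolding spray_solution_def by blast
  then have fs: "continuous_on (uminus ` uminus ` I) (fst \<circ> \<sigma>)"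
    by (simp only: image_image minus_minus image_ident)
  have "continuous_on (uminus ` I) (uminus :: real \<Rightarrow> real)" by (intro continuous_intros)
  from continuous_on_compose[OF this fs]
  have "continuous_on (uminus ` I) ((fst \<circ> \<sigma>) \<circ> uminus)" .
  then show "continuous_on (uminus ` I) (fst \<circ> (\<lambda>t. tscale (- 1) (\<sigma> (- t))))"
    by (simp add: o_def tscale_def)
  fix c t assume c: "c \<in> A" and t: "t \<in> uminus ` I" and q: "fst (tscale (- 1) (\<sigma> (- t))) \<in> fst c"
  let ?I = "uminus ` I" and ?x = "snd c (fst (\<sigma> (- t)))" and ?v = "snd (\<sigma> (- t)) c"
  have "(uminus has_vector_derivative (- 1)) (at t within ?I)"
    by (auto intro!: derivative_eq_intros simp: has_vector_derivative_def)
  moreover have "((\<lambda>s. snd (TM_chart A c) (\<sigma> s)) has_vector_derivative (?v, H c ?x ?v))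
      (at (- t) within uminus ` ?I)"
    using sol c t q unfolding spray_solution_def by (auto simp: image_image tscale_def)
  ultimately have "((\<lambda>s. snd (TM_chart A c) (\<sigma> s)) \<circ> uminus has_vector_derivative
      (- 1) *\<^sub>R (?v, H c ?x ?v)) (at t within ?I)"
    by (rule vector_diff_chain_within)
  then have D: "((\<lambda>s. (snd c (fst (\<sigma> (- s))), snd (\<sigma> (- s)) c)) has_vector_derivative
      (- ?v, - H c ?x ?v)) (at t within ?I)"
    by (simp add: o_def TM_chart_def)
  have "((\<lambda>s. snd c (fst (\<sigma> (- s)))) has_vector_derivative - ?v) (at t within ?I)"
    using bounded_linear.has_vector_derivative[OF bounded_linear_fst D] by simp
  moreover have "((\<lambda>s. snd (\<sigma> (- s)) c) has_vector_derivative - H c ?x ?v) (at t within ?I)"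
    using bounded_linear.has_vector_derivative[OF bounded_linear_snd D] by simp
  then have "((\<lambda>s. - snd (\<sigma> (- s)) c) has_vector_derivative - (- H c ?x ?v)) (at t within ?I)"
    by (rule has_vector_derivative_minus)
  ultimately have "((\<lambda>s. (snd c (fst (\<sigma> (- s))), - snd (\<sigma> (- s)) c)) has_vector_derivative
      (- ?v, - (- H c ?x ?v))) (at t within ?I)"
    by (rule has_vector_derivative_Pair)
  then show "((\<lambda>s. snd (TM_chart A c) (tscale (- 1) (\<sigma> (- s)))) has_vector_derivative
      (snd (tscale (- 1) (\<sigma> (- t))) c,
       reverse_spray H c (snd c (fst (tscale (- 1) (\<sigma> (- t))))) (snd (tscale (- 1) (\<sigma> (- t))) c)))
      (at t within ?I)"
    by (simp add: TM_chart_def tscale_def reverse_spray_def)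
qed

lemma solution_from_reverse:
  assumes "solution_from A H v I \<sigma>"
  shows "solution_from A (reverse_spray H) (tscale (- 1) v) (uminus ` I) (\<lambda>t. tscale (- 1) (\<sigma> (- t)))"
proof -
  have I: "open I" "is_interval I" "0 \<in> I" "spray_solution A H I \<sigma>" "\<sigma> 0 = v"
    using assms by (auto simp: solution_from_def)
  have "open (uminus ` I)" using I(1) by (rule open_negations)
  moreover have "is_interval (uminus ` I)" using I(2) by simp
  moreover have "0 \<in> uminus ` I" using I(3) by (auto intro: image_eqI[of _ _ 0])
  ultimately show ?thesis using spray_solution_reverse[OF I(4)] I(5) by (simp add: solution_from_def)
qed

text \<open>One direction is reversal of time; the other is the same statement for the reverse spray,
  whose reverse is \<open>H\<close>.\<close>

lemma solution_from_reverse_iff: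
  "(\<exists>I \<sigma>. solution_from A (reverse_spray H) (tscale (- 1) v) I \<sigma> \<and> - t \<in> I \<and> q = fst (\<sigma> (- t)))
    \<longleftrightarrow> (\<exists>I \<sigma>. solution_from A H v I \<sigma> \<and> t \<in> I \<and> q = fst (\<sigma> t))" (is "?L \<longleftrightarrow> ?R")
proof
  assume ?R
  then obtain I \<sigma> where I: "solution_from A H v I \<sigma>" "t \<in> I" "q = fst (\<sigma> t)" by blast
  show ?L
    by (rule exI, rule exI, rule conjI[OF solution_from_reverse[OF I(1)]]) (use I in \<open>auto simp: tscale_def\<close>)
next
  assume ?L
  then obtain I \<sigma> where I: "solution_from A (reverse_spray H) (tscale (- 1) v) I \<sigma>" "- t \<in> I" "q = fst (\<sigma> (- t))"
    by blast
  interpret rev: sprayed_manifold A "reverse_spray H" by (rule reverse_sprayed)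
  show ?R
    by (rule exI, rule exI, rule conjI[OF rev.solution_from_reverse[OF I(1), simplified]])
       (use I in \<open>auto simp: tscale_def intro: image_eqI[of _ _ "- t"]\<close>)
qed

lemma rev_exp_eq_exp_reverse:
  assumes "v \<in> TM A"
  shows "rev_exp_map A H v = exp_map A (reverse_spray H) (tscale (- 1) v)"
    and "v \<in> rev_exp_domain A H \<longleftrightarrow> tscale (- 1) v \<in> exp_domain A (reverse_spray H)"
proof -
  have "maximal_solution A H v (- 1) = maximal_solution A (reverse_spray H) (tscale (- 1) v) 1"
    unfolding maximal_solution_def using solution_from_reverse_iff[of v "- 1"] by simp
  then show "rev_exp_map A H v = exp_map A (reverse_spray H) (tscale (- 1) v)"
    by (simp add: rev_exp_map_def exp_map_def exp_pt_def tscale_def)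
  have mi: "t \<in> maximal_interval A H v \<longleftrightarrow> - t \<in> maximal_interval A (reverse_spray H) (tscale (- 1) v)" for t
    using solution_from_reverse_iff[of v t] unfolding maximal_interval_def by blast
  have "{-1..0} \<subseteq> maximal_interval A H v \<longleftrightarrow> {0..1} \<subseteq> maximal_interval A (reverse_spray H) (tscale (- 1) v)"
  proof
    assume a: "{-1..0} \<subseteq> maximal_interval A H v"
    show "{0..1} \<subseteq> maximal_interval A (reverse_spray H) (tscale (- 1) v)"
    proof
      fix t :: real assume "t \<in> {0..1}"
      then have "- t \<in> maximal_interval A H v" using a by auto
      then show "t \<in> maximal_interval A (reverse_spray H) (tscale (- 1) v)" using mi[of "- t"] by simp
    qed
  next
    assume a: "{0..1} \<subseteq> maximal_interval A (reverse_spray H) (tscale (- 1) v)"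
    show "{-1..0} \<subseteq> maximal_interval A H v"
    proof
      fix t :: real assume "t \<in> {-1..0}"
      then have "- t \<in> maximal_interval A (reverse_spray H) (tscale (- 1) v)" using a by auto
      then show "t \<in> maximal_interval A H v" using mi[of t] by simp
    qed
  qed
  then show "v \<in> rev_exp_domain A H \<longleftrightarrow> tscale (- 1) v \<in> exp_domain A (reverse_spray H)"
    using assms tscale_TM by (simp add: rev_exp_domain_def exp_domain_def)
qed

end

section \<open>Coordinate balls\<close>

context C21_atlas
begin

lemma chart_set_image:
  assumes c: "c \<in> A" and D0: "D0 \<subseteq> snd c ` fst c \<times> UNIV"
  defines "S \<equiv> fst (TM_chart A c) \<inter> snd (TM_chart A c) -` D0"
  shows "snd (TM_chart A c) ` S = D0"
proof
  show "D0 \<subseteq> snd (TM_chart A c) ` S"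
  proof
    fix z assume z: "z \<in> D0"
    then obtain q u where q: "q \<in> fst c" "z = (snd c q, u)" using D0 by (cases z) auto
    have "lift A c q u \<in> S" using lift_in_chart[OF c q(1), of u] z q(2) by (simp add: S_def)
    then show "z \<in> snd (TM_chart A c) ` S"
      using lift_in_chart(2)[OF c q(1), of u] q(2) by (metis image_eqI)
  qed
qed (auto simp: S_def)

lemma topspace_TM_subset:
  "S \<subseteq> fst (TM_chart A c) \<Longrightarrow> topspace (subtopology (TM_topology A) S) = S"
  using topspace_TM by (auto simp: TM_chart_def TM_over_def)

lemma fst_tscale: "fst (tscale s v) = fst v"
  by (simp add: tscale_def)

lemma TM_chart_tscale:
  "snd (TM_chart A c) (tscale s v) = (fst (snd (TM_chart A c) v), s *\<^sub>R snd (snd (TM_chart A c) v))"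
  by (simp add: TM_chart_def tscale_def)

text \<open>The form in which the result is used twice, for \<open>exp\<close> and for the reverse exponential map:
  \<open>D0\<close> and \<open>g\<close> are the coordinate expressions of the domain and of the map.\<close>

lemma star_lipeomorphic_from_coordinates:
  assumes c: "c \<in> A" and C: "C \<subseteq> fst c"
    and D0: "open D0" "D0 \<subseteq> snd c ` C \<times> UNIV"
    and star: "\<And>a u s. (a, u) \<in> D0 \<Longrightarrow> s \<in> {0..1} \<Longrightarrow> (a, s *\<^sub>R u) \<in> D0"
    and tscale: "\<And>v s. v \<in> TM A \<Longrightarrow> tscale s v \<in> TM A"
    and f: "\<And>v. v \<in> fst (TM_chart A c) \<Longrightarrow> snd (TM_chart A c) v \<in> D0 \<Longrightarrow>
       v \<in> E \<and> f v \<in> C \<times> C \<and> map_prod (snd c) (snd c) (f v) = g (snd (TM_chart A c) v)"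
    and g: "locally_lipschitz_on D0 g" and g': "locally_lipschitz_on (snd c ` C \<times> snd c ` C) g'"
    and gg': "\<And>z. z \<in> D0 \<Longrightarrow> g' (g z) = z"
    and g'g: "\<And>z. z \<in> snd c ` C \<times> snd c ` C \<Longrightarrow> g' z \<in> D0 \<and> g (g' z) = z"
  shows "star_lipeomorphic_onto_square A E f C"
proof -
  define S where "S = fst (TM_chart A c) \<inter> snd (TM_chart A c) -` D0"
  have SD: "snd (TM_chart A c) ` S = D0"
    unfolding S_def using D0(2) C by (intro chart_set_image[OF c]) auto
  have Sc: "S \<subseteq> fst (TM_chart A c)" by (auto simp: S_def)
  have SC: "S \<subseteq> TM_over A C"
  proof
    fix v assume v: "v \<in> S"
    then have m: "v \<in> TM A" "fst v \<in> fst c" "snd c (fst v) \<in> snd c ` C"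
      using D0(2) by (auto simp: S_def TM_chart_def TM_over_def)
    then have "fst v \<in> C" using inj[OF c] C by (auto dest: inj_onD)
    then show "v \<in> TM_over A C" using m by (simp add: TM_over_def)
  qed
  have "openin (TM_topology A) S" unfolding S_def by (rule TM_chart_open[OF c D0(1)])
  then have "openin (subtopology (TM_topology A) (TM_over A C)) S"
    using SC by (auto simp: openin_subtopology)
  moreover have "star_shaped S"
    unfolding star_shaped_def
  proof (intro ballI)
    fix v s assume v: "v \<in> S" and s: "s \<in> {0..1 :: real}"
    have "tscale s v \<in> fst (TM_chart A c)"
      using v tscale[of v s] by (auto simp: S_def TM_chart_def TM_over_def tscale_def)
    moreover have "snd (TM_chart A c) (tscale s v) \<in> D0"
      using star[of _ _ s] v s by (simp add: S_def TM_chart_tscale)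
    ultimately show "tscale s v \<in> S" by (simp add: S_def)
  qed
  moreover have "S \<subseteq> E" using f by (auto simp: S_def)
  moreover have "lipeomorphism (subtopology (TM_topology A) S) (TM_chart A ` A)
      (top_of_set (C \<times> C)) (prod_charts A) f"
  proof (rule lipeomorphism_through_charts[OF adapted_TM_chart[OF c Sc] adapted_square_chart[OF c C],
        where g = g and g' = g', unfolded topspace_TM_subset[OF Sc] SD])
    have im: "snd (square_chart c) ` topspace (top_of_set (C \<times> C)) = snd c ` C \<times> snd c ` C"
      by (auto simp: square_chart_def)
    show "f x \<in> topspace (top_of_set (C \<times> C)) \<and> snd (square_chart c) (f x) = g (snd (TM_chart A c) x)"
      if "x \<in> S" for x
      using f[of x] that by (simp add: S_def square_chart_def)
    show "locally_lipschitz_on (snd (square_chart c) ` topspace (top_of_set (C \<times> C))) g'"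
      using g' im by simp
    show "g' z \<in> D0 \<and> g (g' z) = z" if "z \<in> snd (square_chart c) ` topspace (top_of_set (C \<times> C))" for z
      using g'g that im by blast
  qed (use g gg' in auto)
  ultimately show ?thesis unfolding star_lipeomorphic_onto_square_def by blast
qed

end

locale sprayed_ball = sprayed_manifold A H + small_quadratic_field "H c" "snd c p" R K \<delta>
  for A :: "('m::t2_space, 'a::euclidean_space) chart set" and H :: "('m, 'a) spray"
    and c :: "('m, 'a) chart" and p :: 'm and R K \<delta> +
  assumes c: "c \<in> A" and p: "p \<in> fst c" and R_chart: "cball (snd c p) R \<subseteq> snd c ` fst c"
begin

abbreviation "point \<equiv> inv_into (fst c) (snd c)"
abbreviation "C \<equiv> coordinate_ball c p \<delta>"

lemma point: assumes "x \<in> cball (snd c p) R" shows "point x \<in> fst c" "snd c (point x) = x"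
  using R_chart assms by (auto simp: inv_into_into f_inv_into_f subset_iff)

lemma C_chart: "C \<subseteq> fst c" by (auto simp: coordinate_ball_def)

lemma ball_R: "x \<in> cball (snd c p) \<delta> \<Longrightarrow> x \<in> cball (snd c p) R"
  using flow_ball_in_domain small_ball_in_flow_ball by blast

lemma C_image: "snd c ` C = ball (snd c p) \<delta>"
proof
  show "ball (snd c p) \<delta> \<subseteq> snd c ` C"
  proof
    fix x assume x: "x \<in> ball (snd c p) \<delta>"
    then have "x \<in> cball (snd c p) R" by (intro ball_R) auto
    from point[OF this] show "x \<in> snd c ` C" using x by (auto simp: coordinate_ball_def image_iff)
  qed
qed (auto simp: coordinate_ball_def)

lemma C_open: "open C"
  unfolding coordinate_ball_def by (rule chart_preimage_open[OF chart[OF c]]) simp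

text \<open>The closed coordinate ball is compact as the image of a compact ball, hence closed in the
  Hausdorff manifold. This is where it matters that the ball is relatively compact in the chart.\<close>

lemma closure_C: "closure C \<subseteq> {q \<in> fst c. snd c q \<in> cball (snd c p) \<delta>}"
proof -
  have "{q \<in> fst c. snd c q \<in> cball (snd c p) \<delta>} = point ` cball (snd c p) \<delta>"
  proof
    show "point ` cball (snd c p) \<delta> \<subseteq> {q \<in> fst c. snd c q \<in> cball (snd c p) \<delta>}"
      using point[OF ball_R] by auto
    show "{q \<in> fst c. snd c q \<in> cball (snd c p) \<delta>} \<subseteq> point ` cball (snd c p) \<delta>"
      using c by (auto simp del: mem_cball intro!: image_eqI[of _ point "snd c _"])
  qed
  moreover have "compact (point ` cball (snd c p) \<delta>)"
    using ball_R R_chart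
    by (intro compact_continuous_image continuous_on_subset[OF chart_inv_continuous[OF chart[OF c]]]) auto
  ultimately have "closed {q \<in> fst c. snd c q \<in> cball (snd c p) \<delta>}"
    by (simp add: compact_imp_closed)
  then show ?thesis by (intro closure_minimal) (auto simp: coordinate_ball_def)
qed

lemma joins_spray_solution:
  assumes j: "joins a b x v"
  shows "spray_solution A H {-1..2} (\<lambda>t. lift A c (point (x t)) (v t))"
proof (rule spray_solution_lift[OF c])
  show "solves (H c) {-1..2} x v" using j by (simp add: joins_def)
  show "x ` {-1..2} \<subseteq> snd c ` fst c" using j flow_ball_in_domain R_chart by (auto simp: joins_def)
qed

text \<open>The curve found in coordinates is a solution on \<open>(-1, 2)\<close> from \<open>u\<close>, and by forward uniqueness
  every other solution from \<open>u\<close> that reaches time \<open>1\<close> ends at the same point.\<close>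

lemma joins_exp:
  assumes j: "joins a b x v" and u: "u \<in> TM A" "fst u \<in> fst c" "snd c (fst u) = a" "snd u c = v 0"
  shows "u \<in> exp_domain A H" "exp_pt A H u = point b"
proof -
  define \<sigma> where "\<sigma> t = lift A c (point (x t)) (v t)" for t
  let ?J = "{-1<..<2 :: real}"
  have sol: "spray_solution A H ?J \<sigma>"
    unfolding \<sigma>_def[abs_def] by (rule spray_solution_subset[OF joins_spray_solution[OF j]]) auto
  have x17: "x t \<in> cball (snd c p) (17 * \<delta>)" if "t \<in> {-1..2}" for t
    using j that by (auto simp: joins_def)
  have xR: "x t \<in> ball (snd c p) R" if "t \<in> {-1..2}" for t
    using x17[OF that] \<delta>(3) by simp
  have q: "fst (\<sigma> t) = point (x t)" "fst (\<sigma> t) \<in> fst c" "snd c (fst (\<sigma> t)) = x t" "snd (\<sigma> t) c = v t"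
    if "t \<in> {-1..2}" for t
  proof -
    have "x t \<in> cball (snd c p) R" using xR[OF that] by auto
    note pt = point[OF this]
    show "fst (\<sigma> t) = point (x t)" "fst (\<sigma> t) \<in> fst c" "snd c (fst (\<sigma> t)) = x t" "snd (\<sigma> t) c = v t"
      using lift_TM[OF c pt(1)] pt by (simp_all add: \<sigma>_def)
  qed
  have "\<sigma> 0 = u"
    using q[of 0] u joinsD(2)[OF j] spray_solution_TM[OF sol, of 0] c
    by (intro tangent_eq_in_chart[where c = c]) auto
  then have start: "solution_from A H u ?J \<sigma>" using sol by (simp add: solution_from_def)
  then show "u \<in> exp_domain A H"
    using u(1) unfolding exp_domain_def maximal_interval_def by fastforce
  have "maximal_solution A H u 1 = fst (\<sigma> 1)"
    unfolding maximal_solution_def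
  proof (rule the_equality)
    show "\<exists>I \<tau>. solution_from A H u I \<tau> \<and> 1 \<in> I \<and> fst (\<sigma> 1) = fst (\<tau> 1)"
      using start by (intro exI[of _ ?J] exI[of _ \<sigma>]) auto
    fix q' assume "\<exists>I \<tau>. solution_from A H u I \<tau> \<and> 1 \<in> I \<and> q' = fst (\<tau> 1)"
    then obtain I \<tau> where \<tau>: "solution_from A H u I \<tau>" "1 \<in> I" "q' = fst (\<tau> 1)" by blast
    have "{0..1} \<subseteq> I"
      using \<tau>(1,2) unfolding solution_from_def is_interval_1 by (meson atLeastAtMost_iff subsetI)
    then have \<tau>sol: "spray_solution A H {0..1} \<tau>"
      using \<tau>(1) spray_solution_subset unfolding solution_from_def by blast
    have \<sigma>sol: "spray_solution A H {0..1} \<sigma>" by (rule spray_solution_subset[OF sol]) auto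
    have eq0: "\<tau> 0 = \<sigma> 0" using \<tau>(1) start by (simp add: solution_from_def)
    have "fst (\<sigma> t) \<in> fst c \<and> snd c (fst (\<sigma> t)) \<in> ball (snd c p) R" if "t \<in> {0..1}" for t
    proof -
      have t: "t \<in> {-1..2}" using that by auto
      show ?thesis using q(2,3)[OF t] xR[OF t] by simp
    qed
    from forward_unique[OF c quadratic_field_axioms \<sigma>sol \<tau>sol eq0 this, of 1]
    have "\<tau> 1 = \<sigma> 1" by simp
    then show "q' = fst (\<sigma> 1)" using \<tau>(3) by simp
  qed
  then show "exp_pt A H u = point b"
    using q(1)[of 1] joinsD(3)[OF j] by (simp add: exp_pt_def)
qed

lemma exp_in_chart:
  assumes v: "v \<in> fst (TM_chart A c)" "snd (TM_chart A c) v \<in> launch_set"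
  shows "v \<in> exp_domain A H" "exp_map A H v \<in> C \<times> C"
    "map_prod (snd c) (snd c) (exp_map A H v) = land (snd (TM_chart A c) v)"
proof -
  obtain a b where ab: "a \<in> ball (snd c p) \<delta>" "b \<in> ball (snd c p) \<delta>"
      "snd (TM_chart A c) v = launch (a, b)"
    using v(2) by (auto simp: launch_set_def)
  have m: "v \<in> TM A" "fst v \<in> fst c" "snd c (fst v) = a" "snd v c = vel a b"
    using v(1) ab(3) by (auto simp: TM_chart_def TM_over_def launch_def)
  obtain x w where j: "joins a b x w" "w 0 = vel a b" using joins_vel[of a b] ab by auto
  note e = joins_exp[OF j(1) m(1-3)]
  show "v \<in> exp_domain A H" using e(1) m(4) j(2) by simp
  have eb: "exp_pt A H v = point b" using e(2) m(4) j(2) by simp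
  have pb: "point b \<in> fst c" "snd c (point b) = b" using point[of b] ball_R[of b] ab by auto
  show "exp_map A H v \<in> C \<times> C"
    using m pb ab eb by (simp add: exp_map_def coordinate_ball_def)
  show "map_prod (snd c) (snd c) (exp_map A H v) = land (snd (TM_chart A c) v)"
    using land_launch[of "(a, b)"] ab m pb eb by (simp add: exp_map_def)
qed

lemma launch_set_over_C: "launch_set \<subseteq> snd c ` C \<times> UNIV"
  unfolding C_image by (auto simp: launch_set_def launch_def)

lemma land_locally_lipschitz: "locally_lipschitz_on launch_set land"
  by (rule lipschitz_on_imp_locally_lipschitz_on[OF land_lipschitz])

lemma launch_locally_lipschitz: "locally_lipschitz_on (snd c ` C \<times> snd c ` C) launch"
  unfolding C_image by (rule lipschitz_on_imp_locally_lipschitz_on[OF launch_lipschitz])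

lemma exp_star_lipeomorphic: "star_lipeomorphic_onto_square A (exp_domain A H) (exp_map A H) C"
proof (rule star_lipeomorphic_from_coordinates[OF c C_chart launch_set_open launch_set_over_C, where g = land and g' = launch])
  show "launch z \<in> launch_set \<and> land (launch z) = z" if "z \<in> snd c ` C \<times> snd c ` C" for z
    using that land_launch unfolding C_image by (auto simp: launch_set_def)
qed (use launch_set_star tscale_TM exp_in_chart land_locally_lipschitz launch_locally_lipschitz launch_land in auto)

text \<open>The exponential map at \<open>q\<close> is the restriction of \<open>land\<close> to the fibre over \<open>q\<close>, followed by
  the projection to the second factor.\<close>

lemma normal_neighborhood_C:
  assumes q: "q \<in> C"
  shows "normal_neighborhood A H q C"
proof -
  let ?\<psi> = "snd (TM_chart A c)" and ?a = "snd c q"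
  have qc: "q \<in> fst c" using q C_chart by blast
  have a: "?a \<in> ball (snd c p) \<delta>" using q by (simp add: coordinate_ball_def)
  define Z where "Z = {z \<in> launch_set. fst z = ?a}"
  define S where "S = fst (TM_chart A c) \<inter> ?\<psi> -` Z"
  have Sc: "S \<subseteq> fst (TM_chart A c)" by (auto simp: S_def)
  have SZ: "?\<psi> ` S = Z"
    unfolding S_def using launch_set_over_C C_chart by (intro chart_set_image[OF c]) (auto simp: Z_def)
  have S_eq: "S = (fst (TM_chart A c) \<inter> ?\<psi> -` launch_set) \<inter> TM_over A {q}"
    using inj[OF c] qc by (auto simp: S_def Z_def TM_chart_def TM_over_def dest: inj_onD)
  have "openin (subtopology (TM_topology A) (TM_over A {q})) S"
    using TM_chart_open[OF c launch_set_open] unfolding S_eq by (auto simp: openin_subtopology)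
  moreover have "star_shaped S"
    unfolding star_shaped_def
  proof (intro ballI)
    fix v s assume v: "v \<in> S" and s: "s \<in> {0..1 :: real}"
    have "tscale s v \<in> fst (TM_chart A c)"
      using v tscale_TM[of v s] by (auto simp: S_def TM_chart_def TM_over_def tscale_def)
    moreover have "?\<psi> (tscale s v) \<in> Z"
    proof -
      have "?\<psi> v \<in> launch_set" "fst (?\<psi> v) = ?a" using v by (auto simp: S_def Z_def)
      then have "(?a, snd (?\<psi> v)) \<in> launch_set" by (metis prod.collapse)
      from launch_set_star[OF this s] show ?thesis using v by (simp add: S_def Z_def TM_chart_tscale)
    qed
    ultimately show "tscale s v \<in> S" by (simp add: S_def)
  qed
  moreover have "S \<subseteq> exp_domain A H" using exp_in_chart(1) by (auto simp: S_def Z_def)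
  moreover have "lipeomorphism (subtopology (TM_topology A) S) (TM_chart A ` A)
      (top_of_set C) A (exp_pt A H)"
  proof (rule lipeomorphism_through_charts[OF adapted_TM_chart[OF c Sc] adapted_chart_base[OF c C_chart],
        where g = "snd \<circ> land" and g' = "launch \<circ> Pair ?a", unfolded topspace_TM_subset[OF Sc] SZ])
    fix v assume "v \<in> S"
    then have "v \<in> fst (TM_chart A c)" "?\<psi> v \<in> launch_set" by (auto simp: S_def Z_def)
    from exp_in_chart(2,3)[OF this]
    show "exp_pt A H v \<in> topspace (top_of_set C) \<and> snd c (exp_pt A H v) = (snd \<circ> land) (?\<psi> v)"
      by (auto simp: exp_map_def map_prod_def dest: arg_cong[of _ _ snd])
  next
    have "locally_lipschitz_on Z land"
      by (rule locally_lipschitz_on_subset[OF land_locally_lipschitz]) (auto simp: Z_def)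
    then show "locally_lipschitz_on Z (snd \<circ> land)"
      by (rule locally_lipschitz_on_compose[OF _ locally_lipschitz_on_snd[of UNIV]]) simp
    have "1-lipschitz_on (snd c ` C) (Pair ?a)"
      by (rule lipschitz_onI) (auto simp: dist_Pair_Pair)
    then have "locally_lipschitz_on (snd c ` C) (Pair ?a)"
      by (rule lipschitz_on_imp_locally_lipschitz_on)
    then have "locally_lipschitz_on (snd c ` C) (launch \<circ> Pair ?a)"
      by (rule locally_lipschitz_on_compose[OF _ launch_locally_lipschitz]) (use q in auto)
    then show "locally_lipschitz_on (snd c ` topspace (top_of_set C)) (launch \<circ> Pair ?a)" by simp
  next
    fix z assume "z \<in> Z"
    then obtain b where "b \<in> ball (snd c p) \<delta>" "z = launch (?a, b)"
      by (auto simp: Z_def launch_set_def launch_def)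
    then show "(launch \<circ> Pair ?a) ((snd \<circ> land) z) = z" using land_launch[of "(?a, b)"] a by simp
  next
    fix y assume "y \<in> snd c ` topspace (top_of_set C)"
    then have "y \<in> ball (snd c p) \<delta>" using C_image by simp
    then show "(launch \<circ> Pair ?a) y \<in> Z \<and> (snd \<circ> land) ((launch \<circ> Pair ?a) y) = y"
      using land_launch[of "(?a, y)"] a by (auto simp: Z_def launch_set_def launch_def)
  qed
  ultimately show ?thesis using C_open q unfolding normal_neighborhood_def by blast
qed

text \<open>Existence is \<open>joins_exists\<close> for points of the closed ball. A competitor \<open>\<eta>\<close> stays in the
  closed ball, so \<open>speed_bound\<close> makes it slow and \<open>joins_unique\<close> applies.\<close>

lemma strictly_convex_C: "strictly_convex_normal A H C"
  unfolding strictly_convex_normal_def convex_normal_def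
proof (intro conjI ballI impI)
  show "open C" by (rule C_open)
  show "normal_neighborhood A H q C" if "q \<in> C" for q using normal_neighborhood_C[OF that] .
next
  fix q q' assume "q \<in> closure C" "q' \<in> closure C" and ne: "q \<noteq> q'"
  then have q: "q \<in> fst c" "snd c q \<in> cball (snd c p) \<delta>" "q' \<in> fst c" "snd c q' \<in> cball (snd c p) \<delta>"
    using closure_C by blast+
  let ?a = "snd c q" and ?b = "snd c q'"
  have ab: "?a \<noteq> ?b" using inj[OF c] q(1,3) ne by (auto dest: inj_onD)
  obtain x v where j: "joins ?a ?b x v" using joins_exists[OF q(2,4)] by blast
  define \<gamma> where "\<gamma> t = point (x t)" for t
  have sol: "spray_solution A H {0..1} (\<lambda>t. lift A c (point (x t)) (v t))"
    by (rule spray_solution_subset[OF joins_spray_solution[OF j]]) auto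
  have \<gamma>01: "\<gamma> 0 = q" "\<gamma> 1 = q'" using joinsD(2,3)[OF j] q c by (auto simp: \<gamma>_def)
  have "geodesic A H {0..1} \<gamma>"
    unfolding geodesic_def
  proof
    show "\<exists>w. spray_solution A H {0..1} (\<lambda>t. (\<gamma> t, w t))"
      using sol by (intro exI[of _ "\<lambda>t. snd (lift A c (point (x t)) (v t))"]) (simp add: \<gamma>_def lift_def)
    show "\<not> \<gamma> constant_on {0..1}"
      using \<gamma>01 ne unfolding constant_on_def by (metis atLeastAtMost_iff order_refl zero_le_one)
  qed
  moreover have "\<gamma> ` {0<..<1} \<subseteq> C"
  proof clarify
    fix t :: real assume t: "t \<in> {0<..<1}"
    then have "x t \<in> ball (snd c p) \<delta>" using joins_inside[OF j ab q(2,4)] by simp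
    then show "\<gamma> t \<in> C"
      using point[of "x t"] ball_R[of "x t"] by (simp add: \<gamma>_def coordinate_ball_def)
  qed
  ultimately have conn: "connects_inside A H C q q' \<gamma>" using \<gamma>01 by (simp add: connects_inside_def)
  have "\<eta> t = \<gamma> t" if \<eta>: "connects_inside A H C q q' \<eta>" and t: "t \<in> {0..1}" for \<eta> t
  proof -
    obtain w where w: "spray_solution A H {0..1} (\<lambda>t. (\<eta> t, w t))"
      using \<eta> by (auto simp: connects_inside_def geodesic_def)
    have e01: "\<eta> 0 = q" "\<eta> 1 = q'" and im: "\<eta> ` {0<..<1} \<subseteq> C"
      using \<eta> by (auto simp: connects_inside_def)
    have mem: "\<eta> s \<in> fst c \<and> snd c (\<eta> s) \<in> cball (snd c p) \<delta>" if "s \<in> {0..1}" for s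
    proof -
      consider "s = 0" | "s = 1" | "s \<in> {0<..<1}" using \<open>s \<in> {0..1}\<close> by force
      then show ?thesis
      proof cases
        case 3
        then have "\<eta> s \<in> C" using im by blast
        then show ?thesis by (auto simp: coordinate_ball_def)
      qed (use q e01 in auto)
    qed
    have sol': "solves (H c) {0..1} (\<lambda>t. snd c (\<eta> t)) (\<lambda>t. w t c)"
      using spray_solution_in_chart[OF w c order_refl] mem by simp
    have "snd c (\<eta> t) = x t"
      by (rule joins_unique(1)[OF j sol'])
         (use mem e01 speed_bound[OF sol'] t small_ball_in_flow_ball in auto)
    then show ?thesis using mem[OF t] c by (metis \<gamma>_def inv_chart)
  qed
  with conn show "\<exists>\<gamma>. connects_inside A H C q q' \<gamma> \<and>
      (\<forall>\<eta>. connects_inside A H C q q' \<eta> \<longrightarrow> (\<forall>t\<in>{0..1}. \<eta> t = \<gamma> t))" by blast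
qed

end

text \<open>The domain and the map are those of the exponential map of the reverse spray, transported by
  \<open>v \<mapsto> -v\<close>.\<close>

lemma rev_exp_star_lipeomorphic:
  assumes F: "sprayed_manifold A H" and B: "sprayed_ball A (reverse_spray H) c p R K \<delta>"
  shows "star_lipeomorphic_onto_square A (rev_exp_domain A H) (rev_exp_map A H) (coordinate_ball c p \<delta>)"
proof -
  interpret sprayed_manifold A H by fact
  interpret B: sprayed_ball A "reverse_spray H" c p R K \<delta> by fact
  define neg :: "'b \<times> 'b \<Rightarrow> 'b \<times> 'b" where "neg = (\<lambda>(a, u). (a, - u))"
  have nn [simp]: "neg (neg z) = z" for z by (simp add: neg_def case_prod_unfold)
  have neg_lip: "locally_lipschitz_on S neg" for S
    by (rule lipschitz_on_imp_locally_lipschitz_on[of 1], rule lipschitz_onI)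
       (auto simp: neg_def dist_Pair_Pair dist_minus)
  have vimage: "neg -` B.launch_set = neg ` B.launch_set"
    by (auto intro: image_eqI[of _ neg "neg _"])
  have "continuous_on UNIV neg" using locally_lipschitz_on_continuous[OF neg_lip] .
  then have open_D: "open (neg -` B.launch_set)" using B.launch_set_open by (simp add: open_vimage)
  show ?thesis
  proof (rule star_lipeomorphic_from_coordinates[OF B.c B.C_chart open_D,
        where g = "B.land \<circ> neg" and g' = "neg \<circ> B.launch"])
    show "neg -` B.launch_set \<subseteq> snd c ` B.C \<times> UNIV" using B.launch_set_over_C by (auto simp: neg_def)
    show "(a, s *\<^sub>R u) \<in> neg -` B.launch_set" if "(a, u) \<in> neg -` B.launch_set" "s \<in> {0..1}" for a u s
      using B.launch_set_star[of a "- u" s] that by (simp add: neg_def)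
    show "v \<in> rev_exp_domain A H \<and> rev_exp_map A H v \<in> B.C \<times> B.C \<and>
        map_prod (snd c) (snd c) (rev_exp_map A H v) = (B.land \<circ> neg) (snd (TM_chart A c) v)"
      if v: "v \<in> fst (TM_chart A c)" "snd (TM_chart A c) v \<in> neg -` B.launch_set" for v
    proof -
      have m: "v \<in> TM A" using v(1) by (simp add: TM_chart_def TM_over_def)
      have e: "snd (TM_chart A c) (tscale (- 1) v) = neg (snd (TM_chart A c) v)"
        by (simp add: TM_chart_tscale neg_def case_prod_unfold)
      have "tscale (- 1) v \<in> fst (TM_chart A c)"
        using v(1) tscale_TM[OF m, of "- 1"] by (simp add: TM_chart_def TM_over_def fst_tscale)
      moreover have "snd (TM_chart A c) (tscale (- 1) v) \<in> B.launch_set" using v(2) e by simp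
      ultimately show ?thesis
        using B.exp_in_chart[of "tscale (- 1) v"] e rev_exp_eq_exp_reverse[OF m] by simp
    qed
    show "locally_lipschitz_on (neg -` B.launch_set) (B.land \<circ> neg)"
      by (rule locally_lipschitz_on_compose[OF neg_lip B.land_locally_lipschitz]) auto
    show "locally_lipschitz_on (snd c ` B.C \<times> snd c ` B.C) (neg \<circ> B.launch)"
      by (rule locally_lipschitz_on_compose[OF B.launch_locally_lipschitz neg_lip[of UNIV]]) simp
    show "(neg \<circ> B.launch) ((B.land \<circ> neg) z) = z" if "z \<in> neg -` B.launch_set" for z
      using B.launch_land[of "neg z"] that by simp
    show "(neg \<circ> B.launch) z \<in> neg -` B.launch_set \<and> (B.land \<circ> neg) ((neg \<circ> B.launch) z) = z"
      if "z \<in> snd c ` B.C \<times> snd c ` B.C" for z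
      using that B.land_launch unfolding B.C_image by (auto simp: B.launch_set_def)
  qed (rule tscale_TM)
qed

text \<open>The radius and the constant of the field do not depend on \<open>\<delta>\<close>, so the conditions of
  smallness hold for all small \<open>\<delta>\<close> at once.\<close>

lemma (in sprayed_manifold) small_balls:
  assumes c: "c \<in> A" and p: "p \<in> fst c"
  obtains \<delta>0 R K where "\<delta>0 > 0" "\<And>\<delta>. 0 < \<delta> \<Longrightarrow> \<delta> < \<delta>0 \<Longrightarrow> sprayed_ball A H c p R K \<delta>"
proof -
  obtain R K where Q: "quadratic_field (H c) (snd c p) R K" and R: "cball (snd c p) R \<subseteq> snd c ` fst c"
    using quadratic_field_exists[OF c p] by blast
  interpret Q: quadratic_field "H c" "snd c p" R K by fact
  define \<delta>0 where "\<delta>0 = min 1 (min (R / 17) (1 / (2000 * (K + 1))))"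
  have "\<delta>0 > 0" using Q.R Q.K by (simp add: \<delta>0_def)
  moreover have "sprayed_ball A H c p R K \<delta>" if \<delta>: "0 < \<delta>" "\<delta> < \<delta>0" for \<delta>
  proof
    show "0 < \<delta>" "\<delta> \<le> 1" "17 * \<delta> < R" using \<delta> by (auto simp: \<delta>0_def)
    have "2000 * (K + 1) * \<delta> \<le> 1" using \<delta> Q.K by (simp add: \<delta>0_def field_simps)
    then show "2000 * K * \<delta> \<le> 1" using \<delta> by (simp add: algebra_simps)
  qed (use c p R in auto)
  ultimately show ?thesis using that by blast
qed

theorem theorem4:
  fixes A :: "('m::t2_space, real ^ 'n) chart set"
    and H :: "('m, real ^ 'n) spray"
    and p :: 'm and N :: "'m set"
  assumes "C21_manifold A"
    and "locally_lipschitz_spray A H"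
    and "open N" and "p \<in> N"
  shows
    "(\<exists>C. open C \<and> p \<in> C \<and> C \<subseteq> N \<and>
        reversible_strictly_convex_normal A H C \<and>
        star_lipeomorphic_onto_square A (exp_domain A H) (exp_map A H) C \<and>
        star_lipeomorphic_onto_square A (rev_exp_domain A H) (rev_exp_map A H) C) \<and>
     (\<forall>c\<in>A. p \<in> fst c \<longrightarrow>
        (\<exists>\<delta>\<^sub>0>0. \<forall>\<delta>. 0 < \<delta> \<and> \<delta> < \<delta>\<^sub>0 \<longrightarrow>
           ball (snd c p) \<delta> \<subseteq> snd c ` fst c \<and>
           (let C = coordinate_ball c p \<delta> in
             open C \<and> p \<in> C \<and> C \<subseteq> N \<and>
             reversible_strictly_convex_normal A H C \<and>
             star_lipeomorphic_onto_square A (exp_domain A H) (exp_map A H) C \<and>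
             star_lipeomorphic_onto_square A (rev_exp_domain A H) (rev_exp_map A H) C)))"
proof -
  interpret F: sprayed_manifold A H
    by unfold_locales (use assms in \<open>auto simp: C21_manifold_def\<close>)
  interpret B: sprayed_manifold A "reverse_spray H" by (rule F.reverse_sprayed)
  let ?good = "\<lambda>C. open C \<and> p \<in> C \<and> C \<subseteq> N \<and> reversible_strictly_convex_normal A H C \<and>
      star_lipeomorphic_onto_square A (exp_domain A H) (exp_map A H) C \<and>
      star_lipeomorphic_onto_square A (rev_exp_domain A H) (rev_exp_map A H) C"
  have balls: "\<exists>\<delta>\<^sub>0>0. \<forall>\<delta>. 0 < \<delta> \<and> \<delta> < \<delta>\<^sub>0 \<longrightarrow>
      ball (snd c p) \<delta> \<subseteq> snd c ` fst c \<and> ?good (coordinate_ball c p \<delta>)"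
    if c: "c \<in> A" and p: "p \<in> fst c" for c
  proof -
    obtain \<delta>1 R K where 1: "\<delta>1 > 0" "\<And>\<delta>. 0 < \<delta> \<Longrightarrow> \<delta> < \<delta>1 \<Longrightarrow> sprayed_ball A H c p R K \<delta>"
      using F.small_balls[OF c p] by blast
    obtain \<delta>2 R' K' where 2: "\<delta>2 > 0"
        "\<And>\<delta>. 0 < \<delta> \<Longrightarrow> \<delta> < \<delta>2 \<Longrightarrow> sprayed_ball A (reverse_spray H) c p R' K' \<delta>"
      using B.small_balls[OF c p] by blast
    have "open (snd c ` (fst c \<inter> N))" by (rule chart_image_open[OF F.chart[OF c] assms(3)])
    then obtain \<delta>3 where 3: "\<delta>3 > 0" "ball (snd c p) \<delta>3 \<subseteq> snd c ` (fst c \<inter> N)"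
      using p assms(4) open_contains_ball by (metis IntI image_eqI)
    show ?thesis
    proof (intro exI[of _ "min \<delta>1 (min \<delta>2 \<delta>3)"] conjI allI impI)
      show "min \<delta>1 (min \<delta>2 \<delta>3) > 0" using 1 2 3 by simp
      fix \<delta> assume \<delta>: "0 < \<delta> \<and> \<delta> < min \<delta>1 (min \<delta>2 \<delta>3)"
      interpret FB: sprayed_ball A H c p R K \<delta> using 1(2) \<delta> by simp
      interpret BB: sprayed_ball A "reverse_spray H" c p R' K' \<delta> using 2(2) \<delta> by simp
      have sub: "ball (snd c p) \<delta> \<subseteq> snd c ` (fst c \<inter> N)" using 3(2) \<delta> by auto
      then show "ball (snd c p) \<delta> \<subseteq> snd c ` fst c" by blast
      show "open (coordinate_ball c p \<delta>)" by (rule FB.C_open)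
      show "p \<in> coordinate_ball c p \<delta>" using p \<delta> by (simp add: coordinate_ball_def)
      show "coordinate_ball c p \<delta> \<subseteq> N"
      proof
        fix q assume q: "q \<in> coordinate_ball c p \<delta>"
        then have "snd c q \<in> snd c ` (fst c \<inter> N)" using sub by (auto simp: coordinate_ball_def)
        then obtain q' where q': "q' \<in> fst c" "q' \<in> N" "snd c q = snd c q'" by blast
        then have "q = q'" using F.inj[OF c] q by (auto simp: coordinate_ball_def dest: inj_onD)
        with q' show "q \<in> N" by simp
      qed
      show "reversible_strictly_convex_normal A H (coordinate_ball c p \<delta>)"
        unfolding reversible_strictly_convex_normal_def
        using FB.strictly_convex_C BB.strictly_convex_C by blast
      show "star_lipeomorphic_onto_square A (exp_domain A H) (exp_map A H) (coordinate_ball c p \<delta>)"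
        by (rule FB.exp_star_lipeomorphic)
      show "star_lipeomorphic_onto_square A (rev_exp_domain A H) (rev_exp_map A H) (coordinate_ball c p \<delta>)"
        by (rule rev_exp_star_lipeomorphic[OF F.sprayed_manifold_axioms BB.sprayed_ball_axioms])
    qed
  qed
  have "p \<in> (\<Union>c\<in>A. fst c)" using F.structure_A by (simp add: C21_structure_def)
  then obtain c where c: "c \<in> A" "p \<in> fst c" by blast
  from balls[OF this] obtain \<delta>\<^sub>0 where \<delta>\<^sub>0: "\<delta>\<^sub>0 > 0"
    "\<And>\<delta>. 0 < \<delta> \<and> \<delta> < \<delta>\<^sub>0 \<Longrightarrow> ?good (coordinate_ball c p \<delta>)" by blast
  have "?good (coordinate_ball c p (\<delta>\<^sub>0 / 2))" by (rule \<delta>\<^sub>0(2)) (use \<delta>\<^sub>0(1) in simp)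
  then have "\<exists>C. ?good C" by blast
  with balls show ?thesis unfolding Let_def by blast
qed

end
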